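(* Let $X$ be a smooth projective toric variety over a field $\mathbb{K}$ with total coordinate ring $S$. Then $\operatorname{reg} S \subseteq \operatorname{Nef} X$. In particular, $\operatorname{reg} S$ contains finitely many minimal elements with respect to the partial order $\leq$ on $\operatorname{Pic}X$.
   Context: $X$ is a smooth projective toric variety over a field $\mathbb{K}$, determined by a fan $\Sigma$. Its total coordinate (Cox) ring $S$ is the polynomial ring over $\mathbb{K}$ with one variable $x_\rho$ for each ray $\rho$ of $\Sigma$, graded by $\operatorname{Pic} X$ with $\deg x_\rho$ the class of the torus-invariant prime divisor $D_\rho$. The irrelevant ideal is $B=\langle \prod_{\rho\not\subset\sigma}x_\rho : \sigma\in\Sigma\rangle\subset S$, and $H^i_B(M)$ is local cohomology with support in $B$. $\operatorname{Nef}X\subset\operatorname{Pic}X$ is the monoid of classes of numerically effective divisors, and $\mathbf C=(\mathbf c_1,\dots,\mathbf c_r)$ are its minimal monoid generators. For $\lambda\in\mathbb{Z}^r$ write $\lambda\cdot\mathbf C=\lambda_1\mathbf c_1+\dots+\lambda_r\mathbf c_r$ and $|\lambda|=\lambda_1+\dots+\lambda_r$. For $\mathbf a,\mathbf b\in\operatorname{Pic}X$, $\mathbf a\le\mathbf b$ means $\mathbf b-\mathbf a\in\operatorname{Nef}X$. $\mathbb{N}$ includes $0$. Multigraded regularity: for $\mathbf d\in\operatorname{Pic}X$, a graded $S$-module $M$ is $\mathbf d$-regular if (1) $H^i_B(M)_{\mathbf b}=0$ for all $i>0$ and all $\mathbf b\in\bigcup_{\lambda\in\mathbb{N}^r,\,|\lambda|=i-1}(\mathbf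 d-\lambda\cdot\mathbf C+\operatorname{Nef}X)$; and (2) $H^0_B(M)_{\mathbf b}=0$ for all $\mathbf b\in\bigcup_j(\mathbf d+\mathbf c_j+\operatorname{Nef}X)$. $\operatorname{reg}M\subseteq\operatorname{Pic}X$ is the set of $\mathbf d$ such that $M$ is $\mathbf d$-regular; $\operatorname{reg}S$ is the case $M=S$. *)

theory Defs
  imports
    "HOL-Algebra.Free_Abelian_Groups"
    "HOL-Algebra.Algebraic_Closure_Type"
    "HOL-Computational_Algebra.Fraction_Field"
begin

section \<open>Smooth projective fans\<close>

text \<open>
  The toric variety \<open>X\<close> is given by its fan \<open>F\<close>.  A fan in the lattice \<open>N = \<int>\<^sup>n\<close>
  (\<open>n\<close> is \<open>rk\<close>; \<open>n = 0\<close> is allowed) is stored as its set of rays, the primitive lattice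
  generator \<open>u\<^sub>\<rho> = gen \<rho>\<close> of each ray (only the coordinates \<open>i < n\<close> matter), and for each cone
  the set of rays it contains.  As smooth cones are simplicial, the faces of a cone are exactly
  the cones on the subsets of its rays.
\<close>

record 'r fan =
  rk :: nat
  rays :: "'r set"
  gen :: "'r \<Rightarrow> nat \<Rightarrow> int"
  cones :: "'r set set"

definition pairing :: "'r fan \<Rightarrow> (nat \<Rightarrow> int) \<Rightarrow> 'r \<Rightarrow> int" where
  "pairing F m \<rho> = (\<Sum>i<rk F. m i * gen F \<rho> i)"

definition real_cone :: "'r fan \<Rightarrow> 'r set \<Rightarrow> (nat \<Rightarrow> real) set" where
  "real_cone F \<sigma> =
     {w. (\<forall>i\<ge>rk F. w i = 0) \<and>
         (\<exists>c. (\<forall>\<rho>\<in>\<sigma>. 0 \<le> c \<rho>) \<and> (\<forall>i<rk F. w i = (\<Sum>\<rho>\<in>\<sigma>. c \<rho> * of_int (gen F \<rho> i))))}"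

definition lattice_basis :: "nat \<Rightarrow> (nat \<Rightarrow> nat \<Rightarrow> int) \<Rightarrow> bool" where
  "lattice_basis n b \<longleftrightarrow>
     (\<forall>w. \<exists>!c. (\<forall>j\<ge>n. c j = 0) \<and> (\<forall>i<n. w i = (\<Sum>j<n. c j * b j i)))"

definition smooth_cone :: "'r fan \<Rightarrow> 'r set \<Rightarrow> bool" where
  "smooth_cone F \<sigma> \<longleftrightarrow>
     (\<exists>b f. lattice_basis (rk F) b \<and> inj_on f \<sigma> \<and> f ` \<sigma> \<subseteq> {..<rk F} \<and>
            (\<forall>\<rho>\<in>\<sigma>. \<forall>i<rk F. gen F \<rho> i = b (f \<rho>) i))"

definition smooth_fan :: "'r fan \<Rightarrow> bool" where
  "smooth_fan F \<longleftrightarrow>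
     finite (rays F) \<and> {} \<in> cones F \<and> \<Union>(cones F) = rays F \<and>
     (\<forall>\<sigma>\<in>cones F. \<forall>\<tau>\<subseteq>\<sigma>. \<tau> \<in> cones F) \<and>
     (\<forall>\<sigma>\<in>cones F. \<forall>\<tau>\<in>cones F. real_cone F \<sigma> \<inter> real_cone F \<tau> = real_cone F (\<sigma> \<inter> \<tau>)) \<and>
     (\<forall>\<sigma>\<in>cones F. smooth_cone F \<sigma>)"

definition complete_fan :: "'r fan \<Rightarrow> bool" where
  "complete_fan F \<longleftrightarrow> (\<Union>\<sigma>\<in>cones F. real_cone F \<sigma>) = {w. \<forall>i\<ge>rk F. w i = 0}"

definition maximal_cones :: "'r fan \<Rightarrow> 'r set set" where
  "maximal_cones F = {\<sigma>\<in>cones F. \<forall>\<tau>\<in>cones F. \<sigma> \<subseteq> \<tau> \<longrightarrow> \<sigma> = \<tau>}"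

text \<open>
  A complete toric variety is projective iff some divisor \<open>\<Sum>\<^sub>\<rho> a\<^sub>\<rho> D\<^sub>\<rho>\<close> has a strictly convex support
  function, that is, iff the fan is the inner normal fan of the lattice polytope
  \<open>{m. \<forall>\<rho>. \<langle>m, u\<^sub>\<rho>\<rangle> \<ge> - a\<^sub>\<rho>}\<close>, whose vertex belonging to the maximal cone \<open>\<sigma>\<close> is the \<open>m\<close> below.
\<close>

definition strictly_convex :: "'r fan \<Rightarrow> ('r \<Rightarrow> int) \<Rightarrow> bool" where
  "strictly_convex F a \<longleftrightarrow>
     (\<forall>\<sigma>\<in>maximal_cones F. \<exists>m. (\<forall>\<rho>\<in>\<sigma>. pairing F m \<rho> = - a \<rho>) \<and>
                               (\<forall>\<rho>\<in>rays F - \<sigma>. pairing F m \<rho> > - a \<rho>))"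

definition smooth_projective_fan :: "'r fan \<Rightarrow> bool" where
  "smooth_projective_fan F \<longleftrightarrow>
     smooth_fan F \<and> complete_fan F \<and> (\<exists>a. strictly_convex F a)"


section \<open>The Picard group\<close>

text \<open>
  As \<open>X\<close> is smooth, \<open>Pic X = Cl X\<close> is the group of torus-invariant divisors modulo the divisors
  of characters.  It is a quotient group of HOL-Algebra, hence written multiplicatively:
  the operation is the addition of divisor classes.
\<close>

definition tdivisor :: "'r fan \<Rightarrow> ('r \<Rightarrow> int) \<Rightarrow> 'r \<Rightarrow>\<^sub>0 int" where
  "tdivisor F a = (\<Sum>\<rho>\<in>rays F. Poly_Mapping.single \<rho> (a \<rho>))"

definition principal :: "'r fan \<Rightarrow> ('r \<Rightarrow>\<^sub>0 int) set" where
  "principal F = range (\<lambda>m. tdivisor F (pairing F m))"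

definition Pic :: "'r fan \<Rightarrow> ('r \<Rightarrow>\<^sub>0 int) set monoid" where
  "Pic F = free_Abelian_group (rays F) Mod principal F"

definition divisor_class :: "'r fan \<Rightarrow> ('r \<Rightarrow>\<^sub>0 int) \<Rightarrow> ('r \<Rightarrow>\<^sub>0 int) set" where
  "divisor_class F D = principal F #>\<^bsub>free_Abelian_group (rays F)\<^esub> D"


section \<open>Curves and numerically effective classes\<close>

text \<open>
  Every function field of one variable over \<open>K\<close> is a finite extension of some \<open>K(t)\<close>, so it embeds
  over \<open>K\<close> into an algebraic closure of \<open>K(t)\<close>.  Normal complete curves over \<open>K\<close> are therefore
  represented by the subfields \<open>L\<close> of this closure that are finitely generated and not algebraic
  over \<open>K\<close>.
\<close>

type_synonym 'k ambient = "'k poly fract alg_closure"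

definition const :: "'k::field \<Rightarrow> 'k ambient" where
  "const c = to_ac (Fract [:c:] 1)"

definition is_subfield :: "'a::field set \<Rightarrow> bool" where
  "is_subfield L \<longleftrightarrow>
     1 \<in> L \<and> (\<forall>x\<in>L. \<forall>y\<in>L. x - y \<in> L \<and> x * y \<in> L) \<and> (\<forall>x\<in>L. inverse x \<in> L)"

definition function_field :: "'k::field ambient set \<Rightarrow> bool" where
  "function_field L \<longleftrightarrow>
     (\<exists>A. finite A \<and> L = \<Inter>{E. is_subfield E \<and> range const \<union> A \<subseteq> E}) \<and>
     (\<exists>t\<in>L. \<forall>p. p \<noteq> 0 \<longrightarrow> poly (map_poly const p) t \<noteq> 0)"

text \<open>
  The closed points of the curve are the normalised discrete valuations of \<open>L\<close> over \<open>K\<close>.  For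
  definiteness the valuation is set to \<open>0\<close> at \<open>0\<close> and outside \<open>L\<close>.
\<close>

definition place :: "'k::field ambient set \<Rightarrow> ('k ambient \<Rightarrow> int) \<Rightarrow> bool" where
  "place L v \<longleftrightarrow>
     (\<forall>x. x \<notin> L - {0} \<longrightarrow> v x = 0) \<and>
     (\<forall>x\<in>L - {0}. \<forall>y\<in>L - {0}. v (x * y) = v x + v y) \<and>
     (\<forall>x\<in>L - {0}. \<forall>y\<in>L - {0}. x + y \<noteq> 0 \<longrightarrow> min (v x) (v y) \<le> v (x + y)) \<and>
     (\<forall>c. c \<noteq> 0 \<longrightarrow> v (const c) = 0) \<and>
     (\<exists>x\<in>L - {0}. v x = 1)"

text \<open>
  The degree of a closed point is the \<open>K\<close>-dimension of the residue field, i.e. the largest number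
  of elements of the valuation ring that are linearly independent over \<open>K\<close> modulo the maximal
  ideal.
\<close>

definition place_degree :: "'k::field ambient set \<Rightarrow> ('k ambient \<Rightarrow> int) \<Rightarrow> nat" where
  "place_degree L v =
     (GREATEST d. \<exists>B. finite B \<and> card B = d \<and> B \<subseteq> {x\<in>L. x = 0 \<or> 0 \<le> v x} \<and>
        (\<forall>c. (let s = (\<Sum>x\<in>B. const (c x) * x) in s = 0 \<or> 0 < v s) \<longrightarrow> (\<forall>x\<in>B. c x = 0)))"

text \<open>
  A morphism from the normal complete curve with function field \<open>L\<close> to \<open>X\<close> is the same as an
  \<open>L\<close>-valued point of the complete variety \<open>X\<close>.  Such a point is given by homogeneous coordinates
  \<open>x\<^sub>\<rho> \<in> L\<close> outside the zero locus of the irrelevant ideal: the vanishing coordinates have to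
  form a cone.
\<close>

definition curve_in :: "'r fan \<Rightarrow> 'k::field ambient set \<Rightarrow> ('r \<Rightarrow> 'k ambient) \<Rightarrow> bool" where
  "curve_in F L x \<longleftrightarrow>
     function_field L \<and> (\<forall>\<rho>\<in>rays F. x \<rho> \<in> L) \<and> {\<rho>\<in>rays F. x \<rho> = 0} \<in> cones F"

text \<open>
  Near the place \<open>v\<close>, with uniformiser \<open>\<pi>\<close>, the homogeneous coordinates can be rescaled to
  \<open>\<pi>\<^bsup>g \<rho>\<^esup> x\<^sub>\<rho>\<close>, where \<open>\<Sum>\<^sub>\<rho> g \<rho> u\<^sub>\<rho> = 0\<close> means that \<open>g\<close> is a one-parameter subgroup of
  \<open>Hom(Pic X, \<G>\<^sub>m)\<close>, so that they are integral and their reduction is again outside the zero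
  locus of the irrelevant ideal.  If the curve is not contained in \<open>D\<^sub>\<rho>\<close> then \<open>ord_v \<rho>\<close> is the
  vanishing order of \<open>\<pi>\<^bsup>g \<rho>\<^esup> x\<^sub>\<rho>\<close> at \<open>v\<close>, i.e. the multiplicity at \<open>v\<close> of the pullback of
  \<open>D\<^sub>\<rho>\<close>; it is then uniquely determined.  The value of \<open>ord_v\<close> at other \<open>\<rho>\<close> is irrelevant.
\<close>

definition is_multiplicity ::
  "'r fan \<Rightarrow> ('r \<Rightarrow> 'k::field ambient) \<Rightarrow> ('k ambient \<Rightarrow> int) \<Rightarrow> ('r \<Rightarrow> int) \<Rightarrow> bool" where
  "is_multiplicity F x v ord_v \<longleftrightarrow>
     (\<exists>g. (\<forall>i<rk F. (\<Sum>\<rho>\<in>rays F. g \<rho> * gen F \<rho> i) = 0) \<and>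
          (\<forall>\<rho>\<in>rays F. x \<rho> \<noteq> 0 \<longrightarrow> ord_v \<rho> = v (x \<rho>) + g \<rho> \<and> 0 \<le> ord_v \<rho>)) \<and>
     {\<rho>\<in>rays F. x \<rho> = 0 \<or> 0 < ord_v \<rho>} \<in> cones F"

definition pullback_mult ::
  "'r fan \<Rightarrow> ('r \<Rightarrow> 'k::field ambient) \<Rightarrow> ('r \<Rightarrow>\<^sub>0 int) \<Rightarrow> ('k ambient \<Rightarrow> int) \<Rightarrow> int" where
  "pullback_mult F x D v =
     (\<Sum>\<rho>\<in>rays F. Poly_Mapping.lookup D \<rho> * (SOME ord_v. is_multiplicity F x v ord_v) \<rho>)"

definition pullback_degree ::
  "'r fan \<Rightarrow> 'k::field ambient set \<Rightarrow> ('r \<Rightarrow> 'k ambient) \<Rightarrow> ('r \<Rightarrow>\<^sub>0 int) \<Rightarrow> int" where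
  "pullback_degree F L x D =
     (\<Sum>v\<in>{v. place L v \<and> pullback_mult F x D v \<noteq> 0}.
        int (place_degree L v) * pullback_mult F x D v)"

text \<open>
  The intersection number of the divisor class \<open>b\<close> with the curve: represent \<open>b\<close> by a
  divisor \<open>D\<close> none of whose components contains the curve and take the degree of the
  pullback of \<open>D\<close>.  Such a \<open>D\<close> exists, and the degree does not depend on it, since principal
  divisors on a complete curve have degree \<open>0\<close>; so exactly one \<open>z\<close> satisfies this relation.
\<close>

definition intersection_number ::
  "'r fan \<Rightarrow> 'k::field ambient set \<Rightarrow> ('r \<Rightarrow> 'k ambient) \<Rightarrow> ('r \<Rightarrow>\<^sub>0 int) set \<Rightarrow> int \<Rightarrow> bool" where
  "intersection_number F L x b z \<longleftrightarrow>
     (\<exists>D\<in>b. (\<forall>\<rho>\<in>rays F. x \<rho> = 0 \<longrightarrow> Poly_Mapping.lookup D \<rho> = 0) \<and> z = pullback_degree F L x D)"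

definition Nef :: "'k::field itself \<Rightarrow> 'r fan \<Rightarrow> ('r \<Rightarrow>\<^sub>0 int) set set" where
  "Nef _ F =
     {b \<in> carrier (Pic F).
        \<forall>(L :: 'k ambient set) x. curve_in F L x \<longrightarrow> (\<exists>z\<ge>0. intersection_number F L x b z)}"

definition nef_le ::
  "'k::field itself \<Rightarrow> 'r fan \<Rightarrow> ('r \<Rightarrow>\<^sub>0 int) set \<Rightarrow> ('r \<Rightarrow>\<^sub>0 int) set \<Rightarrow> bool" where
  "nef_le K F a b \<longleftrightarrow> b \<otimes>\<^bsub>Pic F\<^esub> inv\<^bsub>Pic F\<^esub> a \<in> Nef K F"

inductive_set submonoid_generated :: "('a, 'b) monoid_scheme \<Rightarrow> 'a set \<Rightarrow> 'a set"
  for G :: "('a, 'b) monoid_scheme" and C :: "'a set" where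
  one: "\<one>\<^bsub>G\<^esub> \<in> submonoid_generated G C"
| step: "c \<in> C \<Longrightarrow> a \<in> submonoid_generated G C \<Longrightarrow> c \<otimes>\<^bsub>G\<^esub> a \<in> submonoid_generated G C"

definition nef_generators :: "'k::field itself \<Rightarrow> 'r fan \<Rightarrow> ('r \<Rightarrow>\<^sub>0 int) set set" where
  "nef_generators K F =
     (THE C. C \<subseteq> carrier (Pic F) \<and> submonoid_generated (Pic F) C = Nef K F \<and>
             (\<forall>C'. C' \<subset> C \<longrightarrow> submonoid_generated (Pic F) C' \<noteq> Nef K F))"


section \<open>The Cox ring and local cohomology\<close>

text \<open>
  Polynomials are finitely supported functions on exponents.  The type \<open>'r\<close> may have elements
  that are not rays; the corresponding variables are excluded in \<open>cox_component\<close>, the graded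
  pieces of the Cox ring \<open>S\<close>.
\<close>

type_synonym ('r, 'k) mpoly = "('r \<Rightarrow>\<^sub>0 nat) \<Rightarrow>\<^sub>0 'k"

definition monomial_degree :: "'r fan \<Rightarrow> ('r \<Rightarrow>\<^sub>0 nat) \<Rightarrow> ('r \<Rightarrow>\<^sub>0 int) set" where
  "monomial_degree F e = divisor_class F (tdivisor F (\<lambda>\<rho>. int (Poly_Mapping.lookup e \<rho>)))"

definition cox_component :: "'r fan \<Rightarrow> ('r \<Rightarrow>\<^sub>0 int) set \<Rightarrow> ('r, 'k::field) mpoly set" where
  "cox_component F b =
     {p. \<forall>e\<in>Poly_Mapping.keys p. Poly_Mapping.keys e \<subseteq> rays F \<and> monomial_degree F e = b}"

definition irrelevant_exponent :: "'r fan \<Rightarrow> 'r set \<Rightarrow> 'r \<Rightarrow>\<^sub>0 nat" where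
  "irrelevant_exponent F \<sigma> = (\<Sum>\<rho>\<in>rays F - \<sigma>. Poly_Mapping.single \<rho> 1)"

definition irrelevant_generator :: "'r fan \<Rightarrow> 'r set \<Rightarrow> ('r, 'k::field) mpoly" where
  "irrelevant_generator F \<sigma> = Poly_Mapping.single (irrelevant_exponent F \<sigma>) 1"

text \<open>
  Local cohomology with support in \<open>B\<close> is the cohomology of the Cech complex on the generators
  \<open>f\<^sub>\<sigma> = \<Prod>\<^bsub>\<rho> \<notin> \<sigma>\<^esub> x\<^sub>\<rho>\<close> (\<open>\<sigma> \<in> \<Sigma>\<close>) of \<open>B\<close>, with terms
  \<open>C\<^sup>i = \<Oplus> M[f\<^sub>I\<^sup>-\<^sup>1]\<close>, where \<open>I \<subseteq> \<Sigma>\<close>, \<open>card I = i\<close> and \<open>f\<^sub>I = \<Prod>\<^bsub>\<sigma> \<in> I\<^esub> f\<^sub>\<sigma>\<close>.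
  A graded \<open>S\<close>-module is given by its scalar multiplication \<open>s\<close> and its graded pieces \<open>M b\<close>.
  As \<open>\<Sigma>\<close> is finite, a cochain can be written with a common exponent \<open>k\<close> as the family
  \<open>m I / f\<^sub>I\<^sup>k\<close>; it has degree \<open>b\<close> iff the numerators can be chosen such that \<open>m I\<close> has degree
  \<open>b + k deg f\<^sub>I\<close>.
\<close>

definition denominator :: "'r fan \<Rightarrow> 'r set set \<Rightarrow> ('r, 'k::field) mpoly" where
  "denominator F I = (\<Prod>\<sigma>\<in>I. irrelevant_generator F \<sigma>)"

definition denominator_degree :: "'r fan \<Rightarrow> 'r set set \<Rightarrow> ('r \<Rightarrow>\<^sub>0 int) set" where
  "denominator_degree F I = monomial_degree F (\<Sum>\<sigma>\<in>I. irrelevant_exponent F \<sigma>)"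

text \<open>Equality of \<open>m / f\<^sup>k\<close> and \<open>m' / f\<^bsup>k'\<^esup>\<close> in the localisation of a module.\<close>

definition fraction_eq ::
  "('s::comm_ring_1 \<Rightarrow> 'm::ab_group_add \<Rightarrow> 'm) \<Rightarrow> 's \<Rightarrow> 'm \<times> nat \<Rightarrow> 'm \<times> nat \<Rightarrow> bool" where
  "fraction_eq s f = (\<lambda>(m, k) (m', k'). \<exists>l. s (f ^ l) (s (f ^ k') m - s (f ^ k) m') = 0)"

text \<open>An arbitrary enumeration of the cones, needed for the signs in the Cech complex.\<close>

definition cone_index :: "'r fan \<Rightarrow> 'r set \<Rightarrow> nat" where
  "cone_index F = (SOME f. inj_on f (cones F))"

definition cech_cochain ::
  "'r fan \<Rightarrow> (('r \<Rightarrow>\<^sub>0 int) set \<Rightarrow> 'm set) \<Rightarrow> nat \<Rightarrow> ('r \<Rightarrow>\<^sub>0 int) set \<Rightarrow> nat \<Rightarrow> ('r set set \<Rightarrow> 'm) \<Rightarrow> bool"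
  where
  "cech_cochain F M i b k m \<longleftrightarrow>
     (\<forall>I\<subseteq>cones F. card I = i \<longrightarrow>
        m I \<in> M (b \<otimes>\<^bsub>Pic F\<^esub> denominator_degree F I [^]\<^bsub>Pic F\<^esub> k))"

text \<open>
  The numerators over \<open>f\<^sub>J\<^sup>k\<close> of the coboundary of \<open>m I / f\<^sub>I\<^sup>k\<close>, using
  \<open>m (J - {\<sigma>}) / f\<^bsub>J - {\<sigma>}\<^esub>\<^sup>k = f\<^sub>\<sigma>\<^sup>k m (J - {\<sigma>}) / f\<^sub>J\<^sup>k\<close>.
\<close>

definition cech_differential ::
  "'r fan \<Rightarrow> (('r, 'k::field) mpoly \<Rightarrow> 'm::ab_group_add \<Rightarrow> 'm) \<Rightarrow> nat \<Rightarrow>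
     ('r set set \<Rightarrow> 'm) \<Rightarrow> 'r set set \<Rightarrow> 'm" where
  "cech_differential F s k m J =
     (\<Sum>\<sigma>\<in>J. s ((- 1) ^ card {\<tau>\<in>J. cone_index F \<tau> < cone_index F \<sigma>} * irrelevant_generator F \<sigma> ^ k)
               (m (J - {\<sigma>})))"

text \<open>
  \<open>H\<^sup>i\<^sub>B(M)\<^sub>b = 0\<close>: every cocycle of degree \<open>b\<close> is a coboundary.  For \<open>i = 0\<close> the only index set is
  \<open>I = {}\<close>, where the differential is an empty sum, so the cocycle has to vanish.
\<close>

definition local_cohomology_zero ::
  "'r fan \<Rightarrow> (('r, 'k::field) mpoly \<Rightarrow> 'm::ab_group_add \<Rightarrow> 'm) \<Rightarrow> (('r \<Rightarrow>\<^sub>0 int) set \<Rightarrow> 'm set) \<Rightarrow>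
     nat \<Rightarrow> ('r \<Rightarrow>\<^sub>0 int) set \<Rightarrow> bool" where
  "local_cohomology_zero F s M i b \<longleftrightarrow>
     (\<forall>k m. cech_cochain F M i b k m \<and>
            (\<forall>J\<subseteq>cones F. card J = Suc i \<longrightarrow>
               fraction_eq s (denominator F J) (cech_differential F s k m J, k) (0, 0))
        \<longrightarrow> (\<exists>k' n. (\<forall>j. i = Suc j \<longrightarrow> cech_cochain F M j b k' n) \<and>
                    (\<forall>I\<subseteq>cones F. card I = i \<longrightarrow>
                       fraction_eq s (denominator F I) (m I, k) (cech_differential F s k' n I, k'))))"


section \<open>Multigraded regularity\<close>

definition nef_combination ::
  "'k::field itself \<Rightarrow> 'r fan \<Rightarrow> (('r \<Rightarrow>\<^sub>0 int) set \<Rightarrow> nat) \<Rightarrow> ('r \<Rightarrow>\<^sub>0 int) set" where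
  "nef_combination K F l = (\<Otimes>\<^bsub>Pic F\<^esub>c\<in>nef_generators K F. c [^]\<^bsub>Pic F\<^esub> l c)"

definition regular ::
  "'r fan \<Rightarrow> (('r, 'k::field) mpoly \<Rightarrow> 'm::ab_group_add \<Rightarrow> 'm) \<Rightarrow> (('r \<Rightarrow>\<^sub>0 int) set \<Rightarrow> 'm set) \<Rightarrow>
     ('r \<Rightarrow>\<^sub>0 int) set \<Rightarrow> bool" where
  "regular F s M d \<longleftrightarrow>
     (\<forall>i>0. \<forall>l. (\<Sum>c\<in>nef_generators TYPE('k) F. l c) = i - 1 \<longrightarrow>
        (\<forall>e\<in>Nef TYPE('k) F.
           local_cohomology_zero F s M i
             (d \<otimes>\<^bsub>Pic F\<^esub> inv\<^bsub>Pic F\<^esub> (nef_combination TYPE('k) F l) \<otimes>\<^bsub>Pic F\<^esub> e))) \<and>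
     (\<forall>c\<in>nef_generators TYPE('k) F. \<forall>e\<in>Nef TYPE('k) F.
        local_cohomology_zero F s M 0 (d \<otimes>\<^bsub>Pic F\<^esub> c \<otimes>\<^bsub>Pic F\<^esub> e))"

definition reg ::
  "'r fan \<Rightarrow> (('r, 'k::field) mpoly \<Rightarrow> 'm::ab_group_add \<Rightarrow> 'm) \<Rightarrow> (('r \<Rightarrow>\<^sub>0 int) set \<Rightarrow> 'm set) \<Rightarrow>
     ('r \<Rightarrow>\<^sub>0 int) set set" where
  "reg F s M = {d \<in> carrier (Pic F). regular F s M d}"

definition reg_cox :: "'k::field itself \<Rightarrow> 'r fan \<Rightarrow> ('r \<Rightarrow>\<^sub>0 int) set set" where
  "reg_cox _ F = reg F ((*) :: ('r, 'k) mpoly \<Rightarrow> ('r, 'k) mpoly \<Rightarrow> ('r, 'k) mpoly) (cox_component F)"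

end

(*
  The classes of the torus-invariant divisors that are nonnegative on all primitive relations
  r(P) = sum_P u_rho - (its expression in the generators of the cone containing it) form a
  finitely generated pointed monoid. They are nef: by the termination of rewriting along primitive
  relations they have effective representatives avoiding any given cone. Conversely, if a class d is
  negative on some primitive relation, then it is negative on an extremal one, and an extremal
  relation is the class of a rational curve with two special points; so d is not nef.

  If d is negative on the extremal relation r(P), k = |P| and c is a nef generator positive on r(P),
  then d - (k - 1) c plus a suitable nef class of degree 0 on r(P) is represented by a divisor that
  is negative exactly along P. In this multidegree H^k_B(S) is the cohomology of a (k - 2)-sphere, so
  d is not in reg S. Finiteness of the minimal elements is then Dickson's lemma applied to the degrees
  on the primitive relations.
*)
theory Submission
  imports Defs
begin

text \<open>All geometry is read off from integer vectors on the rays: a lattice point has exactly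
  one nonnegative integral expression supported on a cone, and effectivity, convexity and the
  multiplicities of curves all rest on this uniqueness. Passing to large multiples uses Dickson's
  lemma instead of limits. The obstacle is that an arbitrary primitive relation need not be the
  class of a curve of the required shape. For an extremal one, P without any one of its rays, joined
  with the cone of r(P), is again a cone. The class h supporting the extremal ray also serves the
  cohomological half: a large multiple of it makes a class of degree 0 on r(P) nef. The number k - 1
  balances exactly: regularity allows k - 1 generators to be subtracted in cohomological degree k.
  Starting from degree at most -1 on r(P), each copy of c lowers it by at least 1, and the resulting
  bound -k just suffices for a coefficient at most -1 along each of the k rays of P.\<close>

section \<open>Dickson's lemma\<close>

lemma dickson_seq:
  fixes f :: "nat \<Rightarrow> 'a \<Rightarrow> nat"
  assumes "finite S"
  shows "\<exists>g :: nat \<Rightarrow> nat. strict_mono g \<and> (\<forall>i j. i \<le> j \<longrightarrow> (\<forall>x\<in>S. f (g i) x \<le> f (g j) x))"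
  using assms
proof (induction S)
  case empty
  show ?case by (intro exI[of _ id]) (auto simp: strict_mono_def)
next
  case (insert x S)
  then obtain g :: "nat \<Rightarrow> nat" where g: "strict_mono g" "\<And>i j y. i \<le> j \<Longrightarrow> y \<in> S \<Longrightarrow> f (g i) y \<le> f (g j) y"
    by blast
  obtain h :: "nat \<Rightarrow> nat" where h: "strict_mono h" "monoseq (\<lambda>n. f (g (h n)) x)"
    using seq_monosub[of "\<lambda>n. f (g n) x"] by (auto simp: o_def)
  \<comment> \<open>A monotone sequence of naturals is nondecreasing, or it is nonincreasing and
    then constant once its minimum is attained.\<close>
  have "\<exists>N. \<forall>i j. N \<le> i \<longrightarrow> i \<le> j \<longrightarrow> f (g (h i)) x \<le> f (g (h j)) x"
  proof (cases "\<forall>i j. i \<le> j \<longrightarrow> f (g (h i)) x \<le> f (g (h j)) x")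
    case False
    then have dec: "f (g (h j)) x \<le> f (g (h i)) x" if "i \<le> j" for i j
      using h(2) that unfolding monoseq_def by blast
    define m where "m = (LEAST m. m \<in> range (\<lambda>n. f (g (h n)) x))"
    have "m \<in> range (\<lambda>n. f (g (h n)) x)"
      unfolding m_def by (rule LeastI_ex) auto
    then obtain N where N: "m = f (g (h N)) x" by auto
    have "m \<le> f (g (h n)) x" for n unfolding m_def by (rule Least_le) auto
    then show ?thesis using dec N by (metis le_trans)
  qed auto
  then obtain N where N: "\<And>i j. N \<le> i \<Longrightarrow> i \<le> j \<Longrightarrow> f (g (h i)) x \<le> f (g (h j)) x" by blast
  have "strict_mono (\<lambda>n. g (h (N + n)))"
    using g(1) h(1) by (simp add: strict_mono_def)
  moreover have "\<forall>y\<in>insert x S. f (g (h (N + i))) y \<le> f (g (h (N + j))) y" if "i \<le> j" for i j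
    using g(2) N[of "N + i" "N + j"] that h(1) by (auto simp: strict_mono_less_eq)
  ultimately show ?case by blast
qed

lemma dickson_antichain:
  fixes f :: "'b \<Rightarrow> 'a \<Rightarrow> nat"
  assumes "finite S" and "\<And>x y. x \<in> A \<Longrightarrow> y \<in> A \<Longrightarrow> \<forall>s\<in>S. f x s \<le> f y s \<Longrightarrow> x = y"
  shows "finite A"
proof (rule ccontr)
  assume "infinite A"
  then obtain e :: "nat \<Rightarrow> 'b" where e: "inj e" "range e \<subseteq> A"
    using infinite_countable_subset by blast
  obtain g :: "nat \<Rightarrow> nat" where g: "strict_mono g" "\<And>i j. i \<le> j \<Longrightarrow> \<forall>s\<in>S. f (e (g i)) s \<le> f (e (g j)) s"
    using dickson_seq[OF assms(1), of "\<lambda>n. f (e n)"] by blast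
  have "e (g 0) = e (g 1)" by (rule assms(2)) (use e(2) g(2)[of 0 1] in auto)
  then show False using e(1) g(1) by (metis injD strict_mono_eq zero_neq_one)
qed

section \<open>Cones and support functions\<close>

locale projective_fan =
  fixes F :: "'r fan"
  assumes fan: "smooth_projective_fan F"
begin

lemma finite_rays [simp]: "finite (rays F)"
  and empty_cone [simp]: "{} \<in> cones F"
  and Union_cones: "\<Union>(cones F) = rays F"
  and face_cone: "\<sigma> \<in> cones F \<Longrightarrow> \<tau> \<subseteq> \<sigma> \<Longrightarrow> \<tau> \<in> cones F"
  and cone_Int: "\<sigma> \<in> cones F \<Longrightarrow> \<tau> \<in> cones F \<Longrightarrow>
        real_cone F \<sigma> \<inter> real_cone F \<tau> = real_cone F (\<sigma> \<inter> \<tau>)"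
  and smooth: "\<sigma> \<in> cones F \<Longrightarrow> smooth_cone F \<sigma>"
  and complete: "(\<Union>\<sigma>\<in>cones F. real_cone F \<sigma>) = {w. \<forall>i\<ge>rk F. w i = 0}"
  using fan unfolding smooth_projective_fan_def smooth_fan_def complete_fan_def by auto

lemma cone_subset_rays: "\<sigma> \<in> cones F \<Longrightarrow> \<sigma> \<subseteq> rays F"
  using Union_cones by auto

lemma finite_cone: "\<sigma> \<in> cones F \<Longrightarrow> finite \<sigma>"
  using cone_subset_rays finite_rays finite_subset by blast

lemma finite_cones [simp]: "finite (cones F)"
  by (rule finite_subset[of _ "Pow (rays F)"]) (use cone_subset_rays in auto)

lemma singleton_cone: "\<rho> \<in> rays F \<Longrightarrow> {\<rho>} \<in> cones F"
  using Union_cones face_cone by blast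

lemma maximal_coneE:
  assumes "\<tau> \<in> cones F" obtains \<sigma> where "\<sigma> \<in> maximal_cones F" "\<tau> \<subseteq> \<sigma>"
proof -
  have "\<exists>\<sigma>\<in>cones F. \<tau> \<subseteq> \<sigma> \<and> (\<forall>\<sigma>'\<in>cones F. \<sigma> \<subseteq> \<sigma>' \<longrightarrow> \<sigma> = \<sigma>')"
    using finite_has_maximal2[OF finite_cones assms] by auto
  then show ?thesis using that unfolding maximal_cones_def by blast
qed

section \<open>Lattice points as integer vectors on the rays\<close>

definition vec :: "('r \<Rightarrow> int) \<Rightarrow> nat \<Rightarrow> int" where
  "vec c i = (if i < rk F then \<Sum>\<rho>\<in>rays F. c \<rho> * gen F \<rho> i else 0)"

lemma vec_add: "vec (\<lambda>\<rho>. c \<rho> + d \<rho>) = (\<lambda>i. vec c i + vec d i)"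
  and vec_diff: "vec (\<lambda>\<rho>. c \<rho> - d \<rho>) = (\<lambda>i. vec c i - vec d i)"
  and vec_mult: "vec (\<lambda>\<rho>. k * c \<rho>) = (\<lambda>i. k * vec c i)"
  by (auto simp: vec_def fun_eq_iff sum.distrib sum_subtractf algebra_simps sum_distrib_left)

lemma vec_cong: "(\<And>\<rho>. \<rho> \<in> rays F \<Longrightarrow> c \<rho> = d \<rho>) \<Longrightarrow> vec c = vec d"
  by (auto simp: vec_def fun_eq_iff)

text \<open>For \<open>c\<close> with zero \<open>vec\<close> this is the intersection pairing of a
  numerical curve class with a divisor; characters then pair to zero with \<open>c\<close>.\<close>

definition ev :: "('r \<Rightarrow> int) \<Rightarrow> ('r \<Rightarrow> int) \<Rightarrow> int" where
  "ev c a = (\<Sum>\<rho>\<in>rays F. c \<rho> * a \<rho>)"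

lemma ev_add_left: "ev (\<lambda>\<rho>. c \<rho> + d \<rho>) a = ev c a + ev d a"
  and ev_diff_left: "ev (\<lambda>\<rho>. c \<rho> - d \<rho>) a = ev c a - ev d a"
  and ev_mult_left: "ev (\<lambda>\<rho>. k * c \<rho>) a = k * ev c a"
  and ev_add_right: "ev c (\<lambda>\<rho>. a \<rho> + b \<rho>) = ev c a + ev c b"
  and ev_diff_right: "ev c (\<lambda>\<rho>. a \<rho> - b \<rho>) = ev c a - ev c b"
  and ev_mult_right: "ev c (\<lambda>\<rho>. k * a \<rho>) = k * ev c a"
  by (auto simp: ev_def sum.distrib sum_subtractf algebra_simps sum_distrib_left)

lemmas ev_simps = ev_add_left ev_diff_left ev_mult_left ev_add_right ev_diff_right ev_mult_right

lemma ev_cong: "(\<And>\<rho>. \<rho> \<in> rays F \<Longrightarrow> c \<rho> = d \<rho>) \<Longrightarrow> (\<And>\<rho>. \<rho> \<in> rays F \<Longrightarrow> a \<rho> = b \<rho>) \<Longrightarrow> ev c a = ev d b"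
  by (auto simp: ev_def)

lemma ev_nonneg: "(\<And>\<rho>. \<rho> \<in> rays F \<Longrightarrow> 0 \<le> c \<rho>) \<Longrightarrow> (\<And>\<rho>. \<rho> \<in> rays F \<Longrightarrow> 0 \<le> a \<rho>) \<Longrightarrow> 0 \<le> ev c a"
  by (auto simp: ev_def intro: sum_nonneg)

lemma ev_pairing: "ev c (pairing F m) = (\<Sum>i<rk F. m i * vec c i)"
  unfolding ev_def pairing_def vec_def sum_distrib_left
  by (subst sum.swap) (auto intro!: sum.cong simp: sum_distrib_left algebra_simps)

text \<open>The coordinates of the standard basis with respect to \<open>b\<close> form the inverse
  matrix of \<open>b\<close>; its columns belonging to the rays of the cone are the required
  integral linear forms.\<close>

lemma cone_dual:
  assumes "\<sigma> \<in> cones F"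
  shows "\<exists>m. \<forall>\<rho>\<in>\<sigma>. \<forall>\<rho>'\<in>\<sigma>. pairing F (m \<rho>) \<rho>' = of_bool (\<rho> = \<rho>')"
proof -
  obtain b f where b: "lattice_basis (rk F) b" "inj_on f \<sigma>" "f ` \<sigma> \<subseteq> {..<rk F}"
    "\<And>\<rho> i. \<rho> \<in> \<sigma> \<Longrightarrow> i < rk F \<Longrightarrow> gen F \<rho> i = b (f \<rho>) i"
    using smooth[OF assms] unfolding smooth_cone_def by blast
  define n where "n = rk F"
  have "\<forall>i. \<exists>c. (\<forall>j\<ge>n. c j = 0) \<and> (\<forall>k<n. of_bool (k = i) = (\<Sum>j<n. c j * b j k))"
  proof
    fix i show "\<exists>c. (\<forall>j\<ge>n. c j = 0) \<and> (\<forall>k<n. of_bool (k = i) = (\<Sum>j<n. c j * b j k))"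
      using ex1_implies_ex[OF b(1)[unfolded lattice_basis_def, THEN spec, of "\<lambda>k. of_bool (k = i)"]]
      unfolding n_def .
  qed
  then obtain e where e: "\<And>i j. j \<ge> n \<Longrightarrow> e i j = 0"
    "\<And>i k. k < n \<Longrightarrow> of_bool (k = i) = (\<Sum>j<n. e i j * b j k)" by metis
  \<comment> \<open>By its choice \<open>e\<close> inverts \<open>b\<close> on one side; the other
    side follows because the coordinates of \<open>b l\<close> are unique.\<close>
  have dual: "(\<Sum>i<n. e i j * b l i) = of_bool (j = l)" if "l < n" "j < n" for j l
  proof -
    define c where "c = (\<lambda>j. \<Sum>i<n. e i j * b l i)"
    define Q where "Q = (\<lambda>c. (\<forall>j\<ge>n. c j = 0) \<and> (\<forall>i<n. b l i = (\<Sum>j<n. c j * b j i)))"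
    have "Q c"
      unfolding Q_def
    proof (intro conjI allI impI)
      fix k assume "k < n"
      have "(\<Sum>j<n. c j * b j k) = (\<Sum>i<n. \<Sum>j<n. b l i * (e i j * b j k))"
        unfolding c_def sum_distrib_right by (subst sum.swap) (simp add: algebra_simps)
      also have "\<dots> = (\<Sum>i<n. b l i * of_bool (k = i))"
        by (simp add: sum_distrib_left[symmetric] e(2)[OF \<open>k < n\<close>, symmetric])
      also have "\<dots> = b l k"
        using \<open>k < n\<close> sum.delta[of "{..<n}" k "b l"] by (simp add: of_bool_def if_distrib cong: if_cong)
      finally show "b l k = (\<Sum>j<n. c j * b j k)" by simp
    qed (simp add: c_def e)
    moreover have "Q (\<lambda>j. of_bool (j = l))"
      unfolding Q_def using that by auto
    moreover have "\<exists>!c. Q c"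
      using b(1) unfolding lattice_basis_def n_def Q_def by (rule spec)
    ultimately have "c = (\<lambda>j. of_bool (j = l))" by blast
    then show ?thesis unfolding c_def by meson
  qed
  have "pairing F (\<lambda>i. e i (f \<rho>)) \<rho>' = of_bool (\<rho> = \<rho>')" if "\<rho> \<in> \<sigma>" "\<rho>' \<in> \<sigma>" for \<rho> \<rho>'
  proof -
    have "pairing F (\<lambda>i. e i (f \<rho>)) \<rho>' = (\<Sum>i<n. e i (f \<rho>) * b (f \<rho>') i)"
      using b(4) that unfolding pairing_def n_def by simp
    also have "\<dots> = of_bool (f \<rho> = f \<rho>')"
      using dual b(3) that unfolding n_def by blast
    finally show ?thesis using b(2) that by (auto simp: inj_on_def)
  qed
  then show ?thesis by (intro exI[of _ "\<lambda>\<rho> i. e i (f \<rho>)"]) auto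
qed

lemma pairing_sum: "pairing F (\<lambda>i. \<Sum>x\<in>A. c x * m x i) \<rho> = (\<Sum>x\<in>A. c x * pairing F (m x) \<rho>)"
  unfolding pairing_def sum_distrib_right sum_distrib_left by (subst sum.swap) (simp add: algebra_simps)

lemma cone_interpolate:
  assumes "\<sigma> \<in> cones F"
  obtains m where "\<And>\<rho>. \<rho> \<in> \<sigma> \<Longrightarrow> pairing F m \<rho> = \<alpha> \<rho>"
proof -
  obtain m where m: "\<And>\<rho> \<rho>'. \<rho> \<in> \<sigma> \<Longrightarrow> \<rho>' \<in> \<sigma> \<Longrightarrow> pairing F (m \<rho>) \<rho>' = of_bool (\<rho> = \<rho>')"
    using cone_dual[OF assms] by blast
  have "pairing F (\<lambda>i. \<Sum>\<rho>'\<in>\<sigma>. \<alpha> \<rho>' * m \<rho>' i) \<rho> = \<alpha> \<rho>" if "\<rho> \<in> \<sigma>" for \<rho>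
    unfolding pairing_sum using finite_cone[OF assms] that
    by (simp add: m of_bool_def if_distrib cong: if_cong)
  then show ?thesis using that by blast
qed

text \<open>A dual form kills all generators of \<sigma> but one, so it reads off that coefficient.
  The face \<tau> allows two expressions of one point over different sets of rays to be
  compared.\<close>

lemma real_cone_coeff:
  assumes "\<sigma> \<in> cones F" and m: "\<forall>\<rho>\<in>\<sigma>. \<forall>\<rho>'\<in>\<sigma>. pairing F (m \<rho>) \<rho>' = of_bool (\<rho> = \<rho>')"
    and "\<tau> \<subseteq> \<sigma>" "\<rho> \<in> \<sigma>"
    and w: "\<And>i. i < rk F \<Longrightarrow> w i = (\<Sum>\<rho>'\<in>\<tau>. c \<rho>' * real_of_int (gen F \<rho>' i))"
  shows "(\<Sum>i<rk F. of_int (m \<rho> i) * w i) = (if \<rho> \<in> \<tau> then c \<rho> else 0)"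
proof -
  have "(\<Sum>i<rk F. of_int (m \<rho> i) * w i)
      = (\<Sum>\<rho>'\<in>\<tau>. c \<rho>' * of_int (pairing F (m \<rho>) \<rho>'))"
    unfolding pairing_def of_int_sum of_int_mult sum_distrib_left using w
    by (subst sum.swap) (auto simp: sum_distrib_left algebra_simps intro!: sum.cong)
  also have "\<dots> = (\<Sum>\<rho>'\<in>\<tau>. if \<rho> = \<rho>' then c \<rho>' else 0)"
    using m assms(3,4) by (intro sum.cong) auto
  also have "\<dots> = (if \<rho> \<in> \<tau> then c \<rho> else 0)"
    using finite_cone[OF face_cone[OF assms(1,3)]] by simp
  finally show ?thesis .
qed

text \<open>The coefficients of a lattice point in a cone containing it, padded by zero, so that
  equality of lattice points becomes equality of functions.\<close>

definition cone_vector :: "('r \<Rightarrow> int) \<Rightarrow> bool" where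
  "cone_vector c \<longleftrightarrow> (\<forall>\<rho>. 0 \<le> c \<rho>) \<and> {\<rho>. c \<rho> \<noteq> 0} \<in> cones F"

lemma cone_vector_nonneg: "cone_vector c \<Longrightarrow> 0 \<le> c \<rho>"
  and cone_vector_supp: "cone_vector c \<Longrightarrow> {\<rho>. c \<rho> \<noteq> 0} \<in> cones F"
  by (auto simp: cone_vector_def)

lemma cone_vector_rays: "cone_vector c \<Longrightarrow> \<rho> \<notin> rays F \<Longrightarrow> c \<rho> = 0"
  using cone_subset_rays cone_vector_supp by fastforce

lemma cone_vectorI: "(\<And>\<rho>. 0 \<le> c \<rho>) \<Longrightarrow> {\<rho>. c \<rho> \<noteq> 0} \<subseteq> \<sigma> \<Longrightarrow> \<sigma> \<in> cones F \<Longrightarrow> cone_vector c"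
  using face_cone unfolding cone_vector_def by blast

lemma vec_real:
  assumes "\<sigma> \<in> cones F" "{\<rho>. c \<rho> \<noteq> 0} \<subseteq> \<sigma>" "i < rk F"
  shows "real_of_int (vec c i) = (\<Sum>\<rho>\<in>\<sigma>. of_int (c \<rho>) * of_int (gen F \<rho> i))"
proof -
  have "vec c i = (\<Sum>\<rho>\<in>\<sigma>. c \<rho> * gen F \<rho> i)"
    unfolding vec_def using assms cone_subset_rays[OF assms(1)]
    by (auto intro!: sum.mono_neutral_right)
  then show ?thesis by simp
qed

lemma vec_in_real_cone:
  assumes "cone_vector c" "\<sigma> \<in> cones F" "{\<rho>. c \<rho> \<noteq> 0} \<subseteq> \<sigma>"
  shows "(\<lambda>i. real_of_int (vec c i)) \<in> real_cone F \<sigma>"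
  unfolding real_cone_def using vec_real[OF assms(2,3)] cone_vector_nonneg[OF assms(1)]
  by (auto simp: vec_def intro!: exI[of _ "\<lambda>\<rho>. of_int (c \<rho>)"])

text \<open>Completeness gives real coefficients on some cone; evaluating the integral dual forms at
  the lattice point shows that they are integers.\<close>

lemma cone_vector_exists:
  assumes "\<And>i. i \<ge> rk F \<Longrightarrow> w i = 0"
  shows "\<exists>c. cone_vector c \<and> vec c = w"
proof -
  have "(\<lambda>i. real_of_int (w i)) \<in> (\<Union>\<sigma>\<in>cones F. real_cone F \<sigma>)"
    unfolding complete using assms by auto
  then obtain \<sigma> c where s: "\<sigma> \<in> cones F" "\<And>\<rho>. \<rho> \<in> \<sigma> \<Longrightarrow> 0 \<le> c \<rho>"
    "\<And>i. i < rk F \<Longrightarrow> of_int (w i) = (\<Sum>\<rho>\<in>\<sigma>. c \<rho> * real_of_int (gen F \<rho> i))"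
    unfolding real_cone_def by auto
  obtain m where m: "\<forall>\<rho>\<in>\<sigma>. \<forall>\<rho>'\<in>\<sigma>. pairing F (m \<rho>) \<rho>' = of_bool (\<rho> = \<rho>')"
    using cone_dual[OF s(1)] by blast
  define d where "d = (\<lambda>\<rho>. if \<rho> \<in> \<sigma> then \<Sum>i<rk F. m \<rho> i * w i else 0)"
  have d: "of_int (d \<rho>) = c \<rho>" if "\<rho> \<in> \<sigma>" for \<rho>
    using real_cone_coeff[OF s(1) m order_refl that s(3)] that by (simp add: d_def)
  have supp: "{\<rho>. d \<rho> \<noteq> 0} \<subseteq> \<sigma>" by (auto simp: d_def)
  have "0 \<le> d \<rho>" for \<rho>
  proof (cases "\<rho> \<in> \<sigma>")
    case True
    then have "real_of_int 0 \<le> of_int (d \<rho>)" using d s(2) by simp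
    then show ?thesis by (simp only: of_int_le_iff)
  qed (simp add: d_def)
  then have "cone_vector d" using cone_vectorI supp s(1) by blast
  moreover have "vec d = w"
  proof
    fix i show "vec d i = w i"
    proof (cases "i < rk F")
      case True
      then have "real_of_int (vec d i) = of_int (w i)"
        using vec_real[OF s(1) supp True] s(3) d by simp
      then show ?thesis by simp
    qed (use assms in \<open>auto simp: vec_def\<close>)
  qed
  ultimately show ?thesis by blast
qed

text \<open>By the fan axiom the common point lies in the cone over the intersection of both
  supports. Coefficients over either support are unique, so both vectors live on that intersection
  and agree there.\<close>

lemma cone_vector_unique:
  assumes c: "cone_vector c" and d: "cone_vector d" and eq: "vec c = vec d"
  shows "c = d"
proof -
  let ?\<sigma> = "{\<rho>. c \<rho> \<noteq> 0}" and ?\<tau> = "{\<rho>. d \<rho> \<noteq> 0}"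
  have s: "?\<sigma> \<in> cones F" "?\<tau> \<in> cones F" using c d cone_vector_supp by auto
  have "(\<lambda>i. real_of_int (vec c i)) \<in> real_cone F (?\<sigma> \<inter> ?\<tau>)"
    using vec_in_real_cone[OF c s(1)] vec_in_real_cone[OF d s(2)] eq
    unfolding cone_Int[OF s, symmetric] by auto
  then obtain e where e: "\<And>i. i < rk F \<Longrightarrow> real_of_int (vec c i) = (\<Sum>\<rho>\<in>?\<sigma>\<inter>?\<tau>. e \<rho> * of_int (gen F \<rho> i))"
    unfolding real_cone_def by auto
  have *: "of_int (c' \<rho>) = (if \<rho> \<in> ?\<sigma> \<inter> ?\<tau> then e \<rho> else 0)"
    if *: "\<rho> \<in> \<sigma>'" "\<sigma>' \<in> cones F" "\<sigma>' = {\<rho>. c' \<rho> \<noteq> 0}" "?\<sigma> \<inter> ?\<tau> \<subseteq> \<sigma>'" "vec c = vec c'" for c' \<rho> \<sigma>'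
  proof -
    obtain m where m: "\<forall>\<rho>\<in>\<sigma>'. \<forall>\<rho>'\<in>\<sigma>'. pairing F (m \<rho>) \<rho>' = of_bool (\<rho> = \<rho>')"
      using cone_dual[OF *(2)] by blast
    show ?thesis
      using real_cone_coeff[OF *(2) m *(4,1) e] *(1)
        real_cone_coeff[OF *(2) m order_refl *(1), of "\<lambda>i. of_int (vec c i)" "\<lambda>\<rho>. of_int (c' \<rho>)"]
        vec_real[OF *(2), of c'] *(3,5) by simp
  qed
  have supp: "?\<sigma> = ?\<tau>" 
  proof (intro equalityI subsetI)
    fix \<rho> assume "\<rho> \<in> ?\<sigma>" then show "\<rho> \<in> ?\<tau>" using *[of \<rho> ?\<sigma> c] s by (auto split: if_splits)
  next
    fix \<rho> assume "\<rho> \<in> ?\<tau>" then show "\<rho> \<in> ?\<sigma>" using *[of \<rho> ?\<tau> d] s eq by (auto split: if_splits)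
  qed
  show ?thesis
  proof
    fix \<rho> show "c \<rho> = d \<rho>"
    proof (cases "\<rho> \<in> ?\<sigma>")
      case True
      then have "real_of_int (c \<rho>) = of_int (d \<rho>)"
        using *[of \<rho> ?\<sigma> c] *[of \<rho> ?\<tau> d] s supp eq by auto
      then show ?thesis by simp
    next
      case False then show ?thesis using supp by auto
    qed
  qed
qed

text \<open>The unique \<open>cone_vector\<close> with the lattice point of \<open>c\<close>, where
  \<open>c\<close> may have negative entries. It is the normal form for rewriting along primitive
  relations.\<close>

definition nf :: "('r \<Rightarrow> int) \<Rightarrow> 'r \<Rightarrow> int" where
  "nf c = (SOME d. cone_vector d \<and> vec d = vec c)"

lemma nf_cone_vector: "cone_vector (nf c)" and vec_nf: "vec (nf c) = vec c"
proof -
  have "\<exists>d. cone_vector d \<and> vec d = vec c"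
    by (rule cone_vector_exists) (simp add: vec_def)
  then have "cone_vector (nf c) \<and> vec (nf c) = vec c" unfolding nf_def by (rule someI_ex)
  then show "cone_vector (nf c)" "vec (nf c) = vec c" by auto
qed

lemma nf_unique: "cone_vector d \<Longrightarrow> vec d = vec c \<Longrightarrow> nf c = d"
  using cone_vector_unique nf_cone_vector vec_nf by metis

lemma nf_nonneg: "0 \<le> nf c \<rho>" and nf_supp: "{\<rho>. nf c \<rho> \<noteq> 0} \<in> cones F"
  using nf_cone_vector cone_vector_nonneg cone_vector_supp by auto

lemma nf_cong: "vec c = vec d \<Longrightarrow> nf c = nf d"
  unfolding nf_def by simp


section \<open>Primitive collections and their relations\<close>

definition ind :: "'r set \<Rightarrow> 'r \<Rightarrow> int" where "ind S \<rho> = of_bool (\<rho> \<in> S)"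

lemma ind_nonneg: "0 \<le> ind S \<rho>"
  by (simp add: ind_def)

text \<open>Batyrev's notion: the minimal nonfaces of the simplicial complex of cones.\<close>

definition primitive_collection :: "'r set \<Rightarrow> bool" where
  "primitive_collection P \<longleftrightarrow> P \<subseteq> rays F \<and> P \<notin> cones F \<and> (\<forall>Q. Q \<subset> P \<longrightarrow> Q \<in> cones F)"

definition relation :: "'r set \<Rightarrow> 'r \<Rightarrow> int" where
  "relation P \<rho> = ind P \<rho> - nf (ind P) \<rho>"

definition deg :: "'r set \<Rightarrow> ('r \<Rightarrow> int) \<Rightarrow> int" where
  "deg P a = ev (relation P) a"

definition convex :: "('r \<Rightarrow> int) \<Rightarrow> bool" where
  "convex a \<longleftrightarrow> (\<forall>P. primitive_collection P \<longrightarrow> 0 \<le> deg P a)"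

lemma vec_relation: "vec (relation P) = (\<lambda>i. 0)"
  using vec_diff[of "ind P" "nf (ind P)"] vec_nf[of "ind P"] by (simp add: relation_def[abs_def])

lemma deg_alt: "deg P a = ev (ind P) a - ev (nf (ind P)) a"
  unfolding deg_def relation_def by (rule ev_diff_left)

lemma deg_add: "deg P (\<lambda>\<rho>. a \<rho> + b \<rho>) = deg P a + deg P b"
  and deg_diff: "deg P (\<lambda>\<rho>. a \<rho> - b \<rho>) = deg P a - deg P b"
  and deg_mult: "deg P (\<lambda>\<rho>. k * a \<rho>) = k * deg P a"
  unfolding deg_def by (rule ev_simps)+

lemma ev_pairing_cong: "vec c = vec d \<Longrightarrow> ev c (pairing F m) = ev d (pairing F m)"
  by (simp add: ev_pairing)

lemma deg_pairing: "deg P (pairing F m) = 0"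
  unfolding deg_alt using ev_pairing_cong[OF vec_nf] by simp

lemma primitive_rays: "primitive_collection P \<Longrightarrow> P \<subseteq> rays F"
  and primitive_not_cone: "primitive_collection P \<Longrightarrow> P \<notin> cones F"
  and primitive_subset: "primitive_collection P \<Longrightarrow> Q \<subset> P \<Longrightarrow> Q \<in> cones F"
  by (auto simp: primitive_collection_def)

lemma finite_primitive: "finite {P. primitive_collection P}"
  by (rule finite_subset[of _ "Pow (rays F)"]) (auto simp: primitive_collection_def)

lemma primitive_exists:
  assumes "S \<subseteq> rays F" "S \<notin> cones F"
  obtains P where "primitive_collection P" "P \<subseteq> S"
proof -
  let ?A = "{Q. Q \<subseteq> S \<and> Q \<notin> cones F}"
  have "finite S" using assms(1) finite_rays finite_subset by blast
  then have "finite ?A" by simp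
  moreover have "S \<in> ?A" using assms by auto
  ultimately obtain P where P: "P \<in> ?A" "\<And>Q. Q \<in> ?A \<Longrightarrow> Q \<subseteq> P \<Longrightarrow> P = Q"
    using finite_has_minimal2[of ?A S] by auto
  have "primitive_collection P"
    unfolding primitive_collection_def using P assms by blast
  then show ?thesis using that P by auto
qed

lemma primitive_finite: "primitive_collection P \<Longrightarrow> finite P"
  using primitive_rays finite_rays finite_subset by blast

lemma primitive_nonempty: "primitive_collection P \<Longrightarrow> P \<noteq> {}"
  using primitive_not_cone empty_cone by metis

lemma primitive_other:
  assumes "primitive_collection P" "\<rho> \<in> P"
  obtains \<rho>' where "\<rho>' \<in> P" "\<rho>' \<noteq> \<rho>"
proof -
  have "P \<noteq> {\<rho>}" using assms singleton_cone primitive_rays primitive_not_cone by blast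
  then show ?thesis using that assms by blast
qed

lemma cone_vector_add:
  assumes "cone_vector c" "cone_vector d" "{\<rho>. c \<rho> \<noteq> 0} \<union> {\<rho>. d \<rho> \<noteq> 0} \<in> cones F"
  shows "cone_vector (\<lambda>\<rho>. c \<rho> + d \<rho>)"
  by (rule cone_vectorI[OF _ _ assms(3)]) (use cone_vector_nonneg[OF assms(1)] cone_vector_nonneg[OF assms(2)] in auto)

lemma cone_vector_ind: "\<sigma> \<in> cones F \<Longrightarrow> cone_vector (ind \<sigma>)"
  by (rule cone_vectorI[of _ \<sigma>]) (auto simp: ind_def)

text \<open>If \<rho> occurred in the normal form, removing one copy of it from both sides would
  express the sum over P - {\<rho>} along two cones. By uniqueness the normal form would be
  \<open>ind P\<close>, but the support of that is not a cone.\<close>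

lemma primitive_disjoint:
  assumes P: "primitive_collection P" and "\<rho> \<in> P"
  shows "nf (ind P) \<rho> = 0"
proof (rule ccontr)
  assume nz: "nf (ind P) \<rho> \<noteq> 0"
  have c: "P - {\<rho>} \<in> cones F" using primitive_subset[OF P] assms(2) by blast
  have 1: "cone_vector (\<lambda>\<rho>'. nf (ind P) \<rho>' - ind {\<rho>} \<rho>')"
  proof (rule cone_vectorI[OF _ _ nf_supp[of "ind P"]])
    show "0 \<le> nf (ind P) x - ind {\<rho>} x" for x
      using nz nf_nonneg[of "ind P" x] by (auto simp: ind_def)
  qed (use nz in \<open>auto simp: ind_def\<close>)
  have eq: "ind (P - {\<rho>}) = (\<lambda>\<rho>'. ind P \<rho>' - ind {\<rho>} \<rho>')"
    using assms(2) by (auto simp: ind_def fun_eq_iff)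
  have "ind (P - {\<rho>}) = (\<lambda>\<rho>'. nf (ind P) \<rho>' - ind {\<rho>} \<rho>')"
  proof (rule cone_vector_unique[OF cone_vector_ind[OF c] 1])
    show "vec (ind (P - {\<rho>})) = vec (\<lambda>\<rho>'. nf (ind P) \<rho>' - ind {\<rho>} \<rho>')"
      unfolding eq vec_diff vec_nf ..
  qed
  then have "nf (ind P) = ind P"
    unfolding eq by (auto simp: fun_eq_iff)
  then have "{\<rho>. nf (ind P) \<rho> \<noteq> 0} = P" by (auto simp: ind_def)
  then show False using nf_supp[of "ind P"] primitive_not_cone[OF P] by simp
qed

lemma relation_primitive: "primitive_collection P \<Longrightarrow> \<rho> \<in> P \<Longrightarrow> relation P \<rho> = 1"
  by (simp add: relation_def ind_def primitive_disjoint)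

lemma relation_pos_iff: "primitive_collection P \<Longrightarrow> 0 < relation P \<rho> \<longleftrightarrow> \<rho> \<in> P"
  using relation_primitive nf_nonneg[of "ind P" \<rho>] by (force simp: relation_def ind_def)

section \<open>Ample and convex divisors\<close>

definition ample :: "'r \<Rightarrow> int" where "ample = (SOME a. strictly_convex F a)"

lemma ample: "strictly_convex F ample"
  using fan unfolding smooth_projective_fan_def ample_def by (intro someI_ex[of "strictly_convex F"]) simp

text \<open>On a maximal cone containing the normal form, a twist by a character makes the ample
  divisor zero there and positive on all other rays. The twist does not affect the difference of the
  two values; after it the normal form has value 0 and \<open>c\<close> has a nonnegative value,
  positive if \<open>c\<close> leaves the cone.\<close>

lemma ample_nf:
  assumes "\<And>\<rho>. 0 \<le> c \<rho>"
  shows "ev (nf c) ample \<le> ev c ample"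
    and "{\<rho>\<in>rays F. c \<rho> \<noteq> 0} \<notin> cones F \<Longrightarrow> ev (nf c) ample < ev c ample"
proof -
  obtain \<sigma> where \<sigma>: "\<sigma> \<in> maximal_cones F" "{\<rho>. nf c \<rho> \<noteq> 0} \<subseteq> \<sigma>"
    using maximal_coneE[OF nf_supp[of c]] by blast
  obtain m where m: "\<And>\<rho>. \<rho> \<in> \<sigma> \<Longrightarrow> pairing F m \<rho> = - ample \<rho>"
    "\<And>\<rho>. \<rho> \<in> rays F - \<sigma> \<Longrightarrow> pairing F m \<rho> > - ample \<rho>"
    using ample[unfolded strictly_convex_def, rule_format, OF \<sigma>(1)] by blast
  have nn: "0 \<le> ample \<rho> + pairing F m \<rho>" if "\<rho> \<in> rays F" for \<rho>
    using m[of \<rho>] that by force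
  have "ev (nf c) (\<lambda>\<rho>. ample \<rho> + pairing F m \<rho>) = 0"
    unfolding ev_def using \<sigma>(2) m(1) by (intro sum.neutral) force
  then have eq: "ev c ample - ev (nf c) ample = ev c (\<lambda>\<rho>. ample \<rho> + pairing F m \<rho>)"
    unfolding ev_simps using ev_pairing_cong[OF vec_nf, of c m] by linarith
  moreover have "0 \<le> ev c (\<lambda>\<rho>. ample \<rho> + pairing F m \<rho>)"
    by (rule ev_nonneg) (rule assms nn, assumption?)+
  ultimately show "ev (nf c) ample \<le> ev c ample" by linarith
  assume "{\<rho>\<in>rays F. c \<rho> \<noteq> 0} \<notin> cones F"
  then obtain \<rho> where \<rho>: "\<rho> \<in> rays F" "c \<rho> \<noteq> 0" "\<rho> \<notin> \<sigma>"
    using face_cone[of \<sigma> "{\<rho>\<in>rays F. c \<rho> \<noteq> 0}"] \<sigma>(1) unfolding maximal_cones_def by blast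
  have "0 < ev c (\<lambda>\<rho>. ample \<rho> + pairing F m \<rho>)"
    unfolding ev_def
  proof (rule sum_pos2[OF finite_rays \<rho>(1)])
    show "0 < c \<rho> * (ample \<rho> + pairing F m \<rho>)"
      using m(2)[of \<rho>] \<rho> assms[of \<rho>] by (intro mult_pos_pos) auto
  qed (use assms nn in auto)
  then show "ev (nf c) ample < ev c ample" using eq by linarith
qed

lemma deg_ample_pos: "primitive_collection P \<Longrightarrow> 0 < deg P ample"
proof -
  assume P: "primitive_collection P"
  have "{\<rho>\<in>rays F. ind P \<rho> \<noteq> 0} = P" using primitive_rays[OF P] by (auto simp: ind_def)
  then show ?thesis unfolding deg_alt
    using ample_nf(2)[of "ind P", OF ind_nonneg] primitive_not_cone[OF P] by simp
qed

lemma convex_ample: "convex ample"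
  using deg_ample_pos by (auto simp: convex_def intro: less_imp_le)

text \<open>Replacing a primitive collection inside \<open>c\<close> by the normal form of its sum does not increase
  the value on \<open>a\<close> and strictly decreases that on an ample divisor, so this rewriting terminates.\<close>

lemma convex_nf_le:
  assumes a: "convex a" and "\<And>\<rho>. 0 \<le> c \<rho>"
  shows "ev (nf c) a \<le> ev c a"
  using assms(2)
proof (induction "nat (ev c ample - ev (nf c) ample)" arbitrary: c rule: less_induct)
  case less
  let ?S = "{\<rho>\<in>rays F. c \<rho> \<noteq> 0}"
  show ?case
  proof (cases "?S \<in> cones F")
    case True
    \<comment> \<open>\<open>vec\<close> and \<open>ev\<close> ignore indices that are not rays,
      whereas a \<open>cone_vector\<close> vanishes there; hence the cut-off.\<close>
    define d where "d = (\<lambda>\<rho>. if \<rho> \<in> rays F then c \<rho> else 0)"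
    have "cone_vector d"
      by (rule cone_vectorI[OF _ _ True]) (use less.prems in \<open>auto simp: d_def\<close>)
    moreover have "vec d = vec c" by (rule vec_cong) (simp add: d_def)
    ultimately have "nf c = d" by (rule nf_unique)
    then have "ev (nf c) a = ev c a" by (intro ev_cong) (auto simp: d_def)
    then show ?thesis by simp
  next
    case False
    then obtain P where P: "primitive_collection P" "P \<subseteq> ?S"
      using primitive_exists[of ?S] by auto
    define c' where "c' = (\<lambda>\<rho>. c \<rho> - relation P \<rho>)"
    have nn: "0 \<le> c' \<rho>" for \<rho>
    proof -
      have "ind P \<rho> \<le> c \<rho>" using P(2) less.prems[of \<rho>] by (cases "\<rho> \<in> P") (auto simp: ind_def)
      then show ?thesis using nf_nonneg[of "ind P" \<rho>] by (simp add: c'_def relation_def)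
    qed
    have v: "nf c' = nf c"
      by (intro nf_cong) (simp add: c'_def vec_diff vec_relation)
    have e: "ev c' b = ev c b - deg P b" for b
      unfolding c'_def ev_simps deg_def ..
    have "nat (ev c' ample - ev (nf c') ample) < nat (ev c ample - ev (nf c) ample)"
      unfolding v e using deg_ample_pos[OF P(1)] ample_nf(1)[of c'] nn v e[of ample] by auto
    then have "ev (nf c') a \<le> ev c' a" using less.hyps nn by blast
    then show ?thesis unfolding v e using a P(1) by (auto simp: convex_def)
  qed
qed

text \<open>Geometrically, a half-line in the direction of an interior point of \<tau> ends in the
  star of \<tau>. Dickson's lemma supplies N < M with the normal form at N below that at M. Their
  difference is again supported on a cone, so by uniqueness it is M - N times the indicator of
  \<tau>.\<close>

lemma star_normal_form:
  assumes "\<tau> \<in> cones F"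
  obtains N c where "cone_vector c" "vec c = vec (\<lambda>\<rho>. d \<rho> + int N * ind \<tau> \<rho>)" "\<tau> \<subseteq> {\<rho>. c \<rho> \<noteq> 0}"
proof -
  define f where "f = (\<lambda>N::nat. nf (\<lambda>\<rho>. d \<rho> + int N * ind \<tau> \<rho>))"
  obtain g :: "nat \<Rightarrow> nat" where g: "strict_mono g"
    "\<And>i j. i \<le> j \<Longrightarrow> \<forall>\<rho>\<in>rays F. nat (f (g i) \<rho>) \<le> nat (f (g j) \<rho>)"
    using dickson_seq[OF finite_rays, of "\<lambda>N \<rho>. nat (f N \<rho>)"] by blast
  have f: "cone_vector (f N)" "vec (f N) = vec (\<lambda>\<rho>. d \<rho> + int N * ind \<tau> \<rho>)" for N
    unfolding f_def using nf_cone_vector vec_nf by auto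
  define N M where "N = g 0" and "M = g 1"
  have NM: "N < M" using g(1) by (simp add: N_def M_def strict_mono_less)
  have le: "f N \<rho> \<le> f M \<rho>" for \<rho>
  proof (cases "\<rho> \<in> rays F")
    case True
    then have "nat (f N \<rho>) \<le> nat (f M \<rho>)" using g(2)[of 0 1] by (simp add: N_def M_def)
    then show ?thesis using cone_vector_nonneg[OF f(1)[of M], of \<rho>] by linarith
  qed (simp add: cone_vector_rays[OF f(1)])
  have "cone_vector (\<lambda>\<rho>. f M \<rho> - f N \<rho>)"
  proof (rule cone_vectorI[OF _ _ cone_vector_supp[OF f(1)[of M]]])
    show "{\<rho>. f M \<rho> - f N \<rho> \<noteq> 0} \<subseteq> {\<rho>. f M \<rho> \<noteq> 0}"
    proof
      fix \<rho> assume "\<rho> \<in> {\<rho>. f M \<rho> - f N \<rho> \<noteq> 0}"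
      then show "\<rho> \<in> {\<rho>. f M \<rho> \<noteq> 0}"
        using le[of \<rho>] cone_vector_nonneg[OF f(1)[of N], of \<rho>] by auto
    qed
  qed (use le in auto)
  moreover have "cone_vector (\<lambda>\<rho>. (int M - int N) * ind \<tau> \<rho>)"
    by (rule cone_vectorI[OF _ _ assms]) (use NM in \<open>auto simp: ind_def\<close>)
  moreover have "vec (\<lambda>\<rho>. f M \<rho> - f N \<rho>) = vec (\<lambda>\<rho>. (int M - int N) * ind \<tau> \<rho>)"
    by (auto simp: vec_diff vec_add vec_mult f(2) algebra_simps)
  ultimately have eq: "f M \<rho> - f N \<rho> = (int M - int N) * ind \<tau> \<rho>" for \<rho>
    using cone_vector_unique by metis
  have "\<tau> \<subseteq> {\<rho>. f M \<rho> \<noteq> 0}"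
  proof
    fix \<rho> assume "\<rho> \<in> \<tau>"
    then show "\<rho> \<in> {\<rho>. f M \<rho> \<noteq> 0}"
      using eq[of \<rho>] NM cone_vector_nonneg[OF f(1)[of N], of \<rho>] by (auto simp: ind_def)
  qed
  then show ?thesis using that f by blast
qed

lemma vanishing_representative:
  assumes "\<tau> \<in> cones F"
  shows "\<exists>m. \<forall>\<rho>\<in>\<tau>. a \<rho> + pairing F m \<rho> = 0"
proof -
  obtain m where m: "\<And>\<rho>. \<rho> \<in> \<tau> \<Longrightarrow> pairing F m \<rho> = - a \<rho>"
    using cone_interpolate[OF assms, of "\<lambda>\<rho>. - a \<rho>"] by blast
  then show ?thesis by (intro exI[of _ m]) simp
qed

lemma deg_add_pairing: "deg P (\<lambda>\<rho>. a \<rho> + pairing F m \<rho>) = deg P a"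
  by (simp add: deg_add deg_pairing)

lemma convex_add_pairing: "convex (\<lambda>\<rho>. a \<rho> + pairing F m \<rho>) \<longleftrightarrow> convex a"
  by (simp add: convex_def deg_add_pairing)

text \<open>A cone containing a maximal cone equals it, so the star is \<sigma> itself. In effect
  the generator of \<rho> becomes an integral combination of those of \<sigma>.\<close>

lemma maximal_cone_normal_form:
  assumes "\<sigma> \<in> maximal_cones F"
  obtains N c where "cone_vector c" "vec c = vec (\<lambda>\<rho>'. ind {\<rho>} \<rho>' + int N * ind \<sigma> \<rho>')"
    "\<sigma> = {\<rho>. c \<rho> \<noteq> 0}"
proof -
  have "\<sigma> \<in> cones F" using assms by (simp add: maximal_cones_def)
  then obtain N c where c: "cone_vector c" "vec c = vec (\<lambda>\<rho>'. ind {\<rho>} \<rho>' + int N * ind \<sigma> \<rho>')"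
    "\<sigma> \<subseteq> {\<rho>. c \<rho> \<noteq> 0}"
    by (rule star_normal_form)
  have "\<sigma> = {\<rho>. c \<rho> \<noteq> 0}"
    using assms c(3) cone_vector_supp[OF c(1)] unfolding maximal_cones_def by simp
  then show ?thesis by (rule that[OF c(1,2)])
qed

lemma ev_ind_singleton: "\<rho> \<in> rays F \<Longrightarrow> ev (ind {\<rho>}) a = a \<rho>"
  unfolding ev_def ind_def by simp

lemma ev_zero: "(\<And>\<rho>. \<rho> \<in> rays F \<Longrightarrow> c \<rho> \<noteq> 0 \<Longrightarrow> a \<rho> = 0) \<Longrightarrow> ev c a = 0"
  unfolding ev_def by (intro sum.neutral) auto

lemma pairing_zero:
  assumes \<sigma>: "\<sigma> \<in> maximal_cones F" and z: "\<And>\<rho>. \<rho> \<in> \<sigma> \<Longrightarrow> pairing F m \<rho> = 0" and "\<rho> \<in> rays F"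
  shows "pairing F m \<rho> = 0"
proof -
  obtain N c where c: "cone_vector c" "vec c = vec (\<lambda>\<rho>'. ind {\<rho>} \<rho>' + int N * ind \<sigma> \<rho>')"
    "\<sigma> = {\<rho>. c \<rho> \<noteq> 0}"
    by (rule maximal_cone_normal_form[OF \<sigma>])
  have "ev c (pairing F m) = ev (\<lambda>\<rho>'. ind {\<rho>} \<rho>' + int N * ind \<sigma> \<rho>') (pairing F m)"
    by (rule ev_pairing_cong[OF c(2)])
  moreover have "ev c (pairing F m) = 0" using z c(3) by (intro ev_zero) auto
  moreover have "ev (ind \<sigma>) (pairing F m) = 0"
    using z by (intro ev_zero) (auto simp: ind_def)
  ultimately show ?thesis using ev_ind_singleton[OF assms(3)] by (simp add: ev_simps)
qed

text \<open>This is global generation at the torus-fixed point of a maximal cone \<sigma>. With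
  \<open>b\<close> zero on \<sigma>, the number \<open>b \<rho>\<close> is the value of
  \<open>b\<close> on \<rho> plus N times the sum over \<sigma>. Passing to the normal form, which
  is supported on \<sigma>, cannot raise the value and leaves 0.\<close>

lemma effective_representative:
  assumes a: "convex a" and "\<tau> \<in> cones F"
  shows "\<exists>m. (\<forall>\<rho>\<in>\<tau>. a \<rho> + pairing F m \<rho> = 0) \<and> (\<forall>\<rho>\<in>rays F. 0 \<le> a \<rho> + pairing F m \<rho>)"
proof -
  obtain \<sigma> where \<sigma>: "\<sigma> \<in> maximal_cones F" "\<tau> \<subseteq> \<sigma>" by (rule maximal_coneE[OF assms(2)])
  then have \<sigma>c: "\<sigma> \<in> cones F" by (auto simp: maximal_cones_def)
  obtain m where m: "\<And>\<rho>. \<rho> \<in> \<sigma> \<Longrightarrow> a \<rho> + pairing F m \<rho> = 0"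
    using vanishing_representative[OF \<sigma>c, of a] by blast
  define b where "b = (\<lambda>\<rho>. a \<rho> + pairing F m \<rho>)"
  have b: "convex b" using a unfolding b_def convex_add_pairing .
  have "0 \<le> b \<rho>" if \<rho>: "\<rho> \<in> rays F" for \<rho>
  proof -
    obtain N c where c: "cone_vector c" "vec c = vec (\<lambda>\<rho>'. ind {\<rho>} \<rho>' + int N * ind \<sigma> \<rho>')"
      "\<sigma> = {\<rho>. c \<rho> \<noteq> 0}"
      by (rule maximal_cone_normal_form[OF \<sigma>(1)])
    have "ev c b = 0" using m c(3) by (intro ev_zero) (auto simp: b_def)
    moreover have "ev (nf (\<lambda>\<rho>'. ind {\<rho>} \<rho>' + int N * ind \<sigma> \<rho>')) b \<le> ev (\<lambda>\<rho>'. ind {\<rho>} \<rho>' + int N * ind \<sigma> \<rho>') b"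
      by (rule convex_nf_le[OF b]) (simp add: ind_def)
    moreover have "nf (\<lambda>\<rho>'. ind {\<rho>} \<rho>' + int N * ind \<sigma> \<rho>') = c"
      using nf_unique c by blast
    moreover have "ev (ind \<sigma>) b = 0" using m by (intro ev_zero) (auto simp: b_def ind_def)
    ultimately show ?thesis using ev_ind_singleton[OF \<rho>] by (simp add: ev_simps)
  qed
  then show ?thesis using m \<sigma>(2) by (intro exI[of _ m]) (auto simp: b_def)
qed

text \<open>Both \<open>a\<close> and its negative are convex, so each has an effective
  representative vanishing on one fixed maximal cone. The sum of these is a character vanishing on
  that cone, hence on all rays, and nonnegative divisors with sum 0 are 0. Thus the degrees on
  primitive relations embed \<open>Pic F\<close> into a power of the integers.\<close>

lemma deg_zero_imp_pairing:
  assumes "\<And>P. primitive_collection P \<Longrightarrow> deg P a = 0"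
  shows "\<exists>m. \<forall>\<rho>\<in>rays F. a \<rho> = pairing F m \<rho>"
proof -
  obtain \<sigma> where \<sigma>: "\<sigma> \<in> maximal_cones F" by (rule maximal_coneE[OF empty_cone])
  then have \<sigma>c: "\<sigma> \<in> cones F" by (auto simp: maximal_cones_def)
  define b where "b = (\<lambda>\<rho>. (-1) * a \<rho>)"
  have "deg P b = 0" if "primitive_collection P" for P
    unfolding b_def deg_mult using assms[OF that] by simp
  then have "convex a" "convex b" using assms by (auto simp: convex_def)
  obtain m where m: "\<And>\<rho>. \<rho> \<in> \<sigma> \<Longrightarrow> a \<rho> + pairing F m \<rho> = 0"
      "\<And>\<rho>. \<rho> \<in> rays F \<Longrightarrow> 0 \<le> a \<rho> + pairing F m \<rho>"
    using effective_representative[OF \<open>convex a\<close> \<sigma>c] by blast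
  obtain m' where m': "\<And>\<rho>. \<rho> \<in> \<sigma> \<Longrightarrow> b \<rho> + pairing F m' \<rho> = 0"
      "\<And>\<rho>. \<rho> \<in> rays F \<Longrightarrow> 0 \<le> b \<rho> + pairing F m' \<rho>"
    using effective_representative[OF \<open>convex b\<close> \<sigma>c] by blast
  have add: "pairing F (\<lambda>i. m i + m' i) \<rho> = pairing F m \<rho> + pairing F m' \<rho>" for \<rho>
    by (simp add: pairing_def algebra_simps sum.distrib)
  have sum0: "pairing F (\<lambda>i. m i + m' i) \<rho> = 0" if "\<rho> \<in> rays F" for \<rho>
  proof (rule pairing_zero[OF \<sigma> _ that])
    show "pairing F (\<lambda>i. m i + m' i) \<rho> = 0" if "\<rho> \<in> \<sigma>" for \<rho>
      using m(1)[OF that] m'(1)[OF that] unfolding add b_def by simp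
  qed
  have "a \<rho> = pairing F m' \<rho>" if "\<rho> \<in> rays F" for \<rho>
    using m(2)[OF that] m'(2)[OF that] sum0[OF that] unfolding add b_def by linarith
  then show ?thesis by blast
qed


section \<open>Extremal primitive relations\<close>

text \<open>The divisor \<open>h\<close> certifies that the relation of \<open>P\<close> spans an
  extremal ray of the cone generated by all primitive relations. No other one can lie on that ray,
  since they are pairwise not proportional.\<close>

definition extremal_by :: "('r \<Rightarrow> int) \<Rightarrow> 'r set \<Rightarrow> bool" where
  "extremal_by h P \<longleftrightarrow> primitive_collection P \<and> deg P h = 0 \<and>
     (\<forall>Q. primitive_collection Q \<longrightarrow> Q \<noteq> P \<longrightarrow> 0 < deg Q h)"

lemma extremal_convex: "extremal_by h P \<Longrightarrow> convex h"
  unfolding extremal_by_def convex_def by (metis order.refl less_imp_le)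

text \<open>Tested on coordinate divisors, proportional relations have the same positive entries,
  the ratio being positive because ample degrees are; and the positive entries of a primitive
  relation recover its collection.\<close>

lemma not_proportional:
  assumes "primitive_collection P" "primitive_collection Q" "P \<noteq> Q"
  shows "\<exists>b. deg P b * deg Q ample \<noteq> deg Q b * deg P ample"
proof (rule ccontr)
  assume "\<not> ?thesis"
  then have eq: "deg P b * deg Q ample = deg Q b * deg P ample" for b by blast
  have d: "deg P' (ind {\<rho>}) = relation P' \<rho>" if "\<rho> \<in> rays F" for P' \<rho>
    unfolding deg_def ev_def ind_def using that by simp
  have "\<rho> \<in> P \<longleftrightarrow> \<rho> \<in> Q" if "\<rho> \<in> rays F" for \<rho>
  proof -
    have "relation P \<rho> * deg Q ample = relation Q \<rho> * deg P ample"
      using eq[of "ind {\<rho>}"] d that by simp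
    then have "0 < relation P \<rho> \<longleftrightarrow> 0 < relation Q \<rho>"
      using deg_ample_pos[OF assms(1)] deg_ample_pos[OF assms(2)]
      by (metis zero_less_mult_pos2 mult_pos_pos)
    then show ?thesis using relation_pos_iff assms(1,2) by simp
  qed
  then show False using assms primitive_rays by blast
qed

lemma ratio_minimizer:
  fixes f g :: "'b \<Rightarrow> int"
  assumes "finite Z" "Z \<noteq> {}" and g: "\<And>x. x \<in> Z \<Longrightarrow> 0 < g x"
  shows "\<exists>x\<in>Z. \<forall>y\<in>Z. f x * g y \<le> f y * g x"
proof -
  obtain x where x: "x \<in> Z" "\<And>y. y \<in> Z \<Longrightarrow> rat_of_int (f x) / rat_of_int (g x) \<le> rat_of_int (f y) / rat_of_int (g y)"
    using ex_is_arg_min_if_finite[OF assms(1,2), of "\<lambda>x. rat_of_int (f x) / rat_of_int (g x)"]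
    by (auto simp: is_arg_min_linorder)
  have "f x * g y \<le> f y * g x" if "y \<in> Z" for y
  proof -
    have "rat_of_int (f x * g y) \<le> rat_of_int (f y * g x)"
      using x(2)[OF that] g[OF that] g[OF x(1)] by (simp add: field_simps)
    then show ?thesis by (simp only: of_int_le_iff)
  qed
  then show ?thesis using x(1) by blast
qed

text \<open>Start from the boundary point of the nef cone on the segment from an ample class to \<open>d\<close>, and
  perturb it to shrink the set of relations on which it vanishes.\<close>

lemma extremal_exists:
  assumes P0: "primitive_collection P0" and d: "deg P0 d < 0"
  obtains h P where "extremal_by h P" "deg P d < 0"
proof -
  let ?V = "{P. primitive_collection P}"
  define Z where "Z = (\<lambda>h. {P \<in> ?V. deg P h = 0})"
  define good where "good = (\<lambda>h. convex h \<and> Z h \<noteq> {} \<and> (\<forall>P\<in>Z h. deg P d < 0))"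
  have "\<exists>h. good h"
  proof -
    let ?N = "{P \<in> ?V. deg P d < 0}"
    have "finite ?N" "?N \<noteq> {}" using finite_primitive assms by auto
    \<comment> \<open>\<open>Q\<close> minimises \<open>deg P ample\<close> /
      \<open>- deg P d\<close>, so its wall is the first one met on the way from
      \<open>ample\<close> to \<open>d\<close>; \<open>h\<close> below is that point with
      denominators cleared.\<close>
    then obtain Q where Q: "Q \<in> ?N" "\<And>P. P \<in> ?N \<Longrightarrow> deg Q ample * - deg P d \<le> deg P ample * - deg Q d"
      using ratio_minimizer[of ?N "\<lambda>P. - deg P d" "\<lambda>P. deg P ample"] by auto
    define h where "h = (\<lambda>\<rho>. (- deg Q d) * ample \<rho> + deg Q ample * d \<rho>)"
    have h: "deg P h = (- deg Q d) * deg P ample + deg Q ample * deg P d" for P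
      unfolding h_def deg_add deg_mult ..
    have pos: "0 < deg P h" if "P \<in> ?V" "0 \<le> deg P d" for P
      unfolding h using that Q(1) deg_ample_pos[of P] deg_ample_pos[of Q]
      by (intro add_pos_nonneg mult_pos_pos mult_nonneg_nonneg) auto
    have "convex h"
      unfolding convex_def
    proof (intro allI impI)
      fix P assume "primitive_collection P"
      then show "0 \<le> deg P h"
        using pos[of P] Q(2)[of P] by (cases "deg P d < 0") (auto simp: h algebra_simps)
    qed
    moreover have "deg Q h = 0" by (simp add: h)
    ultimately have "good h" unfolding good_def Z_def using Q(1) pos by force
    then show ?thesis by (rule exI[of good])
  qed
  then obtain h where h: "good h" "\<And>h'. good h' \<Longrightarrow> card (Z h) \<le> card (Z h')"
    using ex_has_least_nat[of good _ "\<lambda>h. card (Z h)"] by blast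
  have fin: "finite (Z h)" unfolding Z_def using finite_primitive by simp
  obtain P where P: "P \<in> Z h" using h(1) by (auto simp: good_def)
  have "Z h = {P}"
  proof (rule ccontr)
    assume "Z h \<noteq> {P}"
    then obtain P' where P': "P' \<in> Z h" "P' \<noteq> P" using P by blast
    obtain b where b: "deg P b * deg P' ample \<noteq> deg P' b * deg P ample"
      using not_proportional[of P P'] P P' by (auto simp: Z_def)
    obtain Q where Q: "Q \<in> Z h" "\<And>R. R \<in> Z h \<Longrightarrow> deg Q b * deg R ample \<le> deg R b * deg Q ample"
      using ratio_minimizer[OF fin, of "\<lambda>P. deg P ample" "\<lambda>P. deg P b"] P deg_ample_pos
      by (auto simp: Z_def)
    \<comment> \<open>Minimality of the ratio at \<open>Q\<close> makes \<open>g\<close> nonnegative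
      on \<open>Z h\<close> and zero at \<open>Q\<close>. It is not zero on all of
      \<open>Z h\<close>, because \<open>b\<close> separates \<open>P\<close> from
      \<open>P'\<close>.\<close>
    define g where "g = (\<lambda>\<rho>. deg Q ample * b \<rho> - deg Q b * ample \<rho>)"
    have g: "deg R g = deg Q ample * deg R b - deg Q b * deg R ample" for R
      unfolding g_def deg_diff deg_mult ..
    have gnn: "0 \<le> deg R g" if "R \<in> Z h" for R
      using Q(2)[OF that] by (simp add: g algebra_simps)
    \<comment> \<open>Large enough that \<open>g\<close> cannot spoil the relations on which
      \<open>h\<close> has degree at least 1.\<close>
    define M where "M = 1 + (\<Sum>R\<in>?V. \<bar>deg R g\<bar>)"
    define h' where "h' = (\<lambda>\<rho>. M * h \<rho> + g \<rho>)"
    have h': "deg R h' = M * deg R h + deg R g" for R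
      unfolding h'_def deg_add deg_mult ..
    have M: "\<bar>deg R g\<bar> < M" if "R \<in> ?V" for R
      using member_le_sum[of R ?V "\<lambda>R. \<bar>deg R g\<bar>"] that finite_primitive by (simp add: M_def)
    have pos: "0 < deg R h'" if "R \<in> ?V" "R \<notin> Z h" for R
    proof -
      have "1 \<le> deg R h" using that h(1) by (auto simp: Z_def good_def convex_def dest: spec[of _ R])
      moreover have "0 < M" using M[OF that(1)] by linarith
      ultimately have "M \<le> M * deg R h" by simp
      then show ?thesis using M[OF that(1)] by (simp add: h')
    qed
    have onZ: "deg R h' = deg R g" if "R \<in> Z h" for R using that by (simp add: h' Z_def)
    have sub: "Z h' \<subseteq> Z h" using pos by (force simp: Z_def)
    have "\<exists>R\<in>Z h. R \<notin> Z h'"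
    proof (rule ccontr)
      assume "\<not> ?thesis"
      then have "deg P g = 0" "deg P' g = 0" using P P'(1) onZ by (auto simp: Z_def)
      then have e: "deg Q ample * deg P b = deg Q b * deg P ample"
        "deg Q ample * deg P' b = deg Q b * deg P' ample" by (auto simp: g)
      have "deg Q ample * (deg P b * deg P' ample) = deg Q ample * (deg P' b * deg P ample)"
        using e by (metis (no_types, opaque_lifting) mult.assoc mult.commute)
      moreover have "deg Q ample \<noteq> 0" using deg_ample_pos[of Q] Q(1) by (auto simp: Z_def)
      ultimately show False using b by simp
    qed
    then have lt: "card (Z h') < card (Z h)" using sub fin by (intro psubset_card_mono) auto
    have "convex h'"
      unfolding convex_def
    proof (intro allI impI)
      fix R assume "primitive_collection R"
      then show "0 \<le> deg R h'"
        using pos[of R] onZ[of R] gnn[of R] by (cases "R \<in> Z h") auto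
    qed
    moreover have "Q \<in> Z h'" using Q(1) onZ[of Q] by (auto simp: Z_def g)
    ultimately have "good h'" using sub h(1) by (auto simp: good_def)
    then show False using h(2) lt by fastforce
  qed
  then have "extremal_by h P" "deg P d < 0"
    using h(1) P unfolding extremal_by_def good_def Z_def convex_def
    by (auto simp: set_eq_iff order.order_iff_strict)
  then show ?thesis by (rule that)
qed

text \<open>Otherwise the set contains a primitive collection \<open>Q\<close> without \<rho>, on
  which \<open>h\<close> is positive. Rewriting \<open>Q\<close> inside a sum of rays of
  \<open>P\<close> and of the cone of its relation lowers the value of \<open>h\<close> strictly.
  But that sum already has the value of its normal form, since \<open>h\<close> vanishes on the
  relation of \<open>P\<close>, and normal forms minimise convex divisors.\<close>

lemma extremal_contractible:
  assumes P: "extremal_by h P" and \<rho>: "\<rho> \<in> P"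
  shows "(P - {\<rho>}) \<union> {\<rho>. nf (ind P) \<rho> \<noteq> 0} \<in> cones F"
proof (rule ccontr)
  let ?\<sigma> = "{\<rho>. nf (ind P) \<rho> \<noteq> 0}"
  assume n: "(P - {\<rho>}) \<union> ?\<sigma> \<notin> cones F"
  have prim: "primitive_collection P" using P by (simp add: extremal_by_def)
  have "(P - {\<rho>}) \<union> ?\<sigma> \<subseteq> rays F"
    using primitive_rays[OF prim] cone_subset_rays[OF nf_supp] by blast
  then obtain Q where Q: "primitive_collection Q" "Q \<subseteq> (P - {\<rho>}) \<union> ?\<sigma>"
    using primitive_exists n by metis
  have "\<rho> \<notin> Q" using Q(2) primitive_disjoint[OF prim \<rho>] by auto
  then have pos: "0 < deg Q h" using P Q(1) \<rho> by (auto simp: extremal_by_def)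
  \<comment> \<open>The second summand makes room for the rays of \<open>Q\<close> that lie in the
    cone of the relation.\<close>
  define c where "c = (\<lambda>\<rho>. ind P \<rho> + ind ?\<sigma> \<rho>)"
  define c' where "c' = (\<lambda>\<rho>. c \<rho> - relation Q \<rho>)"
  define e where "e = (\<lambda>\<rho>. nf (ind P) \<rho> + ind ?\<sigma> \<rho>)"
  have "cone_vector e"
    unfolding e_def
  proof (rule cone_vector_add[OF nf_cone_vector cone_vector_ind[OF nf_supp]])
    have "?\<sigma> \<union> {\<rho>. ind ?\<sigma> \<rho> \<noteq> 0} = ?\<sigma>" by (auto simp: ind_def)
    then show "?\<sigma> \<union> {\<rho>. ind ?\<sigma> \<rho> \<noteq> 0} \<in> cones F" using nf_supp by simp
  qed
  moreover have "vec e = vec c'"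
    by (simp add: e_def c'_def c_def vec_add vec_diff vec_nf vec_relation)
  ultimately have e: "nf c' = e" by (rule nf_unique)
  have "0 \<le> c' x" for x
    using Q(2) nf_nonneg[of "ind Q" x] by (auto simp: c'_def c_def relation_def ind_def of_bool_def)
  then have "ev e h \<le> ev c' h" using convex_nf_le[OF extremal_convex[OF P], of c'] e by simp
  moreover have "ev c' h = ev c h - deg Q h" unfolding c'_def ev_simps deg_def ..
  moreover have "ev e h = ev c h"
    using P unfolding e_def c_def ev_simps extremal_by_def deg_alt by simp
  ultimately show False using pos by simp
qed

end

section \<open>Places of the rational function field\<close>

text \<open>The function field of the projective line, the source of all curves used to refute
  nefness.\<close>

definition rational_functions :: "'k::field ambient set" where
  "rational_functions = range to_ac"

definition var_t :: "'k::field ambient" where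
  "var_t = to_ac (Fract [:0, 1:] 1)"

abbreviation peval :: "'k::field poly \<Rightarrow> 'k ambient \<Rightarrow> 'k ambient" where
  "peval p s \<equiv> poly (map_poly const p) s"

lemma const_0 [simp]: "const 0 = 0"
  by (simp add: const_def fract_collapse)

lemma const_1 [simp]: "const 1 = 1"
  by (simp add: const_def fract_collapse flip: one_pCons)

lemma const_add: "const (a + b) = const a + const b"
  by (simp add: const_def flip: to_ac_add)

lemma const_mult: "const (a * b) = const a * const b"
  by (simp add: const_def mult.commute flip: to_ac_mult)

lemma const_uminus: "const (- a) = - const a"
  using const_add[of a "- a"] by (simp add: eq_neg_iff_add_eq_0 add.commute)

lemma const_eq_0_iff [simp]: "const a = 0 \<longleftrightarrow> a = 0"
  by (simp add: const_def Zero_fract_def eq_fract)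

lemma const_in_rational_functions: "const c \<in> rational_functions"
  by (simp add: const_def rational_functions_def)

lemma peval_pCons [simp]: "peval (pCons a p) s = const a + s * peval p s"
  by (simp add: map_poly_pCons)

lemma peval_0 [simp]: "peval 0 s = 0" by simp

lemma peval_add: "peval (p + q) s = peval p s + peval q s"
proof (induction p arbitrary: q)
  case (pCons a p)
  obtain b q' where "q = pCons b q'" by (cases q)
  then show ?case using pCons.IH[of q'] by (simp add: const_add algebra_simps)
qed simp

lemma peval_smult: "peval (smult a p) s = const a * peval p s"
  by (induction p) (simp_all add: const_mult algebra_simps)

lemma peval_diff: "peval (p - q) s = peval p s - peval q s"
  using peval_add[of "p - q" q s] by simp

lemma to_ac_pCons: "to_ac (Fract (pCons a p) 1) = const a + var_t * to_ac (Fract p 1)"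
  by (simp add: const_def var_t_def flip: to_ac_mult to_ac_add)

lemma peval_var: "peval p var_t = to_ac (Fract p 1)"
proof (induction p)
  case 0
  then show ?case by (simp add: fract_collapse)
next
  case (pCons a p)
  then show ?case by (simp add: to_ac_pCons)
qed

lemma var_t_nonzero [simp]: "var_t \<noteq> 0"
  by (simp add: var_t_def Zero_fract_def eq_fract)

text \<open>Turns polynomials in t into polynomials in 1/t, so that infinity can be treated like
  zero.\<close>

lemma peval_reflect:
  assumes "s \<noteq> 0"
  shows "peval (reflect_poly p) s = s ^ degree p * peval p (inverse s)"
proof -
  have d: "degree (map_poly const p) = degree p" by (simp add: degree_map_poly)
  have "reflect_poly (map_poly const p) = map_poly const (reflect_poly p)"
    by (rule poly_eqI) (simp add: coeff_reflect_poly coeff_map_poly d)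
  then show ?thesis using poly_reflect_poly_nz[OF assms, of "map_poly const p"] d by simp
qed

lemma rational_functionsE:
  assumes "x \<in> rational_functions"
  obtains p q where "q \<noteq> 0" "x = peval p var_t / peval q var_t"
proof -
  obtain f where f: "x = to_ac f" using assms by (auto simp: rational_functions_def)
  obtain p q where "f = Fract p q" "q \<noteq> 0" by (cases f)
  then have "x = peval p var_t / peval q var_t"
    unfolding peval_var f by (simp flip: to_ac_divide)
  then show ?thesis using that \<open>q \<noteq> 0\<close> by blast
qed

lemma is_subfield_rational_functions: "is_subfield (rational_functions :: 'k::field ambient set)"
  unfolding is_subfield_def rational_functions_def
proof (intro conjI ballI)
  show "1 \<in> range (to_ac :: 'k poly fract \<Rightarrow> 'k ambient)" by (metis rangeI to_ac_1)
  fix x y :: "'k ambient" assume "x \<in> range to_ac" "y \<in> range to_ac"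
  then obtain u v where "x = to_ac u" "y = to_ac v" by auto
  then have "x - y = to_ac (u - v)" "x * y = to_ac (u * v)" by simp_all
  then show "x - y \<in> range to_ac" "x * y \<in> range to_ac" by blast+
next
  fix x :: "'k ambient" assume "x \<in> range to_ac"
  then obtain u where "x = to_ac u" by auto
  then have "inverse x = to_ac (inverse u)" by simp
  then show "inverse x \<in> range to_ac" by blast
qed

lemma is_subfield_closed:
  assumes "is_subfield L"
  shows "1 \<in> L" "0 \<in> L" "x \<in> L \<Longrightarrow> y \<in> L \<Longrightarrow> x - y \<in> L" "x \<in> L \<Longrightarrow> y \<in> L \<Longrightarrow> x * y \<in> L"
    "x \<in> L \<Longrightarrow> inverse x \<in> L" "x \<in> L \<Longrightarrow> - x \<in> L" "x \<in> L \<Longrightarrow> y \<in> L \<Longrightarrow> x + y \<in> L"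
    "x \<in> L \<Longrightarrow> y \<in> L \<Longrightarrow> x / y \<in> L"
proof -
  have *: "1 \<in> L" "\<And>x y. x \<in> L \<Longrightarrow> y \<in> L \<Longrightarrow> x - y \<in> L" "\<And>x y. x \<in> L \<Longrightarrow> y \<in> L \<Longrightarrow> x * y \<in> L"
    "\<And>x. x \<in> L \<Longrightarrow> inverse x \<in> L" using assms by (auto simp: is_subfield_def)
  have 0: "0 \<in> L" using *(2)[OF *(1) *(1)] by simp
  have m: "- x \<in> L" if "x \<in> L" for x using *(2)[OF 0 that] by simp
  have a: "x + y \<in> L" if "x \<in> L" "y \<in> L" for x y using *(2)[OF that(1) m[OF that(2)]] by simp
  have d: "x / y \<in> L" if "x \<in> L" "y \<in> L" for x y
    using *(3)[OF that(1) *(4)[OF that(2)]] by (simp add: divide_inverse)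
  show "1 \<in> L" "0 \<in> L" "x \<in> L \<Longrightarrow> y \<in> L \<Longrightarrow> x - y \<in> L" "x \<in> L \<Longrightarrow> y \<in> L \<Longrightarrow> x * y \<in> L"
    "x \<in> L \<Longrightarrow> inverse x \<in> L" "x \<in> L \<Longrightarrow> - x \<in> L" "x \<in> L \<Longrightarrow> y \<in> L \<Longrightarrow> x + y \<in> L"
    "x \<in> L \<Longrightarrow> y \<in> L \<Longrightarrow> x / y \<in> L"
    by (fact * 0 m a d)+
qed

lemma peval_in_subfield: "is_subfield L \<Longrightarrow> range const \<subseteq> L \<Longrightarrow> s \<in> L \<Longrightarrow> peval p s \<in> L"
  by (induction p) (auto intro!: is_subfield_closed(2,4,7))

lemma var_t_in: "var_t \<in> rational_functions"
  by (simp add: var_t_def rational_functions_def)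

lemma peval_in_rational_functions: "s \<in> rational_functions \<Longrightarrow> peval p s \<in> rational_functions"
  using peval_in_subfield[OF is_subfield_rational_functions] const_in_rational_functions by blast

lemma function_field_rational_functions: "function_field (rational_functions :: 'k::field ambient set)"
  unfolding function_field_def
proof (intro conjI)
  have "rational_functions = \<Inter>{E. is_subfield E \<and> range const \<union> {var_t} \<subseteq> (E :: 'k ambient set)}"
  proof (intro equalityI subsetI)
    fix x :: "'k ambient" assume x: "x \<in> rational_functions"
    then obtain p q where "x = peval p var_t / peval q var_t" by (rule rational_functionsE)
    then show "x \<in> \<Inter>{E. is_subfield E \<and> range const \<union> {var_t} \<subseteq> E}"
      by (auto intro!: is_subfield_closed(8) peval_in_subfield)
  next
    fix x :: "'k ambient" assume "x \<in> \<Inter>{E. is_subfield E \<and> range const \<union> {var_t} \<subseteq> E}"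
    then show "x \<in> rational_functions"
      using is_subfield_rational_functions const_in_rational_functions var_t_in by blast
  qed
  then show "\<exists>A. finite A \<and> rational_functions = \<Inter>{E. is_subfield E \<and> range const \<union> A \<subseteq> (E :: 'k ambient set)}"
    by (intro exI[of _ "{var_t}"]) auto
  show "\<exists>t\<in>rational_functions. \<forall>p. p \<noteq> 0 \<longrightarrow> peval p (t :: 'k ambient) \<noteq> 0"
    using var_t_in by (intro bexI[of _ var_t]) (auto simp: peval_var Zero_fract_def eq_fract)
qed

lemma rational_functions_closed:
  "1 \<in> rational_functions" "0 \<in> rational_functions"
  "x \<in> rational_functions \<Longrightarrow> y \<in> rational_functions \<Longrightarrow> x - y \<in> rational_functions"
  "x \<in> rational_functions \<Longrightarrow> y \<in> rational_functions \<Longrightarrow> x * y \<in> rational_functions"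
  "x \<in> rational_functions \<Longrightarrow> inverse x \<in> rational_functions"
  "x \<in> rational_functions \<Longrightarrow> - x \<in> rational_functions"
  "x \<in> rational_functions \<Longrightarrow> y \<in> rational_functions \<Longrightarrow> x + y \<in> rational_functions"
  "x \<in> rational_functions \<Longrightarrow> y \<in> rational_functions \<Longrightarrow> x / y \<in> rational_functions"
  using is_subfield_closed[OF is_subfield_rational_functions] by auto

lemma place_outside: "place L v \<Longrightarrow> x \<notin> L - {0} \<Longrightarrow> v x = 0"
  and place_mult: "place L v \<Longrightarrow> x \<in> L \<Longrightarrow> x \<noteq> 0 \<Longrightarrow> y \<in> L \<Longrightarrow> y \<noteq> 0 \<Longrightarrow> v (x * y) = v x + v y"
  and place_add: "place L v \<Longrightarrow> x \<in> L \<Longrightarrow> x \<noteq> 0 \<Longrightarrow> y \<in> L \<Longrightarrow> y \<noteq> 0 \<Longrightarrow> x + y \<noteq> 0 \<Longrightarrow>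
    min (v x) (v y) \<le> v (x + y)"
  and place_const: "place L v \<Longrightarrow> c \<noteq> 0 \<Longrightarrow> v (const c) = 0"
  and place_normalised: "place L v \<Longrightarrow> \<exists>x\<in>L - {0}. v x = 1"
  by (auto simp: place_def)

lemma place_zero: "place L v \<Longrightarrow> v 0 = 0"
  using place_outside by blast

lemma place_one: "place L v \<Longrightarrow> v 1 = 0"
  using place_const[of L v 1] by simp

lemma place_inverse:
  assumes "place L v" "is_subfield L" "x \<in> L"
  shows "v (inverse x) = - v x"
proof (cases "x = 0")
  case False
  have "v (x * inverse x) = v x + v (inverse x)"
    using assms False is_subfield_closed by (intro place_mult) auto
  then show ?thesis using False place_one[OF assms(1)] by simp
qed (use place_zero[OF assms(1)] in simp)

lemma place_divide:
  assumes "place L v" "is_subfield L" "x \<in> L" "y \<in> L" "x \<noteq> 0" "y \<noteq> 0"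
  shows "v (x / y) = v x - v y"
  unfolding divide_inverse using assms is_subfield_closed(5)[OF assms(2,4)]
  by (subst place_mult) (auto simp: place_inverse)

lemma place_power:
  assumes "place L v" "is_subfield L" "x \<in> L" "x \<noteq> 0"
  shows "x ^ n \<in> L \<and> v (x ^ n) = int n * v x"
proof (induction n)
  case (Suc n)
  then show ?case using assms is_subfield_closed(4)[OF assms(2)]
    by (auto simp: place_mult algebra_simps)
qed (use assms is_subfield_closed place_one in auto)

lemma place_power_int:
  assumes "place L v" "is_subfield L" "x \<in> L" "x \<noteq> 0"
  shows "x powi n \<in> L" "v (x powi n) = n * v x"
  using place_power[OF assms] assms is_subfield_closed(5)[OF assms(2)]
    place_power[OF assms(1,2), of "inverse x"] place_inverse[OF assms(1-3)]
  by (auto simp: power_int_def)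

lemma place_minus:
  assumes "place L v" "is_subfield L" "x \<in> L"
  shows "v (- x) = v x"
proof (cases "x = 0")
  case False
  have m: "- 1 \<in> L" "(1::'a ambient) \<in> L" using is_subfield_closed(6)[OF assms(2)] is_subfield_closed(1)[OF assms(2)] by auto
  have "v ((-1) * (-1)) = v (-1) + v (-1)"
    using m by (intro place_mult[OF assms(1)]) auto
  then have "v (-1) = 0" using place_one[OF assms(1)] by simp
  moreover have "v ((-1) * x) = v (-1) + v x"
    using m assms(3) False by (intro place_mult[OF assms(1)]) auto
  ultimately show ?thesis by simp
qed simp

lemma place_add_strict:
  assumes "place L v" "is_subfield L" "x \<in> L" "x \<noteq> 0" "y \<in> L" "y = 0 \<or> v x < v y"
  shows "x + y \<noteq> 0" "v (x + y) = v x"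
proof -
  have "x + y \<noteq> 0 \<and> v (x + y) = v x"
  proof (cases "y = 0")
    case False
    then have lt: "v x < v y" using assms by blast
    have nz: "x + y \<noteq> 0"
    proof
      assume "x + y = 0"
      then have "x = - y" by (simp add: eq_neg_iff_add_eq_0)
      then show False using place_minus[OF assms(1,2,5)] lt by simp
    qed
    have "v x \<le> v (x + y)"
      using place_add[OF assms(1,3-5) False nz] lt by simp
    moreover have "min (v (x + y)) (v (- y)) \<le> v ((x + y) + (- y))"
      using assms nz False is_subfield_closed(6,7)[OF assms(2)] by (intro place_add[OF assms(1)]) auto
    ultimately show ?thesis using nz lt place_minus[OF assms(1,2,5)] by auto
  qed (use assms in auto)
  then show "x + y \<noteq> 0" "v (x + y) = v x" by auto
qed

abbreviation rat_place :: "('k::field ambient \<Rightarrow> int) \<Rightarrow> bool" where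
  "rat_place \<equiv> place rational_functions"

lemma peval_nonneg:
  assumes v: "rat_place v" and s: "s \<in> rational_functions" "0 < v s"
  shows "peval p s = 0 \<or> 0 \<le> v (peval p s)"
proof (induction p)
  case (pCons a p)
  have s0: "s \<noteq> 0" using s(2) place_zero[OF v] by auto
  have c: "const a \<in> rational_functions" "s * peval p s \<in> rational_functions"
    using const_in_rational_functions peval_in_rational_functions[OF s(1)] s(1)
      rational_functions_closed(4) by auto
  have 2: "s * peval p s = 0 \<or> 0 \<le> v (s * peval p s)"
    using pCons.IH place_mult[OF v s(1) s0, of "peval p s"] peval_in_rational_functions[OF s(1)] s(2) by force
  have 1: "const a = 0 \<or> v (const a) = 0" using place_const[OF v] by auto
  show ?case
  proof (rule disjCI)
    assume nz: "\<not> 0 \<le> v (peval (pCons a p) s)"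
    show "peval (pCons a p) s = 0"
    proof (rule ccontr)
      assume "peval (pCons a p) s \<noteq> 0"
      then show False
        using nz 1 2 place_add[OF v c(1) _ c(2)] by fastforce
    qed
  qed
qed simp

text \<open>The constant term has value 0 and the remaining part is 0 or of positive value, so the
  constant term dominates.\<close>

lemma peval_unit:
  assumes v: "rat_place v" and s: "s \<in> rational_functions" "0 < v s" and p: "coeff p 0 \<noteq> 0"
  shows "peval p s \<noteq> 0" "v (peval p s) = 0"
proof -
  obtain a q where pq: "p = pCons a q" by (cases p)
  then have a: "a \<noteq> 0" using p by simp
  have s0: "s \<noteq> 0" using s(2) place_zero[OF v] by auto
  have c: "const a \<in> rational_functions" "s * peval q s \<in> rational_functions"
    using const_in_rational_functions peval_in_rational_functions[OF s(1)] s(1)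
      rational_functions_closed(4) by auto
  have "s * peval q s = 0 \<or> v (const a) < v (s * peval q s)"
    using peval_nonneg[OF v s, of q] place_mult[OF v s(1) s0, of "peval q s"]
      peval_in_rational_functions[OF s(1)] s(2) place_const[OF v a] by force
  from place_add_strict[OF v is_subfield_rational_functions c(1) _ c(2) this]
  show "peval p s \<noteq> 0" "v (peval p s) = 0"
    unfolding pq peval_pCons using a place_const[OF v a] by auto
qed

section \<open>Uniformisers at zero and infinity\<close>

text \<open>Isolates what t and 1/t have in common. At a place that is positive on \<open>s\<close>,
  polynomials in \<open>s\<close> with nonzero constant term are units, so only the power of
  \<open>s\<close> counts and the place is determined.\<close>

definition parameter :: "'k::field ambient \<Rightarrow> bool" where
  "parameter s \<longleftrightarrow> s \<in> rational_functions \<and> s \<noteq> 0 \<and>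
     (\<forall>x\<in>rational_functions - {0}. \<exists>n p q. coeff p 0 \<noteq> 0 \<and> coeff q 0 \<noteq> 0 \<and>
        x = s powi n * (peval p s / peval q s))"

lemma peval_split:
  assumes "p \<noteq> 0"
  shows "\<exists>n q. coeff q 0 \<noteq> 0 \<and> peval p s = s ^ n * peval q s"
  using assms
proof (induction p)
  case (pCons a p)
  show ?case
  proof (cases "a = 0")
    case True
    then obtain n q where "coeff q 0 \<noteq> 0" "peval p s = s ^ n * peval q s"
      using pCons by auto
    then show ?thesis using True by (intro exI[of _ "Suc n"] exI[of _ q]) simp
  next
    case False
    then show ?thesis by (intro exI[of _ 0] exI[of _ "pCons a p"]) simp
  qed
qed simp

lemma parameter_var: "parameter var_t"
  unfolding parameter_def
proof (intro conjI ballI)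
  fix x :: "'a ambient" assume x: "x \<in> rational_functions - {0}"
  then obtain p q where pq: "q \<noteq> 0" "x = peval p var_t / peval q var_t"
    by (auto elim: rational_functionsE)
  then have "p \<noteq> 0" using x by auto
  then obtain m p' where p': "coeff p' 0 \<noteq> 0" "peval p var_t = var_t ^ m * peval p' var_t"
    using peval_split by blast
  obtain n q' where q': "coeff q' 0 \<noteq> 0" "peval q var_t = var_t ^ n * peval q' var_t"
    using peval_split pq(1) by blast
  have "x = var_t powi (int m - int n) * (peval p' var_t / peval q' var_t)"
    unfolding pq(2) p'(2) q'(2) by (simp add: power_int_diff)
  then show "\<exists>n p q. coeff p 0 \<noteq> 0 \<and> coeff q 0 \<noteq> 0 \<and> x = var_t powi n * (peval p var_t / peval q var_t)"
    using p'(1) q'(1) by blast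
qed (simp_all add: var_t_in)

lemma parameter_inverse_var: "parameter (inverse var_t)"
  unfolding parameter_def
proof (intro conjI ballI)
  let ?s = "inverse var_t :: 'a ambient"
  fix x :: "'a ambient" assume x: "x \<in> rational_functions - {0}"
  then obtain p q where pq: "q \<noteq> 0" "x = peval p var_t / peval q var_t"
    by (auto elim: rational_functionsE)
  then have "p \<noteq> 0" using x by auto
  have r: "peval p var_t = inverse (?s ^ degree p) * peval (reflect_poly p) ?s" for p :: "'a poly"
    by (subst peval_reflect) auto
  have "x = ?s powi (int (degree q) - int (degree p)) * (peval (reflect_poly p) ?s / peval (reflect_poly q) ?s)"
    unfolding pq(2) r[of p] r[of q] by (simp add: power_int_diff field_simps)
  moreover have "coeff (reflect_poly p) 0 \<noteq> 0" "coeff (reflect_poly q) 0 \<noteq> 0"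
    using \<open>p \<noteq> 0\<close> pq(1) by auto
  ultimately show "\<exists>n p q. coeff p 0 \<noteq> 0 \<and> coeff q 0 \<noteq> 0 \<and> x = ?s powi n * (peval p ?s / peval q ?s)"
    by blast
qed (simp_all add: var_t_in rational_functions_closed)

lemma parameter_place:
  assumes s: "parameter s" and v: "rat_place v" and pos: "0 < v s"
    and x: "x = s powi n * (peval p s / peval q s)" "coeff p 0 \<noteq> 0" "coeff q 0 \<noteq> 0"
  shows "v x = n * v s"
proof -
  have s': "s \<in> rational_functions" "s \<noteq> 0" using s by (auto simp: parameter_def)
  note u = peval_unit[OF v s'(1) pos x(2)] peval_unit[OF v s'(1) pos x(3)]
  have "v (peval p s / peval q s) = 0"
    using u peval_in_rational_functions[OF s'(1)] by (subst place_divide[OF v is_subfield_rational_functions]) auto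
  then show ?thesis
    unfolding x(1) using u s' place_power_int[OF v is_subfield_rational_functions s']
      rational_functions_closed(8)[OF peval_in_rational_functions peval_in_rational_functions, OF s'(1) s'(1)]
    by (subst place_mult[OF v]) auto
qed

lemma parameter_value_one:
  assumes s: "parameter s" and v: "rat_place v" and pos: "0 < v s"
  shows "v s = 1"
proof -
  obtain x where x: "x \<in> rational_functions - {0}" "v x = 1" using place_normalised[OF v] by blast
  then obtain n p q where "x = s powi n * (peval p s / peval q s)" "coeff p 0 \<noteq> 0" "coeff q 0 \<noteq> 0"
    using s unfolding parameter_def by blast
  then have "1 = n * v s" using parameter_place[OF s v pos] x(2) by simp
  then show ?thesis using pos by (metis zmult_eq_1_iff zero_less_one_class.zero_less_one not_one_less_zero neg_less_0_iff_less less_asym)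
qed

lemma parameter_place_unique:
  assumes s: "parameter s" and v: "rat_place v" "0 < v s" and w: "rat_place w" "0 < w s"
  shows "v = w"
proof
  fix x show "v x = w x"
  proof (cases "x \<in> rational_functions - {0}")
    case True
    then obtain n p q where *: "x = s powi n * (peval p s / peval q s)" "coeff p 0 \<noteq> 0" "coeff q 0 \<noteq> 0"
      using s unfolding parameter_def by blast
    show ?thesis
      using parameter_place[OF s v *] parameter_place[OF s w *]
        parameter_value_one[OF s v] parameter_value_one[OF s w] by simp
  qed (use place_outside[OF v(1)] place_outside[OF w(1)] in auto)
qed

text \<open>A quotient of polynomials in \<open>s\<close> with nonzero constant terms has the
  quotient of these terms as its residue, so the residue field is K.\<close>

lemma parameter_residue:
  assumes s: "parameter s" and v: "rat_place v" and pos: "0 < v s"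
    and x: "x \<in> rational_functions" "x = 0 \<or> 0 \<le> v x"
  shows "\<exists>c. x - const c = 0 \<or> 0 < v (x - const c)"
proof (cases "x = 0 \<or> 0 < v x")
  case True
  then show ?thesis by (intro exI[of _ 0]) auto
next
  case False
  have s': "s \<in> rational_functions" "s \<noteq> 0" using s by (auto simp: parameter_def)
  obtain n p q where *: "x = s powi n * (peval p s / peval q s)" "coeff p 0 \<noteq> 0" "coeff q 0 \<noteq> 0"
    using s False x unfolding parameter_def by blast
  have "n = 0" using False x(2) parameter_place[OF s v pos *] pos by auto
  note u = peval_unit[OF v s'(1) pos *(3)]
  define c where "c = coeff p 0 / coeff q 0"
  define r where "r = p - smult c q"
  have "coeff r 0 = 0" using *(3) by (simp add: r_def c_def)
  then obtain r' where r': "r = pCons 0 r'" by (metis coeff_pCons_0 pCons_cases)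
  have eq: "x - const c = s * peval r' s / peval q s"
  proof -
    have "x - const c = peval r s / peval q s"
      unfolding *(1) \<open>n = 0\<close> r_def peval_diff peval_smult using u by (simp add: field_simps)
    then show ?thesis unfolding r' by simp
  qed
  show ?thesis
  proof (cases "peval r' s = 0")
    case False
    have in': "peval f s \<in> rational_functions" for f using peval_in_rational_functions[OF s'(1)] .
    have "v (x - const c) = v s + v (peval r' s)"
      unfolding eq using False s' u in' rational_functions_closed(4)[OF s'(1) in']
      by (subst place_divide[OF v is_subfield_rational_functions]) (auto simp: place_mult[OF v])
    then show ?thesis using peval_nonneg[OF v s'(1) pos, of r'] False pos by (intro exI[of _ c]) auto
  qed (use eq in \<open>intro exI[of _ c], auto\<close>)
qed

lemma parameter_degree_one:
  assumes s: "parameter s" and v: "rat_place v" and pos: "0 < v s"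
  shows "place_degree rational_functions v = 1"
proof -
  let ?Q = "\<lambda>d. \<exists>B. finite B \<and> card B = d \<and> B \<subseteq> {x\<in>rational_functions. x = 0 \<or> 0 \<le> v x} \<and>
        (\<forall>c. (let s = (\<Sum>x\<in>B. const (c x) * x) in s = 0 \<or> 0 < v s) \<longrightarrow> (\<forall>x\<in>B. c x = 0))"
  have "?Q 1"
  proof (intro exI[of _ "{1}"] conjI allI impI)
    fix c assume "let s = \<Sum>x\<in>{1}. const (c x) * x in s = 0 \<or> 0 < v s"
    then show "\<forall>x\<in>{1}. c x = 0"
      using place_const[OF v, of "c 1"] by (cases "c 1 = 0") (auto simp: Let_def)
  qed (auto simp: rational_functions_closed place_one[OF v])
  moreover have "d \<le> 1" if d: "?Q d" for d
  proof (rule ccontr)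
    assume "\<not> d \<le> 1"
    then have d2: "2 \<le> d" by simp
    obtain B where B: "finite B" "card B = d" "B \<subseteq> {x\<in>rational_functions. x = 0 \<or> 0 \<le> v x}"
      and ind: "\<And>c. (\<Sum>x\<in>B. const (c x) * x) = 0 \<or> 0 < v (\<Sum>x\<in>B. const (c x) * x) \<Longrightarrow> \<forall>x\<in>B. c x = 0"
      using d unfolding Let_def by blast
    obtain x y where xy: "x \<in> B" "y \<in> B" "x \<noteq> y"
      using d2 B(1,2) by (metis card_le_Suc0_iff_eq not_less_eq_eq numeral_2_eq_2)
    obtain a where a: "x - const a = 0 \<or> 0 < v (x - const a)"
      using parameter_residue[OF s v pos, of x] B(3) xy by auto
    obtain b where b: "y - const b = 0 \<or> 0 < v (y - const b)"
      using parameter_residue[OF s v pos, of y] B(3) xy by auto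
    have in': "x \<in> rational_functions" "y \<in> rational_functions" using B(3) xy by auto
    define small where "small = (\<lambda>z. z \<in> rational_functions \<and> (z = 0 \<or> 0 < v z))"
    have small_mult: "small (const c * z)" if "small z" for c z
      using that place_mult[OF v, of "const c" z] place_const[OF v, of c] const_in_rational_functions[of c]
        rational_functions_closed(2) rational_functions_closed(4)
      unfolding small_def by (cases "c = 0 \<or> z = 0") auto
    have small_add: "small (z + w)" if "small z" "small w" for z w
      using that place_add[OF v, of z w] rational_functions_closed(7) unfolding small_def
      by (cases "z = 0 \<or> w = 0 \<or> z + w = 0") force+
    have sx: "small (x - const a)" and sy: "small (y - const b)"
      using a b in' const_in_rational_functions rational_functions_closed(3) by (auto simp: small_def)
    have sum2: "(\<Sum>z\<in>B. const ((\<lambda>z. if z = x then \<alpha> else if z = y then \<beta> else 0) z) * z) = const \<alpha> * x + const \<beta> * y" for \<alpha> \<beta>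
    proof -
      have "(\<Sum>z\<in>B. const ((\<lambda>z. if z = x then \<alpha> else if z = y then \<beta> else 0) z) * z)
          = (\<Sum>z\<in>{x, y}. const ((\<lambda>z. if z = x then \<alpha> else if z = y then \<beta> else 0) z) * z)"
        using B(1) xy by (intro sum.mono_neutral_right) auto
      then show ?thesis using xy(3) by simp
    qed
    have ind2: "\<alpha> = 0 \<and> \<beta> = 0" if "small (const \<alpha> * x + const \<beta> * y)" for \<alpha> \<beta>
      using ind[of "\<lambda>z. if z = x then \<alpha> else if z = y then \<beta> else 0"] that xy
      unfolding sum2 small_def by (auto split: if_splits)
    \<comment> \<open>The residue is b a - a b = 0, so independence forces a = b = 0; but then
      \<open>x\<close> alone already has residue 0.\<close>
    have "small (const b * (x - const a) + const (- a) * (y - const b))"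
      by (intro small_add small_mult sx sy)
    also have "const b * (x - const a) + const (- a) * (y - const b) = const b * x + const (- a) * y"
      by (simp add: algebra_simps const_uminus)
    finally have "b = 0" "a = 0" using ind2 by fastforce+
    then have "small (const 1 * x + const 0 * y)" using sx by simp
    then show False using ind2 by fastforce
  qed
  ultimately show ?thesis
    unfolding place_degree_def by (intro Greatest_equality) auto
qed

text \<open>A valuation of K[t] extends to fractions by \<open>\<mu> a - \<mu> b\<close>,
  independently of the fraction by multiplicativity. It is applied to the order at 0 and to minus
  the degree, which give the places zero and infinity.\<close>

lemma place_of_poly_valuation:
  fixes \<mu> :: "'k::field poly \<Rightarrow> int"
  assumes mult: "\<And>a b. a \<noteq> 0 \<Longrightarrow> b \<noteq> 0 \<Longrightarrow> \<mu> (a * b) = \<mu> a + \<mu> b"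
    and add: "\<And>a b. a \<noteq> 0 \<Longrightarrow> b \<noteq> 0 \<Longrightarrow> a + b \<noteq> 0 \<Longrightarrow> min (\<mu> a) (\<mu> b) \<le> \<mu> (a + b)"
    and const: "\<And>c. c \<noteq> 0 \<Longrightarrow> \<mu> [:c:] = 0"
    and norm: "a0 \<noteq> 0" "b0 \<noteq> 0" "\<mu> a0 - \<mu> b0 = 1"
  shows "\<exists>v. rat_place v \<and> (\<forall>a b. a \<noteq> 0 \<longrightarrow> b \<noteq> 0 \<longrightarrow> v (to_ac (Fract a b)) = \<mu> a - \<mu> b)"
proof -
  define R where "R = (\<lambda>(x :: 'k ambient) n. \<exists>a b. a \<noteq> 0 \<and> b \<noteq> 0 \<and> x = to_ac (Fract a b) \<and> n = \<mu> a - \<mu> b)"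
  define v where "v = (\<lambda>x :: 'k ambient. if x \<in> rational_functions - {0} then SOME n. R x n else 0)"
  have nz: "to_ac (Fract a b) \<noteq> 0" if "a \<noteq> 0" "b \<noteq> 0" for a b :: "'k poly"
    using that by (simp add: Zero_fract_def eq_fract)
  have uniq: "m = n" if mn: "R x m" "R x n" for x m n
  proof -
    obtain a b c d where *: "a \<noteq> 0" "b \<noteq> 0" "c \<noteq> 0" "d \<noteq> 0"
      "to_ac (Fract a b) = to_ac (Fract c d)" "m = \<mu> a - \<mu> b" "n = \<mu> c - \<mu> d"
      using mn unfolding R_def by blast
    then have "a * d = c * b" by (simp add: eq_fract)
    then have "\<mu> a + \<mu> d = \<mu> c + \<mu> b" using mult * by metis
    then show ?thesis using * by simp
  qed
  have v: "v (to_ac (Fract a b)) = \<mu> a - \<mu> b" if "a \<noteq> 0" "b \<noteq> 0" for a b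
  proof -
    have r: "R (to_ac (Fract a b)) (\<mu> a - \<mu> b)" unfolding R_def using that by blast
    have "(SOME n. R (to_ac (Fract a b)) n) = \<mu> a - \<mu> b"
      by (rule some_equality[of "R (to_ac (Fract a b))", OF r]) (rule uniq[OF _ r])
    then show ?thesis using nz[OF that] unfolding v_def rational_functions_def by auto
  qed
  have rep: "\<exists>a b. a \<noteq> 0 \<and> b \<noteq> 0 \<and> x = to_ac (Fract a b)" if x: "x \<in> rational_functions - {0}" for x :: "'k ambient"
  proof -
    obtain f where f: "x = to_ac f" using x by (auto simp: rational_functions_def)
    obtain a b where ab: "f = Fract a b" "b \<noteq> 0" by (cases f)
    then have "a \<noteq> 0" using x f by (auto simp: fract_collapse)
    then show ?thesis using f ab by blast
  qed
  have "rat_place v"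
    unfolding place_def
  proof (intro conjI allI impI ballI)
    fix x y :: "'k ambient" assume x: "x \<in> rational_functions - {0}" and y: "y \<in> rational_functions - {0}"
    obtain a b where ab: "a \<noteq> 0" "b \<noteq> 0" "x = to_ac (Fract a b)" using rep[OF x] by blast
    obtain c d where cd: "c \<noteq> 0" "d \<noteq> 0" "y = to_ac (Fract c d)" using rep[OF y] by blast
    have "x * y = to_ac (Fract (a * c) (b * d))" using ab cd by (simp flip: to_ac_mult)
    then show "v (x * y) = v x + v y"
      using ab cd v[of "a * c" "b * d"] v[of a b] v[of c d] mult by simp
    assume xy: "x + y \<noteq> 0"
    have s: "x + y = to_ac (Fract (a * d + c * b) (b * d))" using ab cd by (simp flip: to_ac_add)
    then have "a * d + c * b \<noteq> 0" using xy by (auto simp: fract_collapse)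
    then show "min (v x) (v y) \<le> v (x + y)"
      using ab cd v[of a b] v[of c d] v[of "a * d + c * b" "b * d"] mult s add[of "a * d" "c * b"] by auto
  next
    fix c :: 'k assume "c \<noteq> 0"
    then show "v (const c) = 0" using v[of "[:c:]" 1] const[of c] const[of 1] by (simp add: const_def one_pCons)
  next
    show "\<exists>x\<in>rational_functions - {0}. v x = 1"
      using v[OF norm(1,2)] norm(3) nz[OF norm(1,2)]
      by (intro bexI[of _ "to_ac (Fract a0 b0)"]) (auto simp: rational_functions_def)
  qed (auto simp: v_def)
  then show ?thesis using v by blast
qed

lemma place_zero_exists: "\<exists>v :: 'k::field ambient \<Rightarrow> int. rat_place v \<and> v var_t = 1"
proof -
  have "\<exists>v. rat_place v \<and> (\<forall>a b. a \<noteq> 0 \<longrightarrow> b \<noteq> 0 \<longrightarrow>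
      v (to_ac (Fract a b)) = int (order 0 a) - int (order 0 (b :: 'k poly)))"
  proof (rule place_of_poly_valuation)
    fix a b :: "'k poly" assume ab: "a \<noteq> 0" "b \<noteq> 0"
    show "int (order 0 (a * b)) = int (order 0 a) + int (order 0 b)" using ab by (simp add: order_mult)
    assume nz: "a + b \<noteq> 0"
    have "[:-0, 1:] ^ min (order 0 a) (order 0 b) dvd a + b"
      using ab by (intro dvd_add) (auto simp only: order_divides)
    then show "min (int (order 0 a)) (int (order 0 b)) \<le> int (order 0 (a + b))"
      using nz unfolding order_divides by auto
  next
    show "int (order 0 [:c:]) = 0" if "c \<noteq> 0" for c :: 'k using that by (simp add: order_0I)
    show "int (order 0 (monom 1 1 :: 'k poly)) - int (order 0 (1 :: 'k poly)) = 1"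
      by (subst order_0_monom) auto
  qed auto
  then obtain v :: "'k ambient \<Rightarrow> int" where v: "rat_place v" "\<forall>a b. a \<noteq> 0 \<longrightarrow> b \<noteq> 0 \<longrightarrow>
      v (to_ac (Fract a b)) = int (order 0 a) - int (order 0 b)" by blast
  have "v var_t = int (order 0 (monom 1 1 :: 'k poly)) - int (order 0 (1 :: 'k poly))"
    unfolding var_t_def using v(2) by (simp add: monom_altdef)
  also have "\<dots> = 1" by (subst order_0_monom) auto
  finally show ?thesis using v(1) by blast
qed

lemma place_infinity_exists: "\<exists>v :: 'k::field ambient \<Rightarrow> int. rat_place v \<and> v (inverse var_t) = 1"
proof -
  have "\<exists>v. rat_place v \<and> (\<forall>a b. a \<noteq> 0 \<longrightarrow> b \<noteq> 0 \<longrightarrow>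
      v (to_ac (Fract a b)) = - int (degree a) - - int (degree (b :: 'k poly)))"
  proof (rule place_of_poly_valuation)
    fix a b :: "'k poly" assume ab: "a \<noteq> 0" "b \<noteq> 0"
    show "- int (degree (a * b)) = - int (degree a) + - int (degree b)" using ab by (simp add: degree_mult_eq)
    show "min (- int (degree a)) (- int (degree b)) \<le> - int (degree (a + b))"
      using degree_add_le_max[of a b] by auto
  next
    show "- int (degree (1 :: 'k poly)) - - int (degree (monom 1 1 :: 'k poly)) = 1"
      by (simp add: degree_monom_eq)
  qed auto
  then obtain v :: "'k ambient \<Rightarrow> int" where v: "rat_place v" "\<forall>a b. a \<noteq> 0 \<longrightarrow> b \<noteq> 0 \<longrightarrow>
      v (to_ac (Fract a b)) = - int (degree a) - - int (degree b)" by blast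
  have "v var_t = -1" unfolding var_t_def using v(2) by simp
  then show ?thesis using v(1) place_inverse[OF v(1) is_subfield_rational_functions var_t_in] by auto
qed

section \<open>Divisor classes\<close>

context projective_fan begin

lemma lookup_tdivisor: "Poly_Mapping.lookup (tdivisor F a) \<rho> = (if \<rho> \<in> rays F then a \<rho> else 0)"
  unfolding tdivisor_def lookup_sum lookup_single by (simp add: when_def)

lemma tdivisor_cong: "(\<And>\<rho>. \<rho> \<in> rays F \<Longrightarrow> a \<rho> = b \<rho>) \<Longrightarrow> tdivisor F a = tdivisor F b"
  by (auto simp: tdivisor_def)

lemma tdivisor_eq_iff: "tdivisor F a = tdivisor F b \<longleftrightarrow> (\<forall>\<rho>\<in>rays F. a \<rho> = b \<rho>)"
  by (metis lookup_tdivisor tdivisor_cong)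

lemma keys_tdivisor: "Poly_Mapping.keys (tdivisor F a) \<subseteq> rays F"
  using lookup_tdivisor in_keys_iff by (metis subsetI)

lemma tdivisor_lookup: "Poly_Mapping.keys D \<subseteq> rays F \<Longrightarrow> tdivisor F (Poly_Mapping.lookup D) = D"
  by (rule poly_mapping_eqI) (auto simp: lookup_tdivisor in_keys_iff)

lemma tdivisor_add: "tdivisor F (\<lambda>\<rho>. a \<rho> + b \<rho>) = tdivisor F a + tdivisor F b"
  by (rule poly_mapping_eqI) (auto simp: lookup_tdivisor lookup_add)

lemma tdivisor_uminus: "tdivisor F (\<lambda>\<rho>. - a \<rho>) = - tdivisor F a"
  by (rule poly_mapping_eqI) (auto simp: lookup_tdivisor)

lemma pairing_add: "pairing F (\<lambda>i. m i + m' i) \<rho> = pairing F m \<rho> + pairing F m' \<rho>"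
  and pairing_uminus: "pairing F (\<lambda>i. - m i) \<rho> = - pairing F m \<rho>"
  by (auto simp: pairing_def algebra_simps sum.distrib sum_negf)

lemma principal_subgroup: "subgroup (principal F) (free_Abelian_group (rays F))"
proof (rule group.subgroupI[OF group_free_Abelian_group])
  show "principal F \<subseteq> carrier (free_Abelian_group (rays F))"
    using keys_tdivisor by (auto simp: principal_def)
  show "principal F \<noteq> {}" by (auto simp: principal_def)
  fix D assume "D \<in> principal F"
  then obtain m where D: "D = tdivisor F (pairing F m)" by (auto simp: principal_def)
  have "- D = tdivisor F (pairing F (\<lambda>i. - m i))"
    unfolding D tdivisor_uminus[symmetric] pairing_uminus ..
  then show "inv\<^bsub>free_Abelian_group (rays F)\<^esub> D \<in> principal F"
    using keys_tdivisor D by (auto simp: principal_def)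
  fix E assume "E \<in> principal F"
  then obtain m' where E: "E = tdivisor F (pairing F m')" by (auto simp: principal_def)
  have "D + E = tdivisor F (pairing F (\<lambda>i. m i + m' i))"
    unfolding D E tdivisor_add[symmetric] pairing_add ..
  then show "D \<otimes>\<^bsub>free_Abelian_group (rays F)\<^esub> E \<in> principal F"
    by (auto simp: principal_def)
qed

sublocale Pic: comm_group "Pic F"
  unfolding Pic_def
  by (rule comm_group.abelian_FactGroup[OF abelian_free_Abelian_group principal_subgroup])

definition cls :: "('r \<Rightarrow> int) \<Rightarrow> ('r \<Rightarrow>\<^sub>0 int) set" where
  "cls a = divisor_class F (tdivisor F a)"

lemma cls_eq: "cls a = range (\<lambda>m. tdivisor F (\<lambda>\<rho>. a \<rho> + pairing F m \<rho>))"
  unfolding cls_def divisor_class_def r_coset_def principal_def tdivisor_add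
  by (simp add: add.commute[of "tdivisor F a"] image_def Setcompr_eq_image) blast

lemma carrier_Pic: "carrier (Pic F) = range cls"
proof -
  have "carrier (free_Abelian_group (rays F)) = range (tdivisor F)"
  proof (intro equalityI subsetI)
    fix D assume "D \<in> carrier (free_Abelian_group (rays F))"
    then show "D \<in> range (tdivisor F)" using tdivisor_lookup[of D] by (metis carrier_free_Abelian_group_iff rangeI)
  qed (use keys_tdivisor in auto)
  then show ?thesis
    unfolding Pic_def carrier_FactGroup cls_def divisor_class_def by auto
qed

lemma cls_closed [simp]: "cls a \<in> carrier (Pic F)"
  by (simp add: carrier_Pic)

lemma cls_add: "cls a \<otimes>\<^bsub>Pic F\<^esub> cls b = cls (\<lambda>\<rho>. a \<rho> + b \<rho>)"
proof -
  interpret normal "principal F" "free_Abelian_group (rays F)"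
    by (rule comm_group.subgroup_imp_normal[OF abelian_free_Abelian_group principal_subgroup])
  show ?thesis
    unfolding cls_def divisor_class_def Pic_def mult_FactGroup tdivisor_add
    using rcos_sum keys_tdivisor by simp
qed

lemma cls_cong: "(\<And>\<rho>. \<rho> \<in> rays F \<Longrightarrow> a \<rho> = b \<rho>) \<Longrightarrow> cls a = cls b"
  unfolding cls_def using tdivisor_cong by metis

lemma one_Pic: "\<one>\<^bsub>Pic F\<^esub> = cls (\<lambda>\<rho>. 0)"
  unfolding Pic_def one_FactGroup cls_eq principal_def by simp

lemma cls_inv: "inv\<^bsub>Pic F\<^esub> cls a = cls (\<lambda>\<rho>. - a \<rho>)"
  by (rule Pic.inv_equality) (simp_all add: cls_add one_Pic)

lemma cls_eq_iff: "cls a = cls b \<longleftrightarrow> (\<exists>m. \<forall>\<rho>\<in>rays F. b \<rho> = a \<rho> + pairing F m \<rho>)"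
proof
  assume "cls a = cls b"
  have "tdivisor F b = tdivisor F (\<lambda>\<rho>. b \<rho> + pairing F (\<lambda>i. 0) \<rho>)"
    by (simp add: pairing_def)
  then have "tdivisor F b \<in> cls a"
    unfolding \<open>cls a = cls b\<close> by (auto simp: cls_eq)
  then show "\<exists>m. \<forall>\<rho>\<in>rays F. b \<rho> = a \<rho> + pairing F m \<rho>"
    by (auto simp: cls_eq tdivisor_eq_iff)
next
  assume "\<exists>m. \<forall>\<rho>\<in>rays F. b \<rho> = a \<rho> + pairing F m \<rho>"
  then obtain m where m: "\<forall>\<rho>\<in>rays F. b \<rho> = a \<rho> + pairing F m \<rho>" ..
  have "cls (pairing F m) = \<one>\<^bsub>Pic F\<^esub>"
    unfolding one_Pic cls_eq
  proof (intro equalityI subsetI)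
    fix D assume "D \<in> range (\<lambda>m'. tdivisor F (\<lambda>\<rho>. pairing F m \<rho> + pairing F m' \<rho>))"
    then obtain m' where "D = tdivisor F (\<lambda>\<rho>. pairing F m \<rho> + pairing F m' \<rho>)" by auto
    then have "D = tdivisor F (\<lambda>\<rho>. 0 + pairing F (\<lambda>i. m i + m' i) \<rho>)"
      by (simp add: pairing_add)
    then show "D \<in> range (\<lambda>m. tdivisor F (\<lambda>\<rho>. 0 + pairing F m \<rho>))" by blast
  next
    fix D assume "D \<in> range (\<lambda>m. tdivisor F (\<lambda>\<rho>. 0 + pairing F m \<rho>))"
    then obtain m' where "D = tdivisor F (\<lambda>\<rho>. 0 + pairing F m' \<rho>)" by auto
    then have "D = tdivisor F (\<lambda>\<rho>. pairing F m \<rho> + pairing F (\<lambda>i. - m i + m' i) \<rho>)"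
      unfolding pairing_add pairing_uminus by simp
    then show "D \<in> range (\<lambda>m'. tdivisor F (\<lambda>\<rho>. pairing F m \<rho> + pairing F m' \<rho>))" by blast
  qed
  moreover have "cls b = cls a \<otimes>\<^bsub>Pic F\<^esub> cls (pairing F m)"
    unfolding cls_add using m by (intro cls_cong) auto
  ultimately show "cls a = cls b" by simp
qed

lemma cls_pairing: "cls (\<lambda>\<rho>. a \<rho> + pairing F m \<rho>) = cls a"
  using cls_eq_iff by metis

lemma mem_cls: "D \<in> cls a \<Longrightarrow> \<exists>b. D = tdivisor F b \<and> cls b = cls a"
  using cls_eq[of a] cls_pairing[of a] by blast

lemma tdivisor_in_cls: "tdivisor F a \<in> cls a"
proof -
  have "tdivisor F a = tdivisor F (\<lambda>\<rho>. a \<rho> + pairing F (\<lambda>i. 0) \<rho>)"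
    by (simp add: pairing_def)
  then show ?thesis by (auto simp: cls_eq)
qed

lemma cls_pow: "cls a [^]\<^bsub>Pic F\<^esub> (n::nat) = cls (\<lambda>\<rho>. int n * a \<rho>)"
proof (induction n)
  case 0
  then show ?case by (simp add: one_Pic)
next
  case (Suc n)
  then show ?case by (simp add: cls_add algebra_simps)
qed

lemma deg_cls: "cls a = cls b \<Longrightarrow> deg P a = deg P b"
proof -
  assume "cls a = cls b"
  then obtain m where "\<forall>\<rho>\<in>rays F. b \<rho> = a \<rho> + pairing F m \<rho>" using cls_eq_iff by blast
  then have "deg P b = deg P (\<lambda>\<rho>. a \<rho> + pairing F m \<rho>)"
    unfolding deg_def by (intro ev_cong) auto
  then show "deg P a = deg P b" by (simp add: deg_add_pairing)
qed

text \<open>The arbitrary representative is harmless, since characters have degree 0 on every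
  relation.\<close>

definition class_deg :: "'r set \<Rightarrow> ('r \<Rightarrow>\<^sub>0 int) set \<Rightarrow> int" where
  "class_deg P b = deg P (SOME a. cls a = b)"

lemma class_deg [simp]: "class_deg P (cls a) = deg P a"
  unfolding class_deg_def by (rule deg_cls) (rule someI[of _ a], rule refl)

lemma class_deg_mult:
  assumes "x \<in> carrier (Pic F)" "y \<in> carrier (Pic F)"
  shows "class_deg P (x \<otimes>\<^bsub>Pic F\<^esub> y) = class_deg P x + class_deg P y"
  using assms by (auto simp: carrier_Pic cls_add deg_add)

lemma class_deg_one: "class_deg P \<one>\<^bsub>Pic F\<^esub> = 0"
  by (simp add: one_Pic deg_def ev_def)

lemma class_deg_inv: "x \<in> carrier (Pic F) \<Longrightarrow> class_deg P (inv\<^bsub>Pic F\<^esub> x) = - class_deg P x"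
  using deg_mult[of P "-1"] by (auto simp: carrier_Pic cls_inv)

lemma class_deg_zero_imp_one:
  assumes "x \<in> carrier (Pic F)" "\<And>P. primitive_collection P \<Longrightarrow> class_deg P x = 0"
  shows "x = \<one>\<^bsub>Pic F\<^esub>"
proof -
  obtain a where a: "x = cls a" using assms(1) by (auto simp: carrier_Pic)
  obtain m where m: "\<forall>\<rho>\<in>rays F. a \<rho> = pairing F m \<rho>"
    using deg_zero_imp_pairing[of a] assms(2) a by auto
  then have "cls (\<lambda>\<rho>. 0) = cls a" unfolding cls_eq_iff by auto
  then show ?thesis using a one_Pic by simp
qed

text \<open>A description by the fan alone; it will be identified with the nef classes over every
  field.\<close>

definition convex_classes :: "('r \<Rightarrow>\<^sub>0 int) set set" where
  "convex_classes = {x \<in> carrier (Pic F). \<forall>P. primitive_collection P \<longrightarrow> 0 \<le> class_deg P x}"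

lemma cls_convex [simp]: "cls a \<in> convex_classes \<longleftrightarrow> convex a"
  by (simp add: convex_classes_def convex_def)

end

section \<open>Nef classes\<close>

context projective_fan begin

lemma vec_zeroD: "vec g = (\<lambda>i. 0) \<Longrightarrow> i < rk F \<Longrightarrow> (\<Sum>\<rho>\<in>rays F. g \<rho> * gen F \<rho> i) = 0"
  unfolding vec_def by (metis (full_types))

text \<open>This is the valuative criterion of properness at \<open>v\<close>. A vanishing
  coordinate has no valuation to respect, so its entry may be raised at will. Far enough in that
  direction the normal form is supported on a cone containing all vanishing coordinates, and the
  change made to reach it is the rescaling \<open>g\<close>.\<close>

lemma multiplicity_exists:
  assumes "{\<rho>\<in>rays F. x \<rho> = 0} \<in> cones F"
  shows "\<exists>ord_v. is_multiplicity F x v ord_v"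
proof -
  let ?\<tau> = "{\<rho>\<in>rays F. x \<rho> = 0}"
  define d where "d = (\<lambda>\<rho>. if x \<rho> \<noteq> 0 then v (x \<rho>) else 0)"
  obtain N c where c: "cone_vector c" "vec c = vec (\<lambda>\<rho>. d \<rho> + int N * ind ?\<tau> \<rho>)" "?\<tau> \<subseteq> {\<rho>. c \<rho> \<noteq> 0}"
    by (rule star_normal_form[OF assms])
  define g where "g = (\<lambda>\<rho>. c \<rho> - (d \<rho> + int N * ind ?\<tau> \<rho>))"
  have "vec g = (\<lambda>i. 0)" unfolding g_def by (simp only: vec_diff c(2)) simp
  then have "\<forall>i<rk F. (\<Sum>\<rho>\<in>rays F. g \<rho> * gen F \<rho> i) = 0" using vec_zeroD by blast
  moreover have "\<forall>\<rho>\<in>rays F. x \<rho> \<noteq> 0 \<longrightarrow> c \<rho> = v (x \<rho>) + g \<rho> \<and> 0 \<le> c \<rho>"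
    using cone_vector_nonneg[OF c(1)] by (auto simp: g_def d_def ind_def)
  moreover have "{\<rho>\<in>rays F. x \<rho> = 0 \<or> 0 < c \<rho>} \<in> cones F"
    by (rule face_cone[OF cone_vector_supp[OF c(1)]]) (use c(3) in auto)
  ultimately show ?thesis unfolding is_multiplicity_def by blast
qed

text \<open>Two solutions differ by a linear relation. On the vanishing coordinates, where nothing
  is prescribed, they can be completed to two vectors supported on cones with the same lattice
  point, which must coincide.\<close>

lemma multiplicity_unique:
  assumes "is_multiplicity F x v e" "is_multiplicity F x v e'" "\<rho> \<in> rays F" "x \<rho> \<noteq> 0"
  shows "e \<rho> = e' \<rho>"
proof -
  obtain g where g: "\<And>i. i < rk F \<Longrightarrow> (\<Sum>\<rho>\<in>rays F. g \<rho> * gen F \<rho> i) = 0"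
    "\<And>\<rho>. \<rho> \<in> rays F \<Longrightarrow> x \<rho> \<noteq> 0 \<Longrightarrow> e \<rho> = v (x \<rho>) + g \<rho> \<and> 0 \<le> e \<rho>"
    "{\<rho>\<in>rays F. x \<rho> = 0 \<or> 0 < e \<rho>} \<in> cones F"
    using assms(1) unfolding is_multiplicity_def by blast
  obtain g' where g': "\<And>i. i < rk F \<Longrightarrow> (\<Sum>\<rho>\<in>rays F. g' \<rho> * gen F \<rho> i) = 0"
    "\<And>\<rho>. \<rho> \<in> rays F \<Longrightarrow> x \<rho> \<noteq> 0 \<Longrightarrow> e' \<rho> = v (x \<rho>) + g' \<rho> \<and> 0 \<le> e' \<rho>"
    "{\<rho>\<in>rays F. x \<rho> = 0 \<or> 0 < e' \<rho>} \<in> cones F"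
    using assms(2) unfolding is_multiplicity_def by blast
  \<comment> \<open>Large enough to keep the completed entries on the vanishing coordinates
    nonnegative.\<close>
  define N where "N = (\<Sum>\<rho>\<in>rays F. \<bar>g \<rho> - g' \<rho>\<bar>)"
  have N: "\<bar>g \<rho> - g' \<rho>\<bar> \<le> N" if "\<rho> \<in> rays F" for \<rho>
    using member_le_sum[of \<rho> "rays F" "\<lambda>\<rho>. \<bar>g \<rho> - g' \<rho>\<bar>"] that by (simp add: N_def)
  define c where "c = (\<lambda>\<rho>. if \<rho> \<in> rays F then if x \<rho> = 0 then N + g \<rho> - g' \<rho> else e \<rho> else 0)"
  define c' where "c' = (\<lambda>\<rho>. if \<rho> \<in> rays F then if x \<rho> = 0 then N else e' \<rho> else 0)"
  have "cone_vector c"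
  proof (rule cone_vectorI[OF _ _ g(3)])
    show "0 \<le> c \<rho>" for \<rho> using N[of \<rho>] g(2)[of \<rho>] by (auto simp: c_def)
    show "{\<rho>. c \<rho> \<noteq> 0} \<subseteq> {\<rho>\<in>rays F. x \<rho> = 0 \<or> 0 < e \<rho>}"
      using g(2) by (force simp: c_def split: if_splits)
  qed
  moreover have "cone_vector c'"
  proof (rule cone_vectorI[OF _ _ g'(3)])
    show "0 \<le> c' \<rho>" for \<rho> using N[of \<rho>] g'(2)[of \<rho>] by (auto simp: c'_def)
    show "{\<rho>. c' \<rho> \<noteq> 0} \<subseteq> {\<rho>\<in>rays F. x \<rho> = 0 \<or> 0 < e' \<rho>}"
      using g'(2) by (force simp: c'_def split: if_splits)
  qed
  moreover have "vec c = vec c'"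
  proof -
    have "vec (\<lambda>\<rho>. c \<rho> - c' \<rho>) = vec (\<lambda>\<rho>. g \<rho> - g' \<rho>)"
      by (rule vec_cong) (use g(2) g'(2) in \<open>auto simp: c_def c'_def\<close>)
    moreover have "vec g = (\<lambda>i. 0)" "vec g' = (\<lambda>i. 0)"
      using g(1) g'(1) by (auto simp: vec_def fun_eq_iff)
    ultimately show ?thesis by (simp add: vec_diff fun_eq_iff)
  qed
  ultimately have "c = c'" by (rule cone_vector_unique)
  then have "c \<rho> = c' \<rho>" by simp
  then show ?thesis using assms(3,4) by (simp add: c_def c'_def)
qed

text \<open>The choice made in \<open>pullback_mult\<close> matters only where \<open>x\<close>
  vanishes, and there the divisor has coefficient 0.\<close>

lemma pullback_mult_eq:
  assumes "is_multiplicity F x v e" "\<And>\<rho>. \<rho> \<in> rays F \<Longrightarrow> x \<rho> = 0 \<Longrightarrow> b \<rho> = 0"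
  shows "pullback_mult F x (tdivisor F b) v = ev b e"
proof -
  have "is_multiplicity F x v (SOME e. is_multiplicity F x v e)"
    by (rule someI[of "is_multiplicity F x v", OF assms(1)])
  then have "b \<rho> * (SOME e. is_multiplicity F x v e) \<rho> = b \<rho> * e \<rho>" if "\<rho> \<in> rays F" for \<rho>
    using multiplicity_unique[OF _ assms(1) that] assms(2)[OF that] by (cases "x \<rho> = 0") auto
  then show ?thesis unfolding pullback_mult_def ev_def by (intro sum.cong) (auto simp: lookup_tdivisor)
qed

text \<open>An effective divisor without a component containing the curve pulls back to an effective
  divisor; the cone to be avoided is that of the coordinates vanishing on the curve.\<close>

lemma convex_imp_nef:
  assumes "convex a"
  shows "cls a \<in> Nef TYPE('k::field) F"
  unfolding Nef_def
proof (intro CollectI conjI allI impI)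
  fix L :: "'k ambient set" and x assume "curve_in F L x"
  then have \<tau>: "{\<rho>\<in>rays F. x \<rho> = 0} \<in> cones F" by (simp add: curve_in_def)
  obtain m where m: "\<forall>\<rho>\<in>{\<rho>\<in>rays F. x \<rho> = 0}. a \<rho> + pairing F m \<rho> = 0"
    "\<forall>\<rho>\<in>rays F. 0 \<le> a \<rho> + pairing F m \<rho>"
    using effective_representative[OF assms \<tau>] by blast
  define b where "b = (\<lambda>\<rho>. a \<rho> + pairing F m \<rho>)"
  have b0: "b \<rho> = 0" if "\<rho> \<in> rays F" "x \<rho> = 0" for \<rho> using m that by (simp add: b_def)
  have nn: "0 \<le> pullback_mult F x (tdivisor F b) v" for v
  proof -
    obtain e where e: "is_multiplicity F x v e" using multiplicity_exists[OF \<tau>] by blast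
    have "0 \<le> b \<rho> * e \<rho>" if "\<rho> \<in> rays F" for \<rho>
    proof (cases "x \<rho> = 0")
      case False
      then have "0 \<le> e \<rho>" using e that unfolding is_multiplicity_def by blast
      moreover have "0 \<le> b \<rho>" using m(2) that by (simp add: b_def)
      ultimately show ?thesis by simp
    qed (use b0[OF that] in simp)
    moreover have "pullback_mult F x (tdivisor F b) v = ev b e"
      by (rule pullback_mult_eq[OF e b0])
    ultimately show ?thesis unfolding ev_def by (simp add: sum_nonneg)
  qed
  have "tdivisor F b \<in> cls a"
    using tdivisor_in_cls[of b] cls_pairing[of a m] by (simp add: b_def)
  then have "intersection_number F L x (cls a) (pullback_degree F L x (tdivisor F b))"
    unfolding intersection_number_def using b0 by (intro bexI[of _ "tdivisor F b"]) (auto simp: lookup_tdivisor)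
  moreover have "0 \<le> pullback_degree F L x (tdivisor F b)"
    unfolding pullback_degree_def using nn by (intro sum_nonneg) simp
  ultimately show "\<exists>z\<ge>0. intersection_number F L x (cls a) z" by blast
qed simp

text \<open>The curve \<open>(0, \<dots>, 0, t, 1, \<dots>, 1)\<close> with zeros along the cone of an extremal primitive
  relation: it meets the other boundary divisors only at \<open>0\<close> and \<open>\<infinity>\<close>, and its class is the relation.\<close>

lemma extremal_nef:
  assumes P: "extremal_by h P" and nef: "cls a \<in> Nef TYPE('k::field) F"
  shows "0 \<le> deg P a"
proof -
  let ?\<sigma> = "{\<rho>. nf (ind P) \<rho> \<noteq> 0}"
  have prim: "primitive_collection P" using P by (simp add: extremal_by_def)
  obtain \<rho>0 where \<rho>0: "\<rho>0 \<in> P" using primitive_nonempty[OF prim] by blast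
  obtain \<rho>1 where \<rho>1: "\<rho>1 \<in> P" "\<rho>1 \<noteq> \<rho>0" by (rule primitive_other[OF prim \<rho>0])
  have disj: "\<rho> \<notin> ?\<sigma>" if "\<rho> \<in> P" for \<rho> using primitive_disjoint[OF prim that] by simp
  have \<sigma>r: "?\<sigma> \<subseteq> rays F" by (rule cone_subset_rays[OF nf_supp])
  define x :: "'r \<Rightarrow> 'k ambient" where
    "x = (\<lambda>\<rho>. if \<rho> \<in> ?\<sigma> then 0 else if \<rho> = \<rho>0 then var_t else 1)"
  have x0: "x \<rho> = 0 \<longleftrightarrow> \<rho> \<in> ?\<sigma>" for \<rho> by (auto simp: x_def)
  have zeros: "{\<rho>\<in>rays F. x \<rho> = 0} = ?\<sigma>" using \<sigma>r by (auto simp: x0)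
  have "curve_in F rational_functions x"
    unfolding curve_in_def zeros
    using function_field_rational_functions nf_supp var_t_in rational_functions_closed(1,2)
    by (auto simp: x_def)
  then obtain z where z: "0 \<le> z" "intersection_number F rational_functions x (cls a) z"
    using nef unfolding Nef_def by blast
  then obtain D where D: "D \<in> cls a" "\<And>\<rho>. \<rho> \<in> rays F \<Longrightarrow> x \<rho> = 0 \<Longrightarrow> Poly_Mapping.lookup D \<rho> = 0"
    "z = pullback_degree F rational_functions x D"
    unfolding intersection_number_def by blast
  obtain b where b: "D = tdivisor F b" "cls b = cls a" using mem_cls[OF D(1)] by blast
  have b0: "b \<rho> = 0" if "\<rho> \<in> rays F" "x \<rho> = 0" for \<rho>
    using D(2)[OF that] that(1) by (simp add: b(1) lookup_tdivisor)
  let ?m = "pullback_mult F x D"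
  \<comment> \<open>At zero no rescaling is required. Besides the cone of the relation only \<rho>0
    vanishes, and \<rho>0 survives when \<rho>1 is dropped from \<open>P\<close>, so the vanishing
    coordinates form a cone.\<close>
  have mult0: "?m v = ev b (ind {\<rho>0})" if "rat_place v" "v var_t = 1" for v
    unfolding b(1)
  proof (rule pullback_mult_eq[OF _ b0])
    have "{\<rho>\<in>rays F. x \<rho> = 0 \<or> 0 < ind {\<rho>0} \<rho>} \<in> cones F"
      by (rule face_cone[OF extremal_contractible[OF P \<rho>1(1)]])
        (use \<rho>0 \<rho>1 in \<open>auto simp: x0 ind_def of_bool_def split: if_splits\<close>)
    then show "is_multiplicity F x v (ind {\<rho>0})"
      unfolding is_multiplicity_def using that place_one[OF that(1)] place_zero[OF that(1)]
      by (intro conjI exI[of _ "\<lambda>_. 0"]) (auto simp: x_def ind_def)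
  qed
  \<comment> \<open>At infinity t has a pole. Rescaling by the relation itself gives order -1 + 1 =
    0 at \<rho>0 and order 1 at the other rays of \<open>P\<close>.\<close>
  have mult_inf: "?m v = ev b (ind (P - {\<rho>0}))" if "rat_place v" "v var_t = -1" for v
    unfolding b(1)
  proof (rule pullback_mult_eq[OF _ b0])
    have "{\<rho>\<in>rays F. x \<rho> = 0 \<or> 0 < ind (P - {\<rho>0}) \<rho>} \<in> cones F"
      by (rule face_cone[OF extremal_contractible[OF P \<rho>0]])
        (auto simp: x0 ind_def of_bool_def split: if_splits)
    moreover have "\<forall>i<rk F. (\<Sum>\<rho>\<in>rays F. relation P \<rho> * gen F \<rho> i) = 0"
      using vec_zeroD[OF vec_relation] by blast
    moreover have "x \<rho> \<noteq> 0 \<longrightarrow> ind (P - {\<rho>0}) \<rho> = v (x \<rho>) + relation P \<rho> \<and> 0 \<le> ind (P - {\<rho>0}) \<rho>" for \<rho>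
      using that place_one[OF that(1)] \<rho>0 unfolding x0
      by (auto simp: x_def ind_def relation_def)
    ultimately show "is_multiplicity F x v (ind (P - {\<rho>0}))"
      unfolding is_multiplicity_def by blast
  qed
  \<comment> \<open>Elsewhere every coordinate is 0 or a unit.\<close>
  have mult_else: "?m v = 0" if "rat_place v" "v var_t = 0" for v
  proof -
    have "is_multiplicity F x v (\<lambda>_. 0)"
      unfolding is_multiplicity_def using that place_one[OF that(1)] nf_supp[of "ind P"] zeros
      by (intro conjI exI[of _ "\<lambda>_. 0"]) (auto simp: x_def)
    from pullback_mult_eq[OF this b0] show ?thesis by (simp add: b(1) ev_def)
  qed
  obtain v0 :: "'k ambient \<Rightarrow> int" where v0: "rat_place v0" "v0 var_t = 1" using place_zero_exists by blast
  obtain vi :: "'k ambient \<Rightarrow> int" where vi: "rat_place vi" "vi (inverse var_t) = 1" using place_infinity_exists by blast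
  have vi': "vi var_t = -1" using vi place_inverse[OF vi(1) is_subfield_rational_functions var_t_in] by simp
  have sub: "{v. rat_place v \<and> ?m v \<noteq> 0} \<subseteq> {v0, vi}"
  proof
    fix v assume "v \<in> {v. rat_place v \<and> ?m v \<noteq> 0}"
    then have v: "rat_place v" "?m v \<noteq> 0" by auto
    then consider "0 < v var_t" | "0 < v (inverse var_t)"
      using mult_else[OF v(1)] place_inverse[OF v(1) is_subfield_rational_functions var_t_in] by linarith
    then show "v \<in> {v0, vi}"
    proof cases
      case 1
      then show ?thesis using parameter_place_unique[OF parameter_var v(1) _ v0(1)] v0(2) by simp
    next
      case 2
      then show ?thesis using parameter_place_unique[OF parameter_inverse_var v(1) _ vi(1)] vi(2) by simp
    qed
  qed
  have ne: "v0 \<noteq> vi" using v0(2) vi' by auto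
  have deg1: "place_degree rational_functions v0 = 1" "place_degree rational_functions vi = 1"
    using parameter_degree_one[OF parameter_var v0(1)] parameter_degree_one[OF parameter_inverse_var vi(1)]
      v0(2) vi(2) by auto
  have "z = (\<Sum>v\<in>{v0, vi}. int (place_degree rational_functions v) * ?m v)"
    unfolding D(3) pullback_degree_def
    by (rule sum.mono_neutral_left) (use sub v0(1) vi(1) in auto)
  also have "\<dots> = ev b (ind {\<rho>0}) + ev b (ind (P - {\<rho>0}))"
    using ne deg1 mult0[OF v0] mult_inf[OF vi(1) vi'] by simp
  also have "\<dots> = ev b (\<lambda>\<rho>. ind {\<rho>0} \<rho> + ind (P - {\<rho>0}) \<rho>)"
    by (simp add: ev_simps)
  also have "\<dots> = ev (ind P) b"
    unfolding ev_def using \<rho>0 by (intro sum.cong) (auto simp: ind_def)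
  \<comment> \<open>\<open>b\<close> vanishes on the support of the normal form, so the negative
    part of the relation contributes nothing.\<close>
  also have "\<dots> = deg P b"
    unfolding deg_alt using ev_zero[of "nf (ind P)" b] b0 x0 by simp
  also have "\<dots> = deg P a" using deg_cls[OF b(2)] .
  finally show ?thesis using z(1) by simp
qed

lemma Nef_eq: "Nef TYPE('k::field) F = convex_classes"
proof (intro equalityI subsetI)
  fix x assume x: "x \<in> Nef TYPE('k) F"
  then obtain a where a: "x = cls a" by (auto simp: Nef_def carrier_Pic)
  show "x \<in> convex_classes"
  proof (rule ccontr)
    assume "x \<notin> convex_classes"
    then obtain P0 where "primitive_collection P0" "deg P0 a < 0"
      unfolding a cls_convex convex_def by (auto simp: not_le)
    then obtain h P where "extremal_by h P" "deg P a < 0" by (rule extremal_exists)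
    then show False using extremal_nef x a by fastforce
  qed
next
  fix x assume "x \<in> convex_classes"
  then show "x \<in> Nef TYPE('k) F"
    using convex_imp_nef by (auto simp: convex_classes_def carrier_Pic convex_def)
qed

lemma convex_classes_carrier: "x \<in> convex_classes \<Longrightarrow> x \<in> carrier (Pic F)"
  by (simp add: convex_classes_def)

lemma convex_classes_one: "\<one>\<^bsub>Pic F\<^esub> \<in> convex_classes"
  by (simp add: convex_classes_def class_deg_one)

lemma convex_classes_mult:
  "x \<in> convex_classes \<Longrightarrow> y \<in> convex_classes \<Longrightarrow> x \<otimes>\<^bsub>Pic F\<^esub> y \<in> convex_classes"
  by (auto simp: convex_classes_def class_deg_mult)

section \<open>Generators of the nef monoid\<close>

text \<open>Additive on convex classes and zero only at the unit, so factorisation into irreducible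
  classes terminates.\<close>

definition class_size :: "('r \<Rightarrow>\<^sub>0 int) set \<Rightarrow> nat" where
  "class_size x = (\<Sum>P | primitive_collection P. nat (class_deg P x))"

lemma class_size_mult:
  assumes "x \<in> convex_classes" "y \<in> convex_classes"
  shows "class_size (x \<otimes>\<^bsub>Pic F\<^esub> y) = class_size x + class_size y"
  unfolding class_size_def sum.distrib[symmetric] using assms
  by (intro sum.cong) (auto simp: convex_classes_def class_deg_mult nat_add_distrib)

lemma class_size_pos:
  assumes "x \<in> convex_classes" "x \<noteq> \<one>\<^bsub>Pic F\<^esub>"
  shows "0 < class_size x"
proof (rule ccontr)
  assume "\<not> 0 < class_size x"
  then have "nat (class_deg P x) = 0" if "primitive_collection P" for P
    using that finite_primitive by (simp add: class_size_def)
  then have "class_deg P x = 0" if "primitive_collection P" for P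
    using that assms(1) by (force simp: convex_classes_def intro: antisym)
  then show False using class_deg_zero_imp_one assms convex_classes_carrier by blast
qed

definition irreducible_classes :: "('r \<Rightarrow>\<^sub>0 int) set set" where
  "irreducible_classes = {x \<in> convex_classes. x \<noteq> \<one>\<^bsub>Pic F\<^esub> \<and>
     (\<forall>y\<in>convex_classes. \<forall>z\<in>convex_classes. x = y \<otimes>\<^bsub>Pic F\<^esub> z \<longrightarrow> y = \<one>\<^bsub>Pic F\<^esub> \<or> z = \<one>\<^bsub>Pic F\<^esub>)}"

lemma convex_classes_difference:
  assumes "x \<in> convex_classes" "y \<in> convex_classes"
    and "\<And>P. primitive_collection P \<Longrightarrow> nat (class_deg P x) \<le> nat (class_deg P y)"
  shows "y \<otimes>\<^bsub>Pic F\<^esub> inv\<^bsub>Pic F\<^esub> x \<in> convex_classes"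
  using assms by (auto simp: convex_classes_def class_deg_mult class_deg_inv nat_le_eq_zle)

lemma eq_if_quotient_one:
  assumes "x \<in> carrier (Pic F)" "y \<in> carrier (Pic F)" "y \<otimes>\<^bsub>Pic F\<^esub> inv\<^bsub>Pic F\<^esub> x = \<one>\<^bsub>Pic F\<^esub>"
  shows "x = y"
  using assms Pic.inv_equality[of y "inv\<^bsub>Pic F\<^esub> x"] by simp

text \<open>If all degrees of \<open>x\<close> are at most those of \<open>y\<close>, the quotient
  of \<open>y\<close> by \<open>x\<close> is convex and \<open>y\<close> factors through
  \<open>x\<close>; irreducibility of \<open>y\<close> then forces equality. Hence the degree
  vectors form an antichain.\<close>

lemma finite_irreducible: "finite irreducible_classes"
proof (rule dickson_antichain[OF finite_primitive, of _ "\<lambda>x P. nat (class_deg P x)"])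
  fix x y assume x: "x \<in> irreducible_classes" and y: "y \<in> irreducible_classes"
    and le: "\<forall>P\<in>{P. primitive_collection P}. nat (class_deg P x) \<le> nat (class_deg P y)"
  have xy: "x \<in> convex_classes" "y \<in> convex_classes" "x \<in> carrier (Pic F)" "y \<in> carrier (Pic F)"
    using x y convex_classes_carrier by (auto simp: irreducible_classes_def)
  have d: "y \<otimes>\<^bsub>Pic F\<^esub> inv\<^bsub>Pic F\<^esub> x \<in> convex_classes"
    using convex_classes_difference xy le by blast
  have "x \<otimes>\<^bsub>Pic F\<^esub> (y \<otimes>\<^bsub>Pic F\<^esub> inv\<^bsub>Pic F\<^esub> x) = y \<otimes>\<^bsub>Pic F\<^esub> (x \<otimes>\<^bsub>Pic F\<^esub> inv\<^bsub>Pic F\<^esub> x)"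
    using xy(3,4) by (intro Pic.m_lcomm) auto
  then have "y = x \<otimes>\<^bsub>Pic F\<^esub> (y \<otimes>\<^bsub>Pic F\<^esub> inv\<^bsub>Pic F\<^esub> x)"
    using xy(3,4) by simp
  then have "y \<otimes>\<^bsub>Pic F\<^esub> inv\<^bsub>Pic F\<^esub> x = \<one>\<^bsub>Pic F\<^esub>"
    using y x xy d unfolding irreducible_classes_def by blast
  then show "x = y" using eq_if_quotient_one xy by blast
qed

lemma submonoid_generated_closed:
  assumes "C \<subseteq> carrier (Pic F)" "x \<in> submonoid_generated (Pic F) C"
  shows "x \<in> carrier (Pic F)"
  using assms(2) by induction (use assms(1) in auto)

lemma submonoid_generated_mult:
  assumes "C \<subseteq> carrier (Pic F)" "x \<in> submonoid_generated (Pic F) C" "y \<in> submonoid_generated (Pic F) C"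
  shows "x \<otimes>\<^bsub>Pic F\<^esub> y \<in> submonoid_generated (Pic F) C"
  using assms(2)
proof induction
  case one
  then show ?case using assms(3) submonoid_generated_closed[OF assms(1,3)] by simp
next
  case (step c a)
  have "c \<otimes>\<^bsub>Pic F\<^esub> a \<otimes>\<^bsub>Pic F\<^esub> y = c \<otimes>\<^bsub>Pic F\<^esub> (a \<otimes>\<^bsub>Pic F\<^esub> y)"
    using step assms submonoid_generated_closed[OF assms(1)] by (intro Pic.m_assoc) auto
  then show ?case using submonoid_generated.step[OF step(1,3)] by simp
qed

lemma submonoid_generated_incl:
  assumes "C \<subseteq> carrier (Pic F)" "c \<in> C"
  shows "c \<in> submonoid_generated (Pic F) C"
proof -
  have "c \<otimes>\<^bsub>Pic F\<^esub> \<one>\<^bsub>Pic F\<^esub> \<in> submonoid_generated (Pic F) C"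
    by (rule submonoid_generated.step[OF assms(2) submonoid_generated.one])
  then show ?thesis using assms by auto
qed

lemma irreducible_carrier: "irreducible_classes \<subseteq> carrier (Pic F)"
  using convex_classes_carrier by (auto simp: irreducible_classes_def)

lemma generated_irreducible: "submonoid_generated (Pic F) irreducible_classes = convex_classes"
proof (intro equalityI subsetI)
  fix x assume "x \<in> submonoid_generated (Pic F) irreducible_classes"
  then show "x \<in> convex_classes"
    by induction (auto simp: convex_classes_one irreducible_classes_def intro!: convex_classes_mult)
next
  fix x assume "x \<in> convex_classes"
  then show "x \<in> submonoid_generated (Pic F) irreducible_classes"
  proof (induction "class_size x" arbitrary: x rule: less_induct)
    case less
    consider "x = \<one>\<^bsub>Pic F\<^esub>" | "x \<in> irreducible_classes" |
      y z where "y \<in> convex_classes" "z \<in> convex_classes" "x = y \<otimes>\<^bsub>Pic F\<^esub> z" "y \<noteq> \<one>\<^bsub>Pic F\<^esub>" "z \<noteq> \<one>\<^bsub>Pic F\<^esub>"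
      using less.prems unfolding irreducible_classes_def by blast
    then show ?case
    proof cases
      case 1
      then show ?thesis by (simp add: submonoid_generated.one)
    next
      case 2
      then show ?thesis by (rule submonoid_generated_incl[OF irreducible_carrier])
    next
      case 3
      have "class_size y < class_size x" "class_size z < class_size x"
        using 3 class_size_pos class_size_mult by auto
      then have "y \<in> submonoid_generated (Pic F) irreducible_classes"
        "z \<in> submonoid_generated (Pic F) irreducible_classes"
        using less.hyps 3(1,2) by blast+
      then show ?thesis
        unfolding 3(3) by (rule submonoid_generated_mult[OF irreducible_carrier])
    qed
  qed
qed

text \<open>Write an irreducible class as a generator times a remainder. Either the remainder is
  trivial and the class is the generator, or the generator is trivial and the argument continues
  with the remainder.\<close>

lemma irreducible_in_generators:
  assumes C: "C \<subseteq> carrier (Pic F)" "submonoid_generated (Pic F) C = convex_classes"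
  shows "irreducible_classes \<subseteq> C"
proof
  fix x assume x: "x \<in> irreducible_classes"
  then have "x \<in> submonoid_generated (Pic F) C" unfolding C(2) by (simp add: irreducible_classes_def)
  then show "x \<in> C" using x
  proof induction
    case (step c a)
    have "c \<in> convex_classes" using submonoid_generated_incl[OF C(1)] C(2) step(1) by blast
    moreover have "a \<in> convex_classes" using step(2) C(2) by simp
    ultimately have "c = \<one>\<^bsub>Pic F\<^esub> \<or> a = \<one>\<^bsub>Pic F\<^esub>" using step(4) unfolding irreducible_classes_def by blast
    then show ?case
      using step C(1) submonoid_generated_closed[OF C(1) step(2)] by auto
  qed (simp add: irreducible_classes_def)
qed

text \<open>The irreducible classes generate and lie in every generating set, so the definite
  description in \<open>nef_generators\<close> denotes them.\<close>

lemma nef_generators_eq: "nef_generators TYPE('k::field) F = irreducible_classes"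
  unfolding nef_generators_def Nef_eq
proof (rule the_equality)
  show "irreducible_classes \<subseteq> carrier (Pic F) \<and>
    submonoid_generated (Pic F) irreducible_classes = convex_classes \<and>
    (\<forall>C'. C' \<subset> irreducible_classes \<longrightarrow> submonoid_generated (Pic F) C' \<noteq> convex_classes)"
    using irreducible_carrier generated_irreducible irreducible_in_generators by blast
next
  fix C assume "C \<subseteq> carrier (Pic F) \<and> submonoid_generated (Pic F) C = convex_classes \<and>
    (\<forall>C'. C' \<subset> C \<longrightarrow> submonoid_generated (Pic F) C' \<noteq> convex_classes)"
  then show "C = irreducible_classes"
    using irreducible_in_generators generated_irreducible by blast
qed

lemma generator_positive_degree:
  assumes "primitive_collection P"
  obtains c where "c \<in> irreducible_classes" "0 < class_deg P c"
proof -
  have "\<exists>c\<in>irreducible_classes. 0 < class_deg P c"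
    if "x \<in> submonoid_generated (Pic F) irreducible_classes" "0 < class_deg P x" for x
    using that
  proof induction
    case (step c a)
    then show ?case
      using class_deg_mult[of c a P] irreducible_carrier
        submonoid_generated_closed[OF irreducible_carrier step(2)] by force
  qed (simp add: class_deg_one)
  moreover have "cls ample \<in> submonoid_generated (Pic F) irreducible_classes"
    unfolding generated_irreducible using convex_ample by simp
  ultimately show ?thesis using that deg_ample_pos[OF assms] by force
qed

end

section \<open>Nonvanishing local cohomology\<close>

definition inversion_factor :: "('a \<Rightarrow> nat) \<Rightarrow> ('a \<Rightarrow> nat) \<Rightarrow> 'a \<Rightarrow> 'a \<Rightarrow> int" where
  "inversion_factor f g x y = (if f x < f y \<and> g y < g x then - 1 else 1)"

text \<open>A pair counts only in its order by \<open>f\<close>, so each inversion enters once and,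
  for orders without ties, this is the sign of the permutation between the orders by
  \<open>f\<close> and by \<open>g\<close>.\<close>

definition inversion_sign :: "('a \<Rightarrow> nat) \<Rightarrow> ('a \<Rightarrow> nat) \<Rightarrow> 'a set \<Rightarrow> int" where
  "inversion_sign f g I = (\<Prod>x\<in>I. \<Prod>y\<in>I. inversion_factor f g x y)"

lemma inversion_sign_insert:
  assumes "finite R" "x \<notin> R"
  shows "inversion_sign f g (insert x R) =
    inversion_sign f g R * (\<Prod>y\<in>R. inversion_factor f g x y * inversion_factor f g y x)"
proof -
  have "inversion_factor f g x x = 1" by (simp add: inversion_factor_def)
  then show ?thesis
    unfolding inversion_sign_def using assms by (simp add: prod.distrib algebra_simps)
qed

lemma inversion_sign_square: "inversion_sign f g I * inversion_sign f g I = 1"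
  unfolding inversion_sign_def prod.distrib[symmetric] inversion_factor_def
  by (intro prod.neutral ballI) simp

text \<open>The orientation cochain of the simplex \<open>P\<close>, pulled back along \<open>\<psi>\<close>.\<close>

definition orientation :: "('a \<Rightarrow> nat) \<Rightarrow> ('b \<Rightarrow> nat) \<Rightarrow> ('a \<Rightarrow> 'b) \<Rightarrow> 'b set \<Rightarrow> 'a set \<Rightarrow> int" where
  "orientation f q \<psi> P I = (if inj_on \<psi> I \<and> \<psi> ` I = P then inversion_sign f (\<lambda>x. q (\<psi> x)) I else 0)"

text \<open>Only the faces omitting \<open>x\<close> or \<open>y\<close> can map bijectively onto
  \<open>P\<close>. Exchanging \<open>x\<close> for \<open>y\<close> changes the inversion sign by
  the parity of the number of elements between them in the order by \<open>f\<close>, while their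
  positions in \<open>J\<close> differ by one more than this number. So the two terms
  cancel.\<close>

lemma orientation_cocycle_pair:
  assumes J: "finite J" "inj_on f J" and q: "inj_on q P"
    and xy: "x \<in> J" "y \<in> J" "x \<noteq> y" "\<psi> x = \<psi> y" "f x < f y"
    and inj: "inj_on \<psi> (J - {x})" "\<psi> ` (J - {x}) = P"
  shows "(\<Sum>z\<in>J. (-1) ^ card {w\<in>J. f w < f z} * orientation f q \<psi> P (J - {z})) = 0"
proof -
  define R where "R = J - {x, y}"
  have R: "finite R" "x \<notin> R" "y \<notin> R" "J - {x} = insert y R" "J - {y} = insert x R"
    using J xy by (auto simp: R_def)
  have neq: "\<psi> w \<noteq> \<psi> y" if "w \<in> R" for w
    using inj(1) that R(3) unfolding R(4) by (auto simp: inj_on_def)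
  have "inj_on \<psi> R" using inj(1) unfolding R(4) by (simp add: inj_on_insert)
  then have inj': "inj_on \<psi> (J - {y})"
    unfolding R(5) using neq xy(4) R(2) by (auto simp: inj_on_insert image_iff) metis
  have img': "\<psi> ` (J - {y}) = P" using inj(2) xy(4) unfolding R(4,5) by simp
  let ?g = "\<lambda>x. q (\<psi> x)"
  define h where "h = (\<lambda>x y. inversion_factor f ?g x y * inversion_factor f ?g y x)"
  define S where "S = inversion_sign f ?g R"
  define A where "A = (\<Prod>w\<in>R. h x w)"
  define B where "B = (\<Prod>w\<in>R. h y w)"
  define M where "M = {w\<in>R. f x < f w \<and> f w < f y}"
  have oy: "orientation f q \<psi> P (J - {y}) = S * A"
    unfolding orientation_def S_def A_def h_def using inj' img' inversion_sign_insert[OF R(1,2)] R(5) by simp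
  have ox: "orientation f q \<psi> P (J - {x}) = S * B"
    unfolding orientation_def S_def B_def h_def using inj inversion_sign_insert[OF R(1,3)] R(4) by simp
  have AB: "A * B = (-1) ^ card M"
  proof -
    have "A * B = (\<Prod>w\<in>R. if w \<in> M then - 1 else 1)"
      unfolding A_def B_def prod.distrib[symmetric]
    proof (rule prod.cong[OF refl])
      fix w assume w: "w \<in> R"
      have "f w \<noteq> f x" "f w \<noteq> f y"
        using w J(2) xy R(2,3) unfolding R_def by (auto simp: inj_on_def)
      moreover have "q (\<psi> w) \<noteq> q (\<psi> y)"
      proof -
        have "\<psi> w \<in> P" "\<psi> y \<in> P" using inj(2) w unfolding R(4) by auto
        then show ?thesis using q neq[OF w] by (auto simp: inj_on_def)
      qed
      ultimately show "h x w * h y w = (if w \<in> M then - 1 else 1)"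
        using w xy(4,5) unfolding h_def inversion_factor_def M_def by auto
    qed
    also have "\<dots> = (\<Prod>w\<in>M. - 1)"
      using R(1) by (simp add: prod.If_cases M_def Int_def)
    finally show ?thesis by simp
  qed
  have BB: "B * B = 1"
    unfolding B_def prod.distrib[symmetric] h_def inversion_factor_def
    by (intro prod.neutral ballI) simp
  have "(-1) ^ card M * B = A * (B * B)" using AB by (simp add: mult.assoc)
  then have A: "A = (-1) ^ card M * B" using BB by simp
  have cards: "card {w\<in>J. f w < f y} = Suc (card {w\<in>J. f w < f x} + card M)"
  proof -
    have "{w\<in>J. f w < f y} = insert x ({w\<in>J. f w < f x} \<union> M)"
      using xy J(2) unfolding M_def R_def by (auto simp: inj_on_def) (metis linorder_neqE_nat)
    moreover have "{w\<in>J. f w < f x} \<inter> M = {}" "x \<notin> {w\<in>J. f w < f x} \<union> M"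
      using R(2) by (auto simp: M_def)
    ultimately show ?thesis using J(1) R(1) by (simp add: card_Un_disjoint M_def)
  qed
  have "(\<Sum>z\<in>J. (-1) ^ card {w\<in>J. f w < f z} * orientation f q \<psi> P (J - {z}))
      = (\<Sum>z\<in>{x, y}. (-1) ^ card {w\<in>J. f w < f z} * orientation f q \<psi> P (J - {z}))"
  proof (rule sum.mono_neutral_right)
    show "\<forall>z\<in>J - {x, y}. (-1) ^ card {w\<in>J. f w < f z} * orientation f q \<psi> P (J - {z}) = 0"
    proof
      fix z assume "z \<in> J - {x, y}"
      then have "\<not> inj_on \<psi> (J - {z})" using xy unfolding inj_on_def by blast
      then show "(-1) ^ card {w\<in>J. f w < f z} * orientation f q \<psi> P (J - {z}) = 0"
        by (simp add: orientation_def)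
    qed
  qed (use J xy in auto)
  also have "\<dots> = (-1) ^ card {w\<in>J. f w < f x} * (S * B) + (-1) ^ card {w\<in>J. f w < f y} * (S * A)"
    using xy(3) ox oy by simp
  also have "\<dots> = 0"
    unfolding cards A by (simp add: power_add algebra_simps flip: power_mult_distrib)
  finally show ?thesis .
qed

text \<open>A nonzero term gives a face mapping bijectively onto \<open>P\<close>. The omitted
  vertex has the same image as another vertex, and the face omitting that one is bijective too,
  which reduces the claim to a pair with equal images.\<close>

lemma orientation_cocycle:
  assumes J: "finite J" "inj_on f J" and q: "inj_on q P" and \<psi>: "\<psi> ` J \<subseteq> P"
  shows "(\<Sum>z\<in>J. (-1) ^ card {w\<in>J. f w < f z} * orientation f q \<psi> P (J - {z})) = 0"
proof (cases "\<exists>x\<in>J. orientation f q \<psi> P (J - {x}) \<noteq> 0")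
  case True
  then obtain x where x: "x \<in> J" "inj_on \<psi> (J - {x})" "\<psi> ` (J - {x}) = P"
    by (auto simp: orientation_def split: if_splits)
  have "\<psi> x \<in> \<psi> ` (J - {x})" using x \<psi> by blast
  then obtain y where y: "y \<in> J" "y \<noteq> x" "\<psi> x = \<psi> y" by auto
  have y': "inj_on \<psi> (J - {y})" "\<psi> ` (J - {y}) = P"
  proof -
    define r where "r = (\<lambda>u. if u = x then y else u)"
    have "w = w'" if w: "w \<in> J - {y}" "w' \<in> J - {y}" "\<psi> w = \<psi> w'" for w w'
    proof -
      have "\<psi> (r u) = \<psi> u" for u using y(3) by (simp add: r_def)
      moreover have "r u \<in> J - {x}" if "u \<in> J" for u using that y(1,2) by (auto simp: r_def)
      ultimately have "r w = r w'" using x(2) w by (metis DiffD1 inj_onD)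
      then show ?thesis using w(1,2) by (auto simp: r_def split: if_splits)
    qed
    then show "inj_on \<psi> (J - {y})" by (rule inj_onI)
    show "\<psi> ` (J - {y}) = P"
    proof -
      have "J - {x} = insert y (J - {x, y})" "J - {y} = insert x (J - {x, y})" using x y by auto
      then show ?thesis using x(3) y(3) by (metis image_insert)
    qed
  qed
  consider "f x < f y" | "f y < f x"
    using J(2) x(1) y(1,2) by (metis inj_onD linorder_neqE_nat)
  then show ?thesis
  proof cases
    case 1
    then show ?thesis using orientation_cocycle_pair[OF J q x(1) y(1) y(2)[symmetric] y(3) _ x(2,3)] by simp
  next
    case 2
    then show ?thesis using orientation_cocycle_pair[OF J q y(1) x(1) y(2) y(3)[symmetric] _ y'] by simp
  qed
qed (simp add: sum.neutral)

section \<open>Monomials of the Cox ring and the Cech cocycle\<close>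

context projective_fan begin

definition expo :: "('r \<Rightarrow> nat) \<Rightarrow> 'r \<Rightarrow>\<^sub>0 nat" where
  "expo f = (\<Sum>\<rho>\<in>rays F. Poly_Mapping.single \<rho> (f \<rho>))"

lemma lookup_expo: "Poly_Mapping.lookup (expo f) \<rho> = (if \<rho> \<in> rays F then f \<rho> else 0)"
  unfolding expo_def lookup_sum lookup_single by (simp add: when_def)

lemma keys_expo: "Poly_Mapping.keys (expo f) \<subseteq> rays F"
  using lookup_expo in_keys_iff by (metis subsetI)

lemma expo_cong: "(\<And>\<rho>. \<rho> \<in> rays F \<Longrightarrow> f \<rho> = g \<rho>) \<Longrightarrow> expo f = expo g"
  by (simp add: expo_def)

lemma expo_add: "expo f + expo g = expo (\<lambda>\<rho>. f \<rho> + g \<rho>)"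
  by (rule poly_mapping_eqI) (simp add: lookup_add lookup_expo)

lemma expo_sum: "finite A \<Longrightarrow> (\<Sum>x\<in>A. expo (f x)) = expo (\<lambda>\<rho>. \<Sum>x\<in>A. f x \<rho>)"
  by (rule poly_mapping_eqI) (simp add: lookup_sum lookup_expo)

lemma expo_zero: "expo (\<lambda>\<rho>. 0) = 0"
  by (rule poly_mapping_eqI) (simp add: lookup_expo)

lemma monomial_degree_expo: "monomial_degree F (expo f) = cls (\<lambda>\<rho>. int (f \<rho>))"
  unfolding monomial_degree_def cls_def by (metis (no_types, lifting) lookup_expo tdivisor_cong)

lemma irrelevant_exponent_eq: "irrelevant_exponent F \<sigma> = expo (\<lambda>\<rho>. of_bool (\<rho> \<notin> \<sigma>))"
proof (rule poly_mapping_eqI)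
  fix \<rho> show "Poly_Mapping.lookup (irrelevant_exponent F \<sigma>) \<rho> = Poly_Mapping.lookup (expo (\<lambda>\<rho>. of_bool (\<rho> \<notin> \<sigma>))) \<rho>"
    unfolding irrelevant_exponent_def lookup_sum lookup_single lookup_expo by (simp add: when_def)
qed

definition cox_monomial :: "('r \<Rightarrow> nat) \<Rightarrow> 'k::field \<Rightarrow> ('r, 'k) mpoly" where
  "cox_monomial f c = Poly_Mapping.single (expo f) c"

lemma cox_monomial_mult: "cox_monomial f c * cox_monomial g d = cox_monomial (\<lambda>\<rho>. f \<rho> + g \<rho>) (c * d)"
  by (simp add: cox_monomial_def mult_single expo_add)

lemma cox_monomial_one: "cox_monomial (\<lambda>\<rho>. 0) 1 = 1"
  by (simp add: cox_monomial_def expo_zero)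

lemma cox_monomial_zero: "cox_monomial f 0 = 0"
  by (simp add: cox_monomial_def)

lemma cox_monomial_power: "cox_monomial f 1 ^ n = cox_monomial (\<lambda>\<rho>. n * f \<rho>) 1"
  by (induction n) (simp_all add: cox_monomial_one cox_monomial_mult)

lemma cox_monomial_sum: "(\<Sum>x\<in>A. cox_monomial f (c x)) = cox_monomial f (\<Sum>x\<in>A. c x)"
  unfolding cox_monomial_def by (induction A rule: infinite_finite_induct) (auto simp: single_add)

lemma cox_monomial_sign: "(- 1) ^ n * cox_monomial f c = cox_monomial f ((- 1) ^ n * c)"
  by (induction n) (auto simp: cox_monomial_def single_uminus)

lemma cox_monomial_cong: "(\<And>\<rho>. \<rho> \<in> rays F \<Longrightarrow> f \<rho> = g \<rho>) \<Longrightarrow> cox_monomial f c = cox_monomial g c"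
  unfolding cox_monomial_def using expo_cong by metis

text \<open>For a ray \<rho> this is the exponent of its variable in
  \<open>denominator F I\<close>.\<close>

definition mult_count :: "'r set set \<Rightarrow> 'r \<Rightarrow> nat" where
  "mult_count I \<rho> = (\<Sum>\<sigma>\<in>I. of_bool (\<rho> \<notin> \<sigma>))"

lemma irrelevant_generator_eq: "irrelevant_generator F \<sigma> = cox_monomial (\<lambda>\<rho>. of_bool (\<rho> \<notin> \<sigma>)) 1"
  by (simp add: irrelevant_generator_def irrelevant_exponent_eq cox_monomial_def)

lemma denominator_eq: "finite I \<Longrightarrow> denominator F I = cox_monomial (mult_count I) 1"
  unfolding denominator_def irrelevant_generator_eq mult_count_def
  by (induction I rule: finite_induct) (simp_all add: cox_monomial_one cox_monomial_mult del: sum_of_bool_eq)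

lemma denominator_degree_eq: "finite I \<Longrightarrow> denominator_degree F I = cls (\<lambda>\<rho>. int (mult_count I \<rho>))"
  unfolding denominator_degree_def irrelevant_exponent_eq
  by (simp add: expo_sum monomial_degree_expo mult_count_def)

lemma lookup_cox_monomial_mult_zero:
  assumes "\<rho> \<in> rays F" "Poly_Mapping.lookup e \<rho> < f \<rho>"
  shows "Poly_Mapping.lookup (cox_monomial f c * p) e = 0"
proof (rule ccontr)
  assume "Poly_Mapping.lookup (cox_monomial f c * p) e \<noteq> 0"
  then have "e \<in> Poly_Mapping.keys (cox_monomial f c * p)" by (simp add: in_keys_iff)
  then obtain y where "e = expo f + y"
    using keys_mult[of "cox_monomial f c" p] by (auto simp: cox_monomial_def split: if_splits)
  then show False using assms by (simp add: lookup_add lookup_expo)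
qed

text \<open>\<open>H\<^sup>k\<^sub>B(S)\<close> in the multidegree \<open>a\<close> is the reduced cohomology of the boundary of the simplex on the
  primitive collection \<open>P\<close>. The vertex map \<open>\<psi>\<close> sends each cone to a ray of \<open>P\<close> outside of it.\<close>

lemma local_cohomology_nonzero:
  assumes P: "primitive_collection P"
    and neg: "\<And>\<rho>. \<rho> \<in> P \<Longrightarrow> a \<rho> < 0" and nonneg: "\<And>\<rho>. \<rho> \<in> rays F \<Longrightarrow> \<rho> \<notin> P \<Longrightarrow> 0 \<le> a \<rho>"
  shows "\<not> local_cohomology_zero F ((*) :: ('r, 'k::field) mpoly \<Rightarrow> _) (cox_component F) (card P) (cls a)"
proof
  assume lc: "local_cohomology_zero F ((*) :: ('r, 'k) mpoly \<Rightarrow> _) (cox_component F) (card P) (cls a)"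
  obtain q :: "'r \<Rightarrow> nat" where q: "inj_on q P"
    using finite_imp_inj_to_nat_seg[OF primitive_finite[OF P]] by blast
  define f where "f = cone_index F"
  have f: "inj_on f (cones F)"
    unfolding f_def cone_index_def
    using finite_imp_inj_to_nat_seg[OF finite_cones] someI_ex[of "\<lambda>f :: 'r set \<Rightarrow> nat. inj_on f (cones F)"] by blast
  define \<psi> where "\<psi> = (\<lambda>\<sigma>. SOME \<rho>. \<rho> \<in> P - \<sigma>)"
  have \<psi>: "\<psi> \<sigma> \<in> P - \<sigma>" if "\<sigma> \<in> cones F" for \<sigma>
  proof -
    have "\<exists>\<rho>. \<rho> \<in> P - \<sigma>" using face_cone[OF that] primitive_not_cone[OF P] by blast
    then show ?thesis unfolding \<psi>_def by (rule someI_ex)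
  qed
  define z where "z = orientation f q \<psi> P"
  define N where "N = (\<Sum>\<rho>\<in>rays F. nat \<bar>a \<rho>\<bar>)"
  have N: "nat \<bar>a \<rho>\<bar> \<le> N" if "\<rho> \<in> rays F" for \<rho>
    using member_le_sum[of \<rho> "rays F" "\<lambda>\<rho>. nat \<bar>a \<rho>\<bar>"] that by (simp add: N_def)
  \<comment> \<open>The exponent in the numerator when the monomial with exponent \<open>a\<close>
    is written over the N-th power of \<open>denominator F I\<close>. If \<open>z I\<close> is
    nonzero, every ray of \<open>P\<close> is the image of some \<sigma> in \<open>I\<close> and N
    outweighs the negative entry. For all other \<open>I\<close> the coefficient is 0 and truncation
    by \<open>nat\<close> does no harm.\<close>
  define t where "t = (\<lambda>I \<rho>. a \<rho> + int N * int (mult_count I \<rho>))"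
  define m :: "'r set set \<Rightarrow> ('r, 'k) mpoly" where "m = (\<lambda>I. cox_monomial (\<lambda>\<rho>. nat (t I \<rho>)) (of_int (z I)))"
  have fin: "finite I" if "I \<subseteq> cones F" for I using that finite_cones finite_subset by blast
  have t_nonneg: "0 \<le> t I \<rho>" if I: "I \<subseteq> cones F" and z: "z I \<noteq> 0" and \<rho>: "\<rho> \<in> rays F" for I \<rho>
  proof (cases "\<rho> \<in> P")
    case True
    then obtain \<sigma> where \<sigma>: "\<sigma> \<in> I" "\<psi> \<sigma> = \<rho>" using z by (auto simp: z_def orientation_def split: if_splits)
    then have "\<rho> \<notin> \<sigma>" using \<psi>[of \<sigma>] I by auto
    then have "1 \<le> mult_count I \<rho>"
      unfolding mult_count_def using member_le_sum[of \<sigma> I "\<lambda>\<sigma>. of_bool (\<rho> \<notin> \<sigma>) :: nat"] \<sigma>(1) fin[OF I] by auto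
    then have "int N * 1 \<le> int N * int (mult_count I \<rho>)" by (intro mult_left_mono) auto
    then show ?thesis using N[OF \<rho>] by (simp add: t_def)
  qed (use nonneg[OF \<rho>] in \<open>simp add: t_def\<close>)
  have cochain: "cech_cochain F (cox_component F) (card P) (cls a) N m"
    unfolding cech_cochain_def
  proof (intro allI impI)
    fix I assume I: "I \<subseteq> cones F"
    have deg: "cls a \<otimes>\<^bsub>Pic F\<^esub> denominator_degree F I [^]\<^bsub>Pic F\<^esub> N = cls (t I)"
      unfolding denominator_degree_eq[OF fin[OF I]] cls_pow cls_add t_def ..
    show "m I \<in> cox_component F (cls a \<otimes>\<^bsub>Pic F\<^esub> denominator_degree F I [^]\<^bsub>Pic F\<^esub> N)"
    proof (cases "z I = 0")
      case False
      have "cls (\<lambda>\<rho>. int (nat (t I \<rho>))) = cls (t I)"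
        using t_nonneg[OF I False] by (intro cls_cong) simp
      then show ?thesis
        unfolding cox_component_def deg m_def cox_monomial_def using keys_expo monomial_degree_expo by auto
    qed (simp add: m_def cox_monomial_zero cox_component_def)
  qed
  have cocycle: "cech_differential F (*) N m J = 0" if J: "J \<subseteq> cones F" for J
  proof -
    have "cech_differential F (*) N m J =
        (\<Sum>\<sigma>\<in>J. cox_monomial (\<lambda>\<rho>. nat (t J \<rho>)) (of_int ((- 1) ^ card {\<tau>\<in>J. f \<tau> < f \<sigma>} * z (J - {\<sigma>}))))"
      unfolding cech_differential_def f_def[symmetric]
    proof (rule sum.cong[OF refl])
      fix \<sigma> assume \<sigma>: "\<sigma> \<in> J"
      let ?s = "(- 1) ^ card {\<tau>\<in>J. f \<tau> < f \<sigma>}"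
      have "irrelevant_generator F \<sigma> ^ N * m (J - {\<sigma>}) = cox_monomial (\<lambda>\<rho>. nat (t J \<rho>)) (of_int (z (J - {\<sigma>})))"
      proof (cases "z (J - {\<sigma>}) = 0")
        case False
        have "mult_count J \<rho> = of_bool (\<rho> \<notin> \<sigma>) + mult_count (J - {\<sigma>}) \<rho>" for \<rho>
          unfolding mult_count_def using \<sigma> fin[OF J] by (rule sum.remove[rotated])
        then have t: "t J \<rho> = int (N * of_bool (\<rho> \<notin> \<sigma>)) + t (J - {\<sigma>}) \<rho>" for \<rho>
          by (simp add: t_def algebra_simps)
        have nt: "nat (t J \<rho>) = N * of_bool (\<rho> \<notin> \<sigma>) + nat (t (J - {\<sigma>}) \<rho>)" if "\<rho> \<in> rays F" for \<rho>
          unfolding t using t_nonneg[OF _ False that] J by (subst nat_add_distrib) auto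
        show ?thesis
          unfolding irrelevant_generator_eq cox_monomial_power m_def cox_monomial_mult mult_1
          by (rule cox_monomial_cong) (simp add: nt)
      qed (simp add: m_def cox_monomial_zero)
      then show "(?s * irrelevant_generator F \<sigma> ^ N) * m (J - {\<sigma>}) = cox_monomial (\<lambda>\<rho>. nat (t J \<rho>)) (of_int (?s * z (J - {\<sigma>})))"
        by (simp add: mult.assoc cox_monomial_sign)
    qed
    also have "\<dots> = cox_monomial (\<lambda>\<rho>. nat (t J \<rho>)) (of_int (\<Sum>\<sigma>\<in>J. (- 1) ^ card {\<tau>\<in>J. f \<tau> < f \<sigma>} * z (J - {\<sigma>})))"
      unfolding cox_monomial_sum of_int_sum ..
    also have "(\<Sum>\<sigma>\<in>J. (- 1) ^ card {\<tau>\<in>J. f \<tau> < f \<sigma>} * z (J - {\<sigma>})) = 0"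
      unfolding z_def
      by (rule orientation_cocycle[OF fin[OF J] inj_on_subset[OF f J] q]) (use \<psi> J in auto)
    finally show ?thesis by (simp add: cox_monomial_zero)
  qed
  \<comment> \<open>The facets of the simplex on \<open>P\<close>. Among them only P - {\<rho>} has
    a generator divisible by the variable of \<rho>, so omitting it loses the pole along \<rho> that
    the monomial with exponent \<open>a\<close> needs.\<close>
  define I0 where "I0 = (\<lambda>\<rho>. P - {\<rho>}) ` P"
  have I0: "I0 \<subseteq> cones F" unfolding I0_def using primitive_subset[OF P] by blast
  have cI0: "card I0 = card P"
    unfolding I0_def by (rule card_image) (auto simp: inj_on_def)
  have \<psi>I0: "\<psi> (P - {\<rho>}) = \<rho>" if "\<rho> \<in> P" for \<rho>
    using \<psi>[of "P - {\<rho>}"] I0 that unfolding I0_def by auto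
  have "inj_on \<psi> I0" "\<psi> ` I0 = P"
    unfolding I0_def using \<psi>I0 by (auto simp: inj_on_def image_image)
  \<comment> \<open>A sign has square 1, so it stays nonzero in every characteristic.\<close>
  then have "z I0 * z I0 = 1" unfolding z_def orientation_def using inversion_sign_square by simp
  then have "of_int (z I0) * of_int (z I0) = (1 :: 'k)" by (metis of_int_1 of_int_mult)
  then have z0: "of_int (z I0) \<noteq> (0 :: 'k)" by auto
  have mc: "mult_count I0 \<rho> = 1" if "\<rho> \<in> P" for \<rho>
  proof -
    have "mult_count I0 \<rho> = (\<Sum>\<sigma>\<in>{P - {\<rho>}}. of_bool (\<rho> \<notin> \<sigma>))"
      unfolding mult_count_def by (rule sum.mono_neutral_right) (use that fin[OF I0] in \<open>auto simp: I0_def\<close>)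
    then show ?thesis by simp
  qed
  have "\<forall>J\<subseteq>cones F. card J = Suc (card P) \<longrightarrow>
     fraction_eq (*) (denominator F J) (cech_differential F (*) N m J, N) (0, 0)"
    using cocycle by (simp add: fraction_eq_def)
  with lc cochain obtain k n where
    "\<forall>I\<subseteq>cones F. card I = card P \<longrightarrow> fraction_eq (*) (denominator F I) (m I, N) (cech_differential F (*) k n I, k)"
    unfolding local_cohomology_zero_def by blast
  then have "fraction_eq (*) (denominator F I0) (m I0, N) (cech_differential F (*) k n I0, k)"
    using I0 cI0 by blast
  then obtain l where l: "denominator F I0 ^ l *
      (denominator F I0 ^ k * m I0 - denominator F I0 ^ N * cech_differential F (*) k n I0) = 0"
    unfolding fraction_eq_def by auto
  let ?E = "mult_count I0"
  \<comment> \<open>The exponent of the cocycle at \<open>I0\<close> once denominators are cleared;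
    the coefficients of this monomial are compared.\<close>
  define K where "K = (\<lambda>\<rho>. l * ?E \<rho> + (k * ?E \<rho> + nat (t I0 \<rho>)))"
  have "cox_monomial K (of_int (z I0)) = denominator F I0 ^ l * (denominator F I0 ^ k * m I0)"
    unfolding K_def m_def denominator_eq[OF fin[OF I0]] cox_monomial_power cox_monomial_mult by simp
  also have "\<dots> = denominator F I0 ^ l * (denominator F I0 ^ N * cech_differential F (*) k n I0)"
    using l by (simp add: right_diff_distrib)
  also have "\<dots> = (\<Sum>\<sigma>\<in>I0. cox_monomial (\<lambda>\<rho>. l * ?E \<rho> + (N * ?E \<rho> + k * of_bool (\<rho> \<notin> \<sigma>))) 1 *
      ((- 1) ^ card {\<tau>\<in>I0. f \<tau> < f \<sigma>} * n (I0 - {\<sigma>})))"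
    unfolding cech_differential_def sum_distrib_left denominator_eq[OF fin[OF I0]] cox_monomial_power
      irrelevant_generator_eq f_def[symmetric]
  proof (rule sum.cong[OF refl])
    fix \<sigma>
    have "cox_monomial (\<lambda>\<rho>. l * ?E \<rho> + (N * ?E \<rho> + k * of_bool (\<rho> \<notin> \<sigma>))) (1 :: 'k) =
       cox_monomial (\<lambda>\<rho>. l * ?E \<rho>) 1 * (cox_monomial (\<lambda>\<rho>. N * ?E \<rho>) 1 * cox_monomial (\<lambda>\<rho>. k * of_bool (\<rho> \<notin> \<sigma>)) 1)"
      unfolding cox_monomial_mult by simp
    then show "cox_monomial (\<lambda>\<rho>. l * ?E \<rho>) 1 * (cox_monomial (\<lambda>\<rho>. N * ?E \<rho>) 1 *
        ((- 1) ^ card {\<tau>\<in>I0. f \<tau> < f \<sigma>} * cox_monomial (\<lambda>\<rho>. k * of_bool (\<rho> \<notin> \<sigma>)) 1 * n (I0 - {\<sigma>}))) =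
      cox_monomial (\<lambda>\<rho>. l * ?E \<rho> + (N * ?E \<rho> + k * of_bool (\<rho> \<notin> \<sigma>))) 1 *
      ((- 1) ^ card {\<tau>\<in>I0. f \<tau> < f \<sigma>} * n (I0 - {\<sigma>}))"
      by (simp only: ac_simps)
  qed
  finally have "Poly_Mapping.lookup (cox_monomial K (of_int (z I0))) (expo K) = Poly_Mapping.lookup
      (\<Sum>\<sigma>\<in>I0. cox_monomial (\<lambda>\<rho>. l * ?E \<rho> + (N * ?E \<rho> + k * of_bool (\<rho> \<notin> \<sigma>))) 1 *
      ((- 1) ^ card {\<tau>\<in>I0. f \<tau> < f \<sigma>} * n (I0 - {\<sigma>}))) (expo K)" by (rule arg_cong)
  also have "\<dots> = 0"
    unfolding lookup_sum
  proof (intro sum.neutral ballI)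
    fix \<sigma> assume "\<sigma> \<in> I0"
    then obtain \<rho> where \<rho>: "\<rho> \<in> P" "\<sigma> = P - {\<rho>}" by (auto simp: I0_def)
    then have r: "\<rho> \<in> rays F" using primitive_rays[OF P] by blast
    \<comment> \<open>A negative \<open>a \<rho>\<close> keeps the exponent of the cocycle at \<rho>
      below l + N + k, which the monomial factor of this summand already has.\<close>
    have "nat (t I0 \<rho>) < N" using neg[OF \<rho>(1)] N[OF r] mc[OF \<rho>(1)] by (simp add: t_def)
    then have lt: "Poly_Mapping.lookup (expo K) \<rho> < l * ?E \<rho> + (N * ?E \<rho> + k * of_bool (\<rho> \<notin> \<sigma>))"
      using r \<rho> mc[OF \<rho>(1)] by (simp add: lookup_expo K_def)
    show "Poly_Mapping.lookup (cox_monomial (\<lambda>\<rho>. l * ?E \<rho> + (N * ?E \<rho> + k * of_bool (\<rho> \<notin> \<sigma>))) 1 *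
      ((- 1) ^ card {\<tau>\<in>I0. f \<tau> < f \<sigma>} * n (I0 - {\<sigma>}))) (expo K) = 0"
      by (rule lookup_cox_monomial_mult_zero[OF r]) (fact lt)
  qed
  finally show False using z0 by (simp add: cox_monomial_def)
qed

end

section \<open>Regular classes are nef\<close>

context projective_fan begin

lemma nef_combination_single:
  assumes "c \<in> irreducible_classes"
  shows "nef_combination TYPE('k::field) F (\<lambda>x. if x = c then n else 0) = c [^]\<^bsub>Pic F\<^esub> n"
proof -
  have c: "irreducible_classes \<subseteq> carrier (Pic F)" by (rule irreducible_carrier)
  have "nef_combination TYPE('k) F (\<lambda>x. if x = c then n else 0)
    = (\<Otimes>\<^bsub>Pic F\<^esub>x\<in>irreducible_classes. if c = x then x [^]\<^bsub>Pic F\<^esub> n else \<one>\<^bsub>Pic F\<^esub>)"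
    unfolding nef_combination_def nef_generators_eq
    by (rule Pic.finprod_cong') (use c in auto)
  also have "\<dots> = c [^]\<^bsub>Pic F\<^esub> n"
    by (rule Pic.finprod_singleton[OF assms finite_irreducible]) (use c in auto)
  finally show ?thesis .
qed

lemma regular_imp_convex:
  assumes "d \<in> reg_cox TYPE('k::field) F"
  shows "d \<in> convex_classes"
proof (rule ccontr)
  assume not_convex: "d \<notin> convex_classes"
  have "d \<in> carrier (Pic F)" and
    reg: "regular F ((*) :: ('r, 'k) mpoly \<Rightarrow> _) (cox_component F) d"
    using assms by (auto simp: reg_cox_def reg_def)
  then obtain a0 where a0: "d = cls a0" by (auto simp: carrier_Pic)
  obtain P0 where "primitive_collection P0" "deg P0 a0 < 0"
    using not_convex unfolding a0 cls_convex convex_def by (auto simp: not_le)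
  then obtain h P where P: "extremal_by h P" and neg: "deg P a0 < 0" by (rule extremal_exists)
  then have prim: "primitive_collection P" and h0: "deg P h = 0" by (auto simp: extremal_by_def)
  obtain \<rho>0 where \<rho>0: "\<rho>0 \<in> P" using primitive_nonempty[OF prim] by blast
  have kpos: "0 < card P" using primitive_finite[OF prim] \<rho>0 by (auto simp: card_gt_0_iff)
  obtain c where c: "c \<in> irreducible_classes" "0 < class_deg P c"
    by (rule generator_positive_degree[OF prim])
  then obtain cc where cc: "c = cls cc" using irreducible_carrier by (auto simp: carrier_Pic)
  define k where "k = int (card P)"
  \<comment> \<open>In cohomological degree k, regularity allows k - 1 generators to be subtracted;
    all of them are taken equal to \<open>cc\<close>.\<close>
  define d' where "d' = (\<lambda>\<rho>. a0 \<rho> - (k - 1) * cc \<rho>)"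
  define L where "L = - deg P d'"
  have "(k - 1) * 1 \<le> (k - 1) * deg P cc"
    using c(2) kpos by (intro mult_left_mono) (auto simp: cc k_def)
  then have L: "k \<le> L" using neg by (simp add: L_def d'_def deg_diff deg_mult)
  \<comment> \<open>Coefficient -1 on each of the k rays of \<open>P\<close>, with the surplus L - k
    placed at \<rho>0, so that the degree on \<open>P\<close> is that of \<open>d'\<close>.\<close>
  define a1 where "a1 = (\<lambda>\<rho>. (-1) * ind P \<rho> - (L - k) * ind {\<rho>0} \<rho>)"
  have degP: "deg P b = ev (ind P) b" if "\<And>\<rho>. \<rho> \<notin> P \<Longrightarrow> b \<rho> = 0" for b
    unfolding deg_alt using ev_zero[of "nf (ind P)" b] primitive_disjoint[OF prim] that by force
  have evP: "ev (ind P) b = (\<Sum>\<rho>\<in>P. b \<rho>)" for b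
    unfolding ev_def ind_def using primitive_rays[OF prim]
    by (intro sum.mono_neutral_cong_right) auto
  have "deg P (ind P) = k"
    by (subst degP) (auto simp: ind_def evP k_def)
  moreover have "deg P (ind {\<rho>0}) = 1"
    by (subst degP) (use \<rho>0 primitive_finite[OF prim] in \<open>auto simp: ind_def evP\<close>)
  ultimately have a1: "deg P a1 = - L"
    unfolding a1_def deg_diff deg_mult by simp
  define \<delta> where "\<delta> = (\<lambda>\<rho>. d' \<rho> - a1 \<rho>)"
  define M where "M = (\<Sum>Q | primitive_collection Q. \<bar>deg Q \<delta>\<bar>)"
  have M: "\<bar>deg Q \<delta>\<bar> \<le> M" if "primitive_collection Q" for Q
    using member_le_sum[of Q "{Q. primitive_collection Q}" "\<lambda>Q. \<bar>deg Q \<delta>\<bar>"] that finite_primitive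
    by (simp add: M_def)
  have M0: "0 \<le> M" unfolding M_def by (rule sum_nonneg) simp
  \<comment> \<open>The degree of \<delta> on \<open>P\<close> is 0, as is that of \<open>h\<close>;
    on all other relations M times \<open>h\<close> outweighs \<delta>.\<close>
  define \<epsilon> where "\<epsilon> = (\<lambda>\<rho>. \<delta> \<rho> + M * h \<rho>)"
  have \<epsilon>: "deg Q \<epsilon> = deg Q \<delta> + M * deg Q h" for Q
    unfolding \<epsilon>_def deg_add deg_mult ..
  have \<delta>P: "deg P \<delta> = 0" unfolding \<delta>_def deg_diff a1 L_def by simp
  have "convex \<epsilon>"
    unfolding convex_def
  proof (intro allI impI)
    fix Q assume Q: "primitive_collection Q"
    show "0 \<le> deg Q \<epsilon>"
    proof (cases "Q = P")
      case False
      then have "1 \<le> deg Q h" using P Q by (auto simp: extremal_by_def)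
      then have "M * 1 \<le> M * deg Q h" using M0 by (rule mult_left_mono)
      then show ?thesis using M[OF Q] by (simp add: \<epsilon>)
    qed (simp add: \<epsilon> \<delta>P h0)
  qed
  \<comment> \<open>Vanishing on the negative part of the relation turns the degree 0 on
    \<open>P\<close> into a sum of nonnegative coefficients over \<open>P\<close>, all of which must
    be 0.\<close>
  then obtain m where m: "\<forall>\<rho>\<in>{\<rho>. nf (ind P) \<rho> \<noteq> 0}. \<epsilon> \<rho> + pairing F m \<rho> = 0"
    "\<forall>\<rho>\<in>rays F. 0 \<le> \<epsilon> \<rho> + pairing F m \<rho>"
    using effective_representative[OF _ nf_supp] by blast
  define p where "p = (\<lambda>\<rho>. \<epsilon> \<rho> + pairing F m \<rho>)"
  have "deg P p = 0" unfolding p_def deg_add_pairing \<epsilon> \<delta>P h0 by simp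
  moreover have "deg P p = (\<Sum>\<rho>\<in>P. p \<rho>)"
    unfolding deg_alt evP using ev_zero[of "nf (ind P)" p] m(1) by (simp add: p_def)
  ultimately have p0: "\<forall>\<rho>\<in>P. p \<rho> = 0"
    using sum_nonneg_eq_0_iff[OF primitive_finite[OF prim], of p] m(2) primitive_rays[OF prim]
    by (auto simp: p_def)
  define a where "a = (\<lambda>\<rho>. a1 \<rho> + p \<rho>)"
  have "\<not> local_cohomology_zero F ((*) :: ('r, 'k) mpoly \<Rightarrow> _) (cox_component F) (card P) (cls a)"
  proof (rule local_cohomology_nonzero[OF prim])
    show "a \<rho> < 0" if "\<rho> \<in> P" for \<rho>
      using that p0 L by (auto simp: a_def a1_def ind_def)
    show "0 \<le> a \<rho>" if "\<rho> \<in> rays F" "\<rho> \<notin> P" for \<rho>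
      using that m(2) \<rho>0 by (auto simp: a_def a1_def ind_def p_def)
  qed
  moreover have "local_cohomology_zero F ((*) :: ('r, 'k) mpoly \<Rightarrow> _) (cox_component F) (card P) (cls a)"
  proof -
    let ?l = "\<lambda>x. if x = c then card P - 1 else 0"
    \<comment> \<open>The multiple of \<open>h\<close> is the nef summand that
      \<open>regular\<close> leaves free.\<close>
    have "convex (\<lambda>\<rho>. M * h \<rho>)"
      using extremal_convex[OF P] M0 by (simp add: convex_def deg_mult)
    then have nef: "cls (\<lambda>\<rho>. M * h \<rho>) \<in> Nef TYPE('k) F" unfolding Nef_eq by simp
    have sum: "(\<Sum>x\<in>nef_generators TYPE('k) F. ?l x) = card P - 1"
      unfolding nef_generators_eq using c(1) finite_irreducible by simp
    have comb: "nef_combination TYPE('k) F ?l = cls (\<lambda>\<rho>. int (card P - 1) * cc \<rho>)"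
      unfolding nef_combination_single[OF c(1)] unfolding cc cls_pow ..
    have "cls a = cls (\<lambda>\<rho>. (d' \<rho> + M * h \<rho>) + pairing F m \<rho>)"
      by (rule cls_cong) (simp add: a_def p_def \<epsilon>_def \<delta>_def)
    also have "\<dots> = cls (\<lambda>\<rho>. d' \<rho> + M * h \<rho>)" by (rule cls_pairing)
    also have "\<dots> = cls (\<lambda>\<rho>. a0 \<rho> + - (int (card P - 1) * cc \<rho>) + M * h \<rho>)"
      using kpos by (intro cls_cong) (simp add: d'_def k_def of_nat_diff)
    also have "\<dots> = d \<otimes>\<^bsub>Pic F\<^esub> inv\<^bsub>Pic F\<^esub> (nef_combination TYPE('k) F ?l) \<otimes>\<^bsub>Pic F\<^esub> cls (\<lambda>\<rho>. M * h \<rho>)"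
      unfolding comb a0 cls_inv cls_add ..
    finally have eq: "cls a = \<dots>" .
    show ?thesis
      unfolding eq using conjunct1[OF reg[unfolded regular_def]] kpos sum nef by blast
  qed
  ultimately show False by blast
qed

end

theorem theorem3p1:
  fixes F :: "'r fan"
  assumes "smooth_projective_fan F"
  shows "reg_cox TYPE('k::field) F \<subseteq> Nef TYPE('k) F \<and>
         finite {d \<in> reg_cox TYPE('k) F.
           \<forall>d'\<in>reg_cox TYPE('k) F. nef_le TYPE('k) F d' d \<longrightarrow> d' = d}"
proof
  interpret projective_fan F by standard (rule assms)
  show sub: "reg_cox TYPE('k) F \<subseteq> Nef TYPE('k) F"
    unfolding Nef_eq using regular_imp_convex by blast
  show "finite {d \<in> reg_cox TYPE('k) F. \<forall>d'\<in>reg_cox TYPE('k) F. nef_le TYPE('k) F d' d \<longrightarrow> d' = d}"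
  proof (rule dickson_antichain[OF finite_primitive, of _ "\<lambda>x P. nat (class_deg P x)"])
    fix x y
    assume x: "x \<in> {d \<in> reg_cox TYPE('k) F. \<forall>d'\<in>reg_cox TYPE('k) F. nef_le TYPE('k) F d' d \<longrightarrow> d' = d}"
      and y: "y \<in> {d \<in> reg_cox TYPE('k) F. \<forall>d'\<in>reg_cox TYPE('k) F. nef_le TYPE('k) F d' d \<longrightarrow> d' = d}"
      and le: "\<forall>P\<in>{P. primitive_collection P}. nat (class_deg P x) \<le> nat (class_deg P y)"
    \<comment> \<open>Regular classes are nef, so their degrees are nonnegative and
      \<open>nat\<close> loses nothing. The coordinatewise inequality makes the quotient nef, and
      minimality of \<open>y\<close> gives equality.\<close>
    have "nef_le TYPE('k) F x y"
      unfolding nef_le_def Nef_eq using x y le regular_imp_convex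
      by (intro convex_classes_difference) auto
    then show "x = y" using x y by blast
  qed
qed

end
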